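(* Let $R$ be an AB ring, and let $M$ and $N$ be finitely generated $R$-modules. Then $\operatorname{Ext}^i_R(M,N)=0$ for all $i\gg 0$ if and only if $\operatorname{Ext}^i_R(N,M)=0$ for all $i\gg 0$.
   Context: Local rings are commutative Noetherian local rings. The Ext-index of a commutative ring $R$ is $\sup\{n \mid \operatorname{Ext}^i_R(M,N)=0 \text{ for all } i>n \text{ and } \operatorname{Ext}^n_R(M,N)\neq 0\}$, where the supremum is taken over all pairs $(M,N)$ of finitely generated $R$-modules with $\operatorname{Ext}^i_R(M,N)=0$ for all $i\gg 0$. An AB ring is a local Gorenstein ring of finite Ext-index. *)

theory Defs
  imports "HOL-Algebra.Module" "HOL-Algebra.Ring_Divisibility" "HOL-Algebra.Elementary_Groups" "HOL-Library.Extended_Nat"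
begin

section \<open>Modules and linear maps\<close>

text \<open>The multiplicative fields of a record of type \<^typ>\<open>('a, 'm) module\<close> play no
  role in the locale \<^locale>\<open>module\<close>; below they are left unspecified.\<close>

definition fg_module :: "'a ring \<Rightarrow> ('a, 'm) module \<Rightarrow> bool" where
  "fg_module R M \<longleftrightarrow> module R M \<and>
     (\<exists>A. finite A \<and> A \<subseteq> carrier M \<and> (\<forall>H. submodule H R M \<and> A \<subseteq> H \<longrightarrow> H = carrier M))"

text \<open>Linear maps are extensional (\<^term>\<open>undefined\<close> off the carrier), so that they are determined
  by their values on the carrier and the sets of maps below are the actual Hom sets.\<close>

definition lin_maps :: "'a ring \<Rightarrow> ('a, 'm) module \<Rightarrow> ('a, 'n) module \<Rightarrow> ('m \<Rightarrow> 'n) set" where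
  "lin_maps R M N = {f \<in> carrier M \<rightarrow>\<^sub>E carrier N.
     (\<forall>x\<in>carrier M. \<forall>y\<in>carrier M. f (x \<oplus>\<^bsub>M\<^esub> y) = f x \<oplus>\<^bsub>N\<^esub> f y) \<and>
     (\<forall>a\<in>carrier R. \<forall>x\<in>carrier M. f (a \<odot>\<^bsub>M\<^esub> x) = a \<odot>\<^bsub>N\<^esub> f x)}"

definition hom_module :: "'a ring \<Rightarrow> ('a, 'm) module \<Rightarrow> ('a, 'n) module \<Rightarrow> ('a, 'm \<Rightarrow> 'n) module" where
  "hom_module R M N = \<lparr>carrier = lin_maps R M N, mult = undefined, one = undefined,
     zero = (\<lambda>x\<in>carrier M. \<zero>\<^bsub>N\<^esub>),
     add = (\<lambda>f g. \<lambda>x\<in>carrier M. f x \<oplus>\<^bsub>N\<^esub> g x),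
     smult = (\<lambda>a f. \<lambda>x\<in>carrier M. a \<odot>\<^bsub>N\<^esub> f x)\<rparr>"

definition regular_module :: "'a ring \<Rightarrow> ('a, 'a) module" where
  "regular_module R = \<lparr>carrier = carrier R, mult = undefined, one = undefined,
     zero = \<zero>\<^bsub>R\<^esub>, add = add R, smult = mult R\<rparr>"

definition free_module :: "'a ring \<Rightarrow> 'i set \<Rightarrow> ('a, 'i \<Rightarrow> 'a) module" where
  "free_module R S = \<lparr>carrier = {f \<in> S \<rightarrow>\<^sub>E carrier R. finite {s \<in> S. f s \<noteq> \<zero>\<^bsub>R\<^esub>}},
     mult = undefined, one = undefined,
     zero = (\<lambda>s\<in>S. \<zero>\<^bsub>R\<^esub>),
     add = (\<lambda>f g. \<lambda>s\<in>S. f s \<oplus>\<^bsub>R\<^esub> g s),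
     smult = (\<lambda>a f. \<lambda>s\<in>S. a \<otimes>\<^bsub>R\<^esub> f s)\<rparr>"


section \<open>Ext\<close>

text \<open>A free resolution
  \<open>\<dots> \<rightarrow> free_module R (S 1) \<rightarrow> free_module R (S 0) \<rightarrow> M \<rightarrow> 0\<close>
  with differentials \<open>d n : free_module R (S (Suc n)) \<rightarrow> free_module R (S n)\<close> and
  augmentation \<open>e\<close>.\<close>

definition free_resolution ::
  "'a ring \<Rightarrow> ('a, 'm) module \<Rightarrow> (nat \<Rightarrow> 'i set) \<Rightarrow> (nat \<Rightarrow> ('i \<Rightarrow> 'a) \<Rightarrow> ('i \<Rightarrow> 'a)) \<Rightarrow>
     (('i \<Rightarrow> 'a) \<Rightarrow> 'm) \<Rightarrow> bool" where
  "free_resolution R M S d e \<longleftrightarrow>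
     e \<in> lin_maps R (free_module R (S 0)) M \<and>
     (\<forall>n. d n \<in> lin_maps R (free_module R (S (Suc n))) (free_module R (S n))) \<and>
     e ` carrier (free_module R (S 0)) = carrier M \<and>
     d 0 ` carrier (free_module R (S 1)) = a_kernel (free_module R (S 0)) M e \<and>
     (\<forall>n. d (Suc n) ` carrier (free_module R (S (Suc (Suc n)))) =
            a_kernel (free_module R (S (Suc n))) (free_module R (S n)) (d n))"

definition ext_coboundary ::
  "'a ring \<Rightarrow> (nat \<Rightarrow> 'i set) \<Rightarrow> (nat \<Rightarrow> ('i \<Rightarrow> 'a) \<Rightarrow> ('i \<Rightarrow> 'a)) \<Rightarrow> nat \<Rightarrow>
     (('i \<Rightarrow> 'a) \<Rightarrow> 'n) \<Rightarrow> ('i \<Rightarrow> 'a) \<Rightarrow> 'n" where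
  "ext_coboundary R S d i f = compose (carrier (free_module R (S (Suc i)))) f (d i)"

definition ext_cocycles ::
  "'a ring \<Rightarrow> (nat \<Rightarrow> 'i set) \<Rightarrow> (nat \<Rightarrow> ('i \<Rightarrow> 'a) \<Rightarrow> ('i \<Rightarrow> 'a)) \<Rightarrow> ('a, 'n) module \<Rightarrow> nat \<Rightarrow>
     (('i \<Rightarrow> 'a) \<Rightarrow> 'n) set" where
  "ext_cocycles R S d N i =
     a_kernel (hom_module R (free_module R (S i)) N) (hom_module R (free_module R (S (Suc i))) N)
       (ext_coboundary R S d i)"

fun ext_coboundaries ::
  "'a ring \<Rightarrow> (nat \<Rightarrow> 'i set) \<Rightarrow> (nat \<Rightarrow> ('i \<Rightarrow> 'a) \<Rightarrow> ('i \<Rightarrow> 'a)) \<Rightarrow> ('a, 'n) module \<Rightarrow> nat \<Rightarrow>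
     (('i \<Rightarrow> 'a) \<Rightarrow> 'n) set" where
  "ext_coboundaries R S d N 0 = {\<zero>\<^bsub>hom_module R (free_module R (S 0)) N\<^esub>}"
| "ext_coboundaries R S d N (Suc i) =
     ext_coboundary R S d i ` carrier (hom_module R (free_module R (S i)) N)"

definition ext_of_resolution ::
  "'a ring \<Rightarrow> (nat \<Rightarrow> 'i set) \<Rightarrow> (nat \<Rightarrow> ('i \<Rightarrow> 'a) \<Rightarrow> ('i \<Rightarrow> 'a)) \<Rightarrow> ('a, 'n) module \<Rightarrow> nat \<Rightarrow>
     (('i \<Rightarrow> 'a) \<Rightarrow> 'n) set monoid" where
  "ext_of_resolution R S d N i =
     (hom_module R (free_module R (S i)) N)\<lparr>carrier := ext_cocycles R S d N i\<rparr>
       A_Mod ext_coboundaries R S d N i"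

text \<open>The type \<^typ>\<open>('a + 'm) list\<close> of basis elements is infinite and at least as large as \<open>R\<close> and
  \<open>M\<close>. So there are enough basis elements for the free module on the carrier of \<open>M\<close>, whose
  carrier again has at most the cardinality of this type, and hence for the free modules on all
  further syzygies: a free resolution of this type exists for every module \<open>M\<close> over a commutative
  ring \<open>R\<close>. Up to isomorphism \<open>Ext R i M N\<close> does not depend on the one that is chosen.\<close>

definition chosen_resolution ::
  "'a ring \<Rightarrow> ('a, 'm) module \<Rightarrow>
     (nat \<Rightarrow> ('a + 'm) list set) \<times>
     (nat \<Rightarrow> (('a + 'm) list \<Rightarrow> 'a) \<Rightarrow> (('a + 'm) list \<Rightarrow> 'a))" where
  "chosen_resolution R M = (SOME (S, d). \<exists>e. free_resolution R M S d e)"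

definition Ext ::
  "'a ring \<Rightarrow> nat \<Rightarrow> ('a, 'm) module \<Rightarrow> ('a, 'n) module \<Rightarrow>
     ((('a + 'm) list \<Rightarrow> 'a) \<Rightarrow> 'n) set monoid" where
  "Ext R i M N = (case chosen_resolution R M of (S, d) \<Rightarrow> ext_of_resolution R S d N i)"

definition ext_eventually_zero :: "'a ring \<Rightarrow> ('a, 'm) module \<Rightarrow> ('a, 'n) module \<Rightarrow> bool" where
  "ext_eventually_zero R M N \<longleftrightarrow> (\<exists>n. \<forall>i>n. trivial_group (Ext R i M N))"

text \<open>Every finitely generated module is isomorphic to a quotient of some \<open>R\<^sup>k\<close>, whose elements are
  cosets, i.e. sets of lists of length \<open>k\<close>. So modules with carrier in the type
  \<^typ>\<open>'a list set\<close> represent all isomorphism classes of finitely generated modules.\<close>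

definition ext_index :: "'a ring \<Rightarrow> enat" where
  "ext_index R = Sup {enat n | n. \<exists>(M :: ('a, 'a list set) module) (N :: ('a, 'a list set) module).
     fg_module R M \<and> fg_module R N \<and> ext_eventually_zero R M N \<and>
     (\<forall>i>n. trivial_group (Ext R i M N)) \<and> \<not> trivial_group (Ext R n M N)}"


section \<open>Injective dimension, local Gorenstein rings, AB rings\<close>

text \<open>Injectivity is tested on the modules with carrier in the same type \<open>'u\<close>. By Baer's criterion
  this is injectivity with respect to all modules as soon as \<open>R\<close> embeds into \<open>'u\<close> as a set,
  which is the case where the notion is used below.\<close>

definition injective_module :: "'a ring \<Rightarrow> ('a, 'u) module \<Rightarrow> bool" where
  "injective_module R I \<longleftrightarrow> module R I \<and>
     (\<forall>(A :: ('a, 'u) module) (B :: ('a, 'u) module) f g.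
        module R A \<and> module R B \<and> f \<in> lin_maps R A B \<and> inj_on f (carrier A) \<and> g \<in> lin_maps R A I
        \<longrightarrow> (\<exists>h \<in> lin_maps R B I. \<forall>x\<in>carrier A. h (f x) = g x))"

text \<open>An injective resolution \<open>0 \<rightarrow> M \<rightarrow> I 0 \<rightarrow> \<dots> \<rightarrow> I n \<rightarrow> 0\<close> of length at most \<open>n\<close>.\<close>

definition injective_resolution ::
  "'a ring \<Rightarrow> ('a, 'm) module \<Rightarrow> nat \<Rightarrow> (nat \<Rightarrow> ('a, 'u) module) \<Rightarrow> (nat \<Rightarrow> 'u \<Rightarrow> 'u) \<Rightarrow>
     ('m \<Rightarrow> 'u) \<Rightarrow> bool" where
  "injective_resolution R M n I d e \<longleftrightarrow>
     (\<forall>j. injective_module R (I j)) \<and>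
     (\<forall>j>n. carrier (I j) = {\<zero>\<^bsub>I j\<^esub>}) \<and>
     e \<in> lin_maps R M (I 0) \<and> (\<forall>j. d j \<in> lin_maps R (I j) (I (Suc j))) \<and>
     inj_on e (carrier M) \<and>
     e ` carrier M = a_kernel (I 0) (I 1) (d 0) \<and>
     (\<forall>j. d j ` carrier (I j) = a_kernel (I (Suc j)) (I (Suc (Suc j))) (d (Suc j)))"

text \<open>With \<open>\<kappa> = |R| + |M| + \<aleph>\<^sub>0\<close>, every module of cardinality at most \<open>2\<^sup>\<kappa>\<close> embeds into an injective
  module of cardinality at most \<open>2\<^sup>\<kappa>\<close>. So the type \<^typ>\<open>('a + 'm) list set\<close> has room for an injective
  resolution of \<open>M\<close>, and for one of minimal length. The infimum of the empty set is \<open>\<infinity>\<close>.\<close>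

definition injective_dimension :: "'a ring \<Rightarrow> ('a, 'm) module \<Rightarrow> enat" where
  "injective_dimension R M = Inf {enat n | n.
     \<exists>(I :: nat \<Rightarrow> ('a, ('a + 'm) list set) module) d e. injective_resolution R M n I d e}"

definition local_ring :: "'a ring \<Rightarrow> bool" where
  "local_ring R \<longleftrightarrow> cring R \<and> noetherian_ring R \<and> (\<exists>!\<mm>. maximalideal \<mm> R)"

definition gorenstein_local_ring :: "'a ring \<Rightarrow> bool" where
  "gorenstein_local_ring R \<longleftrightarrow> local_ring R \<and> injective_dimension R (regular_module R) < \<infinity>"

definition AB_ring :: "'a ring \<Rightarrow> bool" where
  "AB_ring R \<longleftrightarrow> gorenstein_local_ring R \<and> ext_index R < \<infinity>"

end

theory Submission
  imports Defs
begin

text \<open>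
  Write \<open>\<Omega>\<close> for syzygies; \<open>R\<close> has finite injective dimension \<open>n\<close>, so high syzygies \<open>X\<close> satisfy
  \<open>Ext\<^sup>j(X, R) = 0\<close> for all \<open>j > 0\<close>, and \<open>M\<close>, \<open>N\<close> may be replaced by such syzygies. Dualizing a
  resolution of \<open>M\<close> keeps it exact, which lets one continue it to the left by finitely generated free
  modules for as many steps as one likes: \<open>M = \<Omega>\<^sup>m M'\<close> for every \<open>m\<close>. If
  \<open>Ext\<^sup>i(M, N) = 0\<close> for large \<open>i\<close>, then the same holds for \<open>M'\<close>, and the finite Ext-index \<open>b\<close> gives
  \<open>Ext\<^sup>i(M', N) = 0\<close> for all \<open>i > b\<close>, uniformly in \<open>m\<close>. So if \<open>G\<close> resolves \<open>M'\<close>, the complex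
  \<open>Hom(G, N)\<close> is exact beyond degree \<open>b\<close>. All its terms and cocycles have vanishing Ext into \<open>R\<close>;
  hence \<open>Hom(Hom(G, N), R) = Hom(N, G)\<close> is exact there as well, which says that
  \<open>Ext\<^sup>1(N, \<Omega>\<^sup>k M') = 0\<close> for \<open>k\<close> slightly larger than \<open>b\<close>. Shifting dimensions,
  \<open>Ext\<^sup>j\<^sup>+\<^sup>1(N, \<Omega>\<^sup>k\<^sup>+\<^sup>j M') = 0\<close>, and \<open>m = k + j\<close> gives the vanishing for \<open>M\<close> in any degree \<open>j + 1\<close>.
\<close>

text \<open>Ext enters in two forms. Ext into \<open>R\<close> of an arbitrary module is read off
  the finite injective resolution (\<open>ext_ring_vanishes\<close>), where high degrees vanish at
  once; all other Ext is read off free resolutions (\<open>ext_vanishes\<close>). Instead of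
  identifying the two in general, \<open>dual_exact\<close> converts vanishing of the first kind
  into vanishing of the second. The bound must be uniform in m because the exactness of Hom(N, G) is
  counted from the end of G at which the new terms are attached, while the given module sits m
  places away from that end; a bound growing with m might never be overtaken by m. The
  identification of Hom(Hom(G, N), R) with Hom(N, G) rests on G being finite free in each degree:
  Hom(G, N) is then a finite sum of copies of N, generated by the maps \<open>scal\<close>. Passing
  from exactness of Hom(N, G) to Ext^1(N, -) = 0 on a syzygy also uses Ext^1(N, R) = 0, which is why
  N too is first replaced by a syzygy.\<close>

text \<open>Mind the shift: for a free resolution \<open>(S, d)\<close> of \<open>M\<close>, index \<open>i\<close> stands for
  \<open>Ext\<^sup>i\<^sup>+\<^sup>1(M, X) = 0\<close>.\<close>

definition ext_vanishes ::
  "'a ring \<Rightarrow> (nat \<Rightarrow> 'i set) \<Rightarrow> (nat \<Rightarrow> ('i \<Rightarrow> 'a) \<Rightarrow> ('i \<Rightarrow> 'a)) \<Rightarrow> ('a, 'n) module \<Rightarrow> nat \<Rightarrow> bool" where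
  "ext_vanishes R S d X i \<longleftrightarrow>
     (\<forall>f \<in> lin_maps R (free_module R (S (Suc i))) X.
        (\<forall>y \<in> carrier (free_module R (S (Suc (Suc i)))). f (d (Suc i) y) = \<zero>\<^bsub>X\<^esub>) \<longrightarrow>
        (\<exists>g \<in> lin_maps R (free_module R (S i)) X.
           \<forall>y \<in> carrier (free_module R (S (Suc i))). f y = g (d i y)))"

locale base_ring = cring R for R :: "'a ring" (structure)
begin

abbreviation Hom where "Hom \<equiv> lin_maps R"
abbreviation Fr where "Fr \<equiv> free_module R"
abbreviation RR where "RR \<equiv> regular_module R"

section \<open>Linear maps\<close>

lemma lin_closed: "f \<in> Hom M N \<Longrightarrow> x \<in> carrier M \<Longrightarrow> f x \<in> carrier N"
  by (auto simp: lin_maps_def)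

lemma lin_add: "f \<in> Hom M N \<Longrightarrow> x \<in> carrier M \<Longrightarrow> y \<in> carrier M \<Longrightarrow> f (x \<oplus>\<^bsub>M\<^esub> y) = f x \<oplus>\<^bsub>N\<^esub> f y"
  by (auto simp: lin_maps_def)

lemma lin_smult: "f \<in> Hom M N \<Longrightarrow> a \<in> carrier R \<Longrightarrow> x \<in> carrier M \<Longrightarrow> f (a \<odot>\<^bsub>M\<^esub> x) = a \<odot>\<^bsub>N\<^esub> f x"
  by (auto simp: lin_maps_def)

lemma lin_mapI:
  assumes "\<And>x. x \<in> carrier M \<Longrightarrow> t x \<in> carrier N"
    and "\<And>x y. x \<in> carrier M \<Longrightarrow> y \<in> carrier M \<Longrightarrow> t (x \<oplus>\<^bsub>M\<^esub> y) = t x \<oplus>\<^bsub>N\<^esub> t y"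
    and "\<And>a x. a \<in> carrier R \<Longrightarrow> x \<in> carrier M \<Longrightarrow> t (a \<odot>\<^bsub>M\<^esub> x) = a \<odot>\<^bsub>N\<^esub> t x"
    and "module R M"
  shows "(\<lambda>x\<in>carrier M. t x) \<in> Hom M N"
proof -
  interpret M: module R M by fact
  show ?thesis using assms(1-3) by (auto simp: lin_maps_def)
qed

lemma lin_eqI:
  assumes "f \<in> Hom M N" "g \<in> Hom M N" "\<And>x. x \<in> carrier M \<Longrightarrow> f x = g x"
  shows "f = g"
  using assms by (auto simp: lin_maps_def intro: PiE_ext)

lemma lin_zero:
  assumes "module R M" "module R N" "f \<in> Hom M N"
  shows "f \<zero>\<^bsub>M\<^esub> = \<zero>\<^bsub>N\<^esub>"
proof -
  interpret M: module R M by fact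
  interpret N: module R N by fact
  have "f \<zero>\<^bsub>M\<^esub> = f (\<zero> \<odot>\<^bsub>M\<^esub> \<zero>\<^bsub>M\<^esub>)" by simp
  also have "\<dots> = \<zero> \<odot>\<^bsub>N\<^esub> f \<zero>\<^bsub>M\<^esub>"
    using lin_smult[OF assms(3) zero_closed M.M.zero_closed] .
  finally show ?thesis using lin_closed[OF assms(3) M.M.zero_closed] by simp
qed

lemma lin_minus:
  assumes "module R M" "module R N" "f \<in> Hom M N" "x \<in> carrier M" "y \<in> carrier M"
  shows "f (x \<ominus>\<^bsub>M\<^esub> y) = f x \<ominus>\<^bsub>N\<^esub> f y"
proof -
  interpret M: module R M by fact
  interpret N: module R N by fact
  have cl: "f x \<in> carrier N" "f y \<in> carrier N" "f (\<ominus>\<^bsub>M\<^esub> y) \<in> carrier N"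
    using assms lin_closed by (auto intro!: lin_closed[OF assms(3)])
  have "f y \<oplus>\<^bsub>N\<^esub> f (\<ominus>\<^bsub>M\<^esub> y) = f (y \<oplus>\<^bsub>M\<^esub> \<ominus>\<^bsub>M\<^esub> y)"
    using lin_add[OF assms(3), of y "\<ominus>\<^bsub>M\<^esub> y"] assms by simp
  also have "\<dots> = \<zero>\<^bsub>N\<^esub>" using assms lin_zero by (simp add: M.r_neg)
  finally have "f (\<ominus>\<^bsub>M\<^esub> y) = \<ominus>\<^bsub>N\<^esub> f y"
    using cl by (metis N.M.minus_equality N.M.a_comm)
  then show ?thesis unfolding a_minus_def
    using lin_add[OF assms(3), of x "\<ominus>\<^bsub>M\<^esub> y"] assms by simp
qed

lemma lin_comp:
  assumes "module R M" "f \<in> Hom M N" "g \<in> Hom N P"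
  shows "(\<lambda>x\<in>carrier M. g (f x)) \<in> Hom M P"
  using assms by (intro lin_mapI) (auto simp: lin_closed lin_add lin_smult)

lemma minus_eq_zeroD:
  assumes "module R M" "x \<in> carrier M" "y \<in> carrier M" "x \<ominus>\<^bsub>M\<^esub> y = \<zero>\<^bsub>M\<^esub>"
  shows "x = y"
proof -
  interpret M: module R M by fact
  have "x = (x \<ominus>\<^bsub>M\<^esub> y) \<oplus>\<^bsub>M\<^esub> y"
    using assms(2,3) by (simp add: a_minus_def M.M.a_assoc M.M.l_neg)
  also have "\<dots> = y" using assms(3,4) by simp
  finally show ?thesis .
qed

lemma lin_zero_map:
  assumes "module R M" "module R N"
  shows "(\<lambda>x\<in>carrier M. \<zero>\<^bsub>N\<^esub>) \<in> Hom M N"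
proof -
  interpret N: module R N by fact
  show ?thesis using assms by (intro lin_mapI) auto
qed

lemma lin_diff:
  assumes "module R M" "module R N" "f \<in> Hom M N" "g \<in> Hom M N"
  shows "(\<lambda>x\<in>carrier M. f x \<ominus>\<^bsub>N\<^esub> g x) \<in> Hom M N"
proof -
  interpret N: module R N by fact
  note l = lin_closed[OF assms(3)] lin_closed[OF assms(4)] lin_add[OF assms(3)] lin_add[OF assms(4)]
    lin_smult[OF assms(3)] lin_smult[OF assms(4)]
  show ?thesis using assms(1)
    by (intro lin_mapI)
      (auto simp: l a_minus_def N.smult_r_distr N.smult_r_minus N.M.minus_add N.M.a_ac)
qed

lemma lin_sum:
  assumes "module R M" "module R N" "f \<in> Hom M N" "g \<in> Hom M N"
  shows "(\<lambda>x\<in>carrier M. f x \<oplus>\<^bsub>N\<^esub> g x) \<in> Hom M N"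
proof -
  interpret N: module R N by fact
  note l = lin_closed[OF assms(3)] lin_closed[OF assms(4)] lin_add[OF assms(3)] lin_add[OF assms(4)]
    lin_smult[OF assms(3)] lin_smult[OF assms(4)]
  show ?thesis using assms(1)
    by (intro lin_mapI)
      (auto simp: l a_minus_def N.smult_r_distr N.smult_r_minus N.M.minus_add N.M.a_ac)
qed

lemma lin_scale:
  assumes "module R M" "module R N" "f \<in> Hom M N" "a \<in> carrier R"
  shows "(\<lambda>x\<in>carrier M. a \<odot>\<^bsub>N\<^esub> f x) \<in> Hom M N"
proof -
  interpret N: module R N by fact
  note l = lin_closed[OF assms(3)] lin_add[OF assms(3)] lin_smult[OF assms(3)]
  show ?thesis using assms(1,4)
    by (intro lin_mapI)
      (auto simp: l N.smult_r_distr simp flip: N.smult_assoc1 intro: arg_cong2[of _ _ _ _ "smult N"] m_comm)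
qed

section \<open>Submodules\<close>

lemma submodule_carrier: "submodule H R M \<Longrightarrow> H \<subseteq> carrier M"
  using subgroup.subset[OF submodule.axioms(1), of H R M] by simp

lemma submodule_module: "module R M \<Longrightarrow> submodule H R M \<Longrightarrow> module R (M\<lparr>carrier := H\<rparr>)"
  by (rule submodule.submodule_is_module)

lemma submodule_minus:
  assumes "module R M" "submodule H R M" "x \<in> H" "y \<in> H" shows "x \<ominus>\<^bsub>M\<^esub> y \<in> H"
  unfolding a_minus_def using module.submoduleE[OF assms(1,2)] assms(3,4) by auto

lemma submodule_I:
  assumes "module R M" "H \<subseteq> carrier M" "\<zero>\<^bsub>M\<^esub> \<in> H"
    and "\<And>x y. x \<in> H \<Longrightarrow> y \<in> H \<Longrightarrow> x \<oplus>\<^bsub>M\<^esub> y \<in> H"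
    and "\<And>a x. a \<in> carrier R \<Longrightarrow> x \<in> H \<Longrightarrow> a \<odot>\<^bsub>M\<^esub> x \<in> H"
  shows "submodule H R M"
proof -
  interpret M: module R M by fact
  have "\<ominus>\<^bsub>M\<^esub> x \<in> H" if "x \<in> H" for x
  proof -
    have "(\<ominus> \<one>) \<odot>\<^bsub>M\<^esub> x \<in> H" using assms(5) that by blast
    moreover have "(\<ominus> \<one>) \<odot>\<^bsub>M\<^esub> x = \<ominus>\<^bsub>M\<^esub> x"
      using M.smult_l_minus[of \<one> x] that assms(2) by auto
    ultimately show ?thesis by simp
  qed
  then show ?thesis using assms by (intro M.submoduleI)
qed

lemma kernel_submodule:
  assumes "module R M" "module R N" "f \<in> Hom M N"
  shows "submodule {x \<in> carrier M. f x = \<zero>\<^bsub>N\<^esub>} R M"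
proof -
  interpret M: module R M by fact
  interpret N: module R N by fact
  show ?thesis
    by (rule submodule_I) (use assms in \<open>auto simp: lin_zero lin_add lin_smult\<close>)
qed

text \<open>This is how linear maps are compared throughout: the locus of agreement is a submodule,
  so agreement on generators is agreement everywhere.\<close>

lemma equalizer_submodule:
  assumes "module R M" "module R N" "f \<in> Hom M N" "g \<in> Hom M N"
  shows "submodule {x \<in> carrier M. f x = g x} R M"
proof -
  interpret M: module R M by fact
  interpret N: module R N by fact
  show ?thesis
    by (rule submodule_I) (use assms in \<open>auto simp: lin_zero lin_add lin_smult\<close>)
qed

lemma preimage_submodule:
  assumes "module R M" "module R N" "f \<in> Hom M N" "submodule H R N"
  shows "submodule {x \<in> carrier M. f x \<in> H} R M"
proof -
  interpret M: module R M by fact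
  interpret N: module R N by fact
  note N.submoduleE[OF assms(4)] subgroup.one_closed[OF submodule.axioms(1)[OF assms(4)]]
  then show ?thesis
    by (intro submodule_I) (use assms in \<open>auto simp: lin_zero lin_add lin_smult\<close>)
qed

lemma image_submodule:
  assumes "module R M" "module R N" "f \<in> Hom M N" "submodule H R M"
  shows "submodule (f ` H) R N"
proof -
  interpret M: module R M by fact
  interpret N: module R N by fact
  note E = M.submoduleE[OF assms(4)] subgroup.one_closed[OF submodule.axioms(1)[OF assms(4)]]
  show ?thesis
  proof (rule submodule_I)
    show "f ` H \<subseteq> carrier N" using E(1) lin_closed[OF assms(3)] by blast
    show "\<zero>\<^bsub>N\<^esub> \<in> f ` H" using E(7) lin_zero[OF assms(1-3)] by force
  next
    fix x y assume "x \<in> f ` H" "y \<in> f ` H"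
    then obtain u v where "u \<in> H" "v \<in> H" "x = f u" "y = f v" by auto
    then have "x \<oplus>\<^bsub>N\<^esub> y = f (u \<oplus>\<^bsub>M\<^esub> v)" using lin_add[OF assms(3), of u v] subsetD[OF E(1)] by simp
    then show "x \<oplus>\<^bsub>N\<^esub> y \<in> f ` H" using E(5) \<open>u \<in> H\<close> \<open>v \<in> H\<close> by auto
  next
    fix a x assume "a \<in> carrier R" "x \<in> f ` H"
    then obtain u where "u \<in> H" "x = f u" by auto
    then have "a \<odot>\<^bsub>N\<^esub> x = f (a \<odot>\<^bsub>M\<^esub> u)" using lin_smult[OF assms(3), of a u] \<open>a \<in> carrier R\<close> subsetD[OF E(1)] by simp
    then show "a \<odot>\<^bsub>N\<^esub> x \<in> f ` H" using E(4) \<open>u \<in> H\<close> \<open>a \<in> carrier R\<close> by auto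
  qed fact
qed

lemma range_submodule:
  assumes "module R M" "module R N" "f \<in> Hom M N"
  shows "submodule (f ` carrier M) R N"
  using image_submodule[OF assms] module.carrier_is_submodule[OF assms(1)] by blast

lemma lin_restrict:
  assumes "module R M" "submodule H R M" "f \<in> Hom M N"
  shows "restrict f H \<in> Hom (M\<lparr>carrier := H\<rparr>) N"
  using module.submoduleE[OF assms(1,2)] assms(3) by (auto simp: lin_maps_def PiE_iff subset_iff)

lemma lin_inclusion:
  assumes "module R M" "submodule H R M"
  shows "(\<lambda>x\<in>H. x) \<in> Hom (M\<lparr>carrier := H\<rparr>) M"
  using module.submoduleE[OF assms(1,2)] by (auto simp: lin_maps_def)

lemma lin_codomain:
  assumes "f \<in> Hom M N" "\<And>x. x \<in> carrier M \<Longrightarrow> f x \<in> H"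
  shows "f \<in> Hom M (N\<lparr>carrier := H\<rparr>)"
  using assms by (auto simp: lin_maps_def PiE_iff)

lemma lin_codomainD:
  assumes "f \<in> Hom M (N\<lparr>carrier := H\<rparr>)" "H \<subseteq> carrier N"
  shows "f \<in> Hom M N"
  using assms by (auto simp: lin_maps_def PiE_iff)

text \<open>The first isomorphism theorem in a form free of quotients: the image of \<open>p\<close>
  stands for \<open>B\<close> modulo the kernel of \<open>p\<close>. The value at \<open>c\<close>
  is \<open>f\<close> at an arbitrary preimage of \<open>c\<close>, and \<open>wd\<close> makes the
  choice harmless.\<close>

lemma lin_factor:
  assumes "module R B" "module R C" "module R X" "p \<in> Hom B C" "f \<in> Hom B X"
    and "\<And>x. x \<in> carrier B \<Longrightarrow> p x = \<zero>\<^bsub>C\<^esub> \<Longrightarrow> f x = \<zero>\<^bsub>X\<^esub>"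
  shows "\<exists>g \<in> Hom (C\<lparr>carrier := p ` carrier B\<rparr>) X. \<forall>x \<in> carrier B. g (p x) = f x"
proof -
  interpret B: module R B by fact
  interpret C: module R C by fact
  interpret X: module R X by fact
  have wd: "f x = f y" if "x \<in> carrier B" "y \<in> carrier B" "p x = p y" for x y
  proof -
    have "p (x \<ominus>\<^bsub>B\<^esub> y) = \<zero>\<^bsub>C\<^esub>"
      using lin_minus[OF assms(1,2,4) that(1,2)] that lin_closed[OF assms(4) that(2)]
      by (simp add: C.M.r_neg a_minus_def)
    then have "f x \<ominus>\<^bsub>X\<^esub> f y = \<zero>\<^bsub>X\<^esub>"
      using assms(6)[of "x \<ominus>\<^bsub>B\<^esub> y"] that(1,2) lin_minus[OF assms(1,3,5) that(1,2)] by simp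
    then show ?thesis by (rule minus_eq_zeroD[OF assms(3) lin_closed[OF assms(5) that(1)] lin_closed[OF assms(5) that(2)]])
  qed
  define t where "t c = f (SOME x. x \<in> carrier B \<and> p x = c)" for c
  have t: "t (p x) = f x" if "x \<in> carrier B" for x
    unfolding t_def by (rule someI2[of _ x]) (blast intro: that wd)+
  let ?C = "C\<lparr>carrier := p ` carrier B\<rparr>"
  have m: "module R ?C"
    by (rule submodule_module[OF assms(2) range_submodule[OF assms(1,2,4)]])
  have "(\<lambda>c\<in>carrier ?C. t c) \<in> Hom ?C X"
  proof (rule lin_mapI)
    fix c assume "c \<in> carrier ?C"
    then obtain x where x: "x \<in> carrier B" "c = p x" by auto
    then show "t c \<in> carrier X" using t lin_closed[OF assms(5)] by simp
    fix a assume a: "a \<in> carrier R"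
    have "a \<odot>\<^bsub>?C\<^esub> c = p (a \<odot>\<^bsub>B\<^esub> x)" using x a lin_smult[OF assms(4)] by simp
    then show "t (a \<odot>\<^bsub>?C\<^esub> c) = a \<odot>\<^bsub>X\<^esub> t c"
      using t[of "a \<odot>\<^bsub>B\<^esub> x"] t[OF x(1)] x a lin_smult[OF assms(5) a x(1)] by simp
  next
    fix c c' assume "c \<in> carrier ?C" "c' \<in> carrier ?C"
    then obtain x x' where x: "x \<in> carrier B" "c = p x" "x' \<in> carrier B" "c' = p x'" by auto
    have "c \<oplus>\<^bsub>?C\<^esub> c' = p (x \<oplus>\<^bsub>B\<^esub> x')" using x lin_add[OF assms(4)] by simp
    then show "t (c \<oplus>\<^bsub>?C\<^esub> c') = t c \<oplus>\<^bsub>X\<^esub> t c'"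
      using t[of "x \<oplus>\<^bsub>B\<^esub> x'"] t[OF x(1)] t[OF x(3)] x lin_add[OF assms(5) x(1,3)] by simp
  qed (rule m)
  then show ?thesis by (rule bexI[rotated]) (simp add: t)
qed

section \<open>Regular, free and Hom modules\<close>

lemma regular_module: "module R RR"
proof (rule moduleI)
  show "abelian_group RR"
  proof (rule abelian_groupI)
    fix x assume "x \<in> carrier RR"
    then show "\<exists>y\<in>carrier RR. y \<oplus>\<^bsub>RR\<^esub> x = \<zero>\<^bsub>RR\<^esub>"
      by (intro bexI[of _ "\<ominus> x"]) (auto simp: regular_module_def l_neg)
  qed (auto simp: regular_module_def a_assoc intro: a_comm)
qed (auto simp: regular_module_def is_cring l_distr r_distr m_assoc)

lemma free_carrierD:
  "f \<in> carrier (Fr S) \<Longrightarrow> s \<in> S \<Longrightarrow> f s \<in> carrier R"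
  "f \<in> carrier (Fr S) \<Longrightarrow> f \<in> extensional S"
  "f \<in> carrier (Fr S) \<Longrightarrow> finite {s \<in> S. f s \<noteq> \<zero>}"
  by (auto simp: free_module_def PiE_iff)

lemma free_carrierI:
  "(\<And>s. s \<in> S \<Longrightarrow> f s \<in> carrier R) \<Longrightarrow> f \<in> extensional S \<Longrightarrow> finite {s \<in> S. f s \<noteq> \<zero>} \<Longrightarrow> f \<in> carrier (Fr S)"
  by (auto simp: free_module_def PiE_iff)

lemma free_simps:
  "\<zero>\<^bsub>Fr S\<^esub> = (\<lambda>s\<in>S. \<zero>)"
  "f \<oplus>\<^bsub>Fr S\<^esub> g = (\<lambda>s\<in>S. f s \<oplus> g s)"
  "a \<odot>\<^bsub>Fr S\<^esub> f = (\<lambda>s\<in>S. a \<otimes> f s)"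
  by (auto simp: free_module_def)

lemma free_eqI:
  "f \<in> carrier (Fr S) \<Longrightarrow> g \<in> carrier (Fr S) \<Longrightarrow> (\<And>s. s \<in> S \<Longrightarrow> f s = g s) \<Longrightarrow> f = g"
  by (meson extensionalityI free_carrierD(2))

lemma free_pointwise_closed:
  assumes "f \<in> carrier (Fr S)" "g \<in> carrier (Fr S)"
    and "\<And>a b. a \<in> carrier R \<Longrightarrow> b \<in> carrier R \<Longrightarrow> t a b \<in> carrier R" "t \<zero> \<zero> = \<zero>"
  shows "(\<lambda>s\<in>S. t (f s) (g s)) \<in> carrier (Fr S)"
proof (rule free_carrierI)
  have "{s \<in> S. (\<lambda>s\<in>S. t (f s) (g s)) s \<noteq> \<zero>} \<subseteq> {s \<in> S. f s \<noteq> \<zero>} \<union> {s \<in> S. g s \<noteq> \<zero>}"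
    using assms(4) by auto
  then show "finite {s \<in> S. (\<lambda>s\<in>S. t (f s) (g s)) s \<noteq> \<zero>}"
    using free_carrierD(3)[OF assms(1)] free_carrierD(3)[OF assms(2)] by (meson finite_UnI finite_subset)
qed (use assms in \<open>auto simp: free_carrierD\<close>)

lemma free_module: "module R (Fr S)"
proof (rule moduleI)
  show "abelian_group (Fr S)"
  proof (rule abelian_groupI)
    show "x \<oplus>\<^bsub>Fr S\<^esub> y \<in> carrier (Fr S)" if "x \<in> carrier (Fr S)" "y \<in> carrier (Fr S)" for x y
      using free_pointwise_closed[OF that, of "add R"] by (simp add: free_simps)
    show z: "\<zero>\<^bsub>Fr S\<^esub> \<in> carrier (Fr S)" by (rule free_carrierI) (auto simp: free_simps)
    fix x assume x: "x \<in> carrier (Fr S)"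
    show "\<exists>y\<in>carrier (Fr S). y \<oplus>\<^bsub>Fr S\<^esub> x = \<zero>\<^bsub>Fr S\<^esub>"
      using free_pointwise_closed[OF x x, of "\<lambda>a b. \<ominus> a"] x
      by (intro bexI) (auto simp: free_simps free_carrierD l_neg intro!: ext)
    show "\<zero>\<^bsub>Fr S\<^esub> \<oplus>\<^bsub>Fr S\<^esub> x = x"
      using x by (auto simp: free_simps free_carrierD(1) intro!: extensionalityI[OF _ free_carrierD(2)[OF x]])
    fix y assume y: "y \<in> carrier (Fr S)"
    show "x \<oplus>\<^bsub>Fr S\<^esub> y = y \<oplus>\<^bsub>Fr S\<^esub> x"
      using x y by (auto simp: free_simps free_carrierD a_comm intro!: ext)
    fix z assume z: "z \<in> carrier (Fr S)"
    show "x \<oplus>\<^bsub>Fr S\<^esub> y \<oplus>\<^bsub>Fr S\<^esub> z = x \<oplus>\<^bsub>Fr S\<^esub> (y \<oplus>\<^bsub>Fr S\<^esub> z)"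
      using x y z by (auto simp: free_simps free_carrierD a_assoc intro!: ext)
  qed
  fix a x assume a: "a \<in> carrier R" and x: "x \<in> carrier (Fr S)"
  show "a \<odot>\<^bsub>Fr S\<^esub> x \<in> carrier (Fr S)"
    using free_pointwise_closed[OF x x, of "\<lambda>u v. a \<otimes> u"] a by (simp add: free_simps)
  show "a \<odot>\<^bsub>Fr S\<^esub> (x \<oplus>\<^bsub>Fr S\<^esub> y) = a \<odot>\<^bsub>Fr S\<^esub> x \<oplus>\<^bsub>Fr S\<^esub> a \<odot>\<^bsub>Fr S\<^esub> y" if "y \<in> carrier (Fr S)" for y
    using a x that by (auto simp: free_simps free_carrierD r_distr intro!: ext)
  show "(a \<oplus> b) \<odot>\<^bsub>Fr S\<^esub> x = a \<odot>\<^bsub>Fr S\<^esub> x \<oplus>\<^bsub>Fr S\<^esub> b \<odot>\<^bsub>Fr S\<^esub> x" if "b \<in> carrier R" for b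
    using a x that by (auto simp: free_simps free_carrierD l_distr intro!: ext)
  show "a \<otimes> b \<odot>\<^bsub>Fr S\<^esub> x = a \<odot>\<^bsub>Fr S\<^esub> (b \<odot>\<^bsub>Fr S\<^esub> x)" if "b \<in> carrier R" for b
    using a x that by (auto simp: free_simps free_carrierD m_assoc intro!: ext)
next
  fix x assume x: "x \<in> carrier (Fr S)"
  then show "\<one> \<odot>\<^bsub>Fr S\<^esub> x = x"
    by (auto simp: free_simps free_carrierD(1) intro!: extensionalityI[OF _ free_carrierD(2)[OF x]])
qed (rule is_cring)

lemma hom_simps:
  "carrier (hom_module R M N) = Hom M N"
  "\<zero>\<^bsub>hom_module R M N\<^esub> = (\<lambda>x\<in>carrier M. \<zero>\<^bsub>N\<^esub>)"
  "f \<oplus>\<^bsub>hom_module R M N\<^esub> g = (\<lambda>x\<in>carrier M. f x \<oplus>\<^bsub>N\<^esub> g x)"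
  "a \<odot>\<^bsub>hom_module R M N\<^esub> f = (\<lambda>x\<in>carrier M. a \<odot>\<^bsub>N\<^esub> f x)"
  by (auto simp: hom_module_def)

lemma hom_module:
  assumes "module R M" "module R N"
  shows "module R (hom_module R M N)"
proof -
  interpret M: module R M by fact
  interpret N: module R N by fact
  have ex: "f \<in> extensional (carrier M)" if "f \<in> Hom M N" for f
    using that by (auto simp: lin_maps_def PiE_def)
  show ?thesis
  proof (rule moduleI)
    show "abelian_group (hom_module R M N)"
    proof (rule abelian_groupI, unfold hom_simps)
      fix f assume f: "f \<in> Hom M N"
      show "\<exists>g\<in>Hom M N. (\<lambda>x\<in>carrier M. g x \<oplus>\<^bsub>N\<^esub> f x) = (\<lambda>x\<in>carrier M. \<zero>\<^bsub>N\<^esub>)"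
        using lin_diff[OF assms lin_zero_map[OF assms] f] f
        by (intro bexI) (auto intro!: ext simp: N.M.l_neg a_minus_def lin_closed)
      show "(\<lambda>x\<in>carrier M. (\<lambda>x\<in>carrier M. \<zero>\<^bsub>N\<^esub>) x \<oplus>\<^bsub>N\<^esub> f x) = f"
        by (rule extensionalityI[OF _ ex[OF f]]) (use f in \<open>auto simp: lin_closed\<close>)
    qed (auto simp: lin_sum[OF assms] lin_zero_map[OF assms] lin_closed N.M.a_ac intro!: ext)
  next
    fix f assume f: "f \<in> carrier (hom_module R M N)"
    then show "\<one> \<odot>\<^bsub>hom_module R M N\<^esub> f = f"
      unfolding hom_simps
      by (intro extensionalityI[OF _ ex[of f]]) (auto simp: lin_closed)
  qed (auto simp: hom_simps lin_scale[OF assms] is_cring lin_closed N.smult_l_distr N.smult_r_distr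
      N.smult_assoc1 intro!: ext)
qed

section \<open>Free modules\<close>

definition delta :: "'i set \<Rightarrow> 'i \<Rightarrow> 'i \<Rightarrow> 'a" where
  "delta S s = (\<lambda>t\<in>S. if t = s then \<one> else \<zero>)"

definition coord :: "'i set \<Rightarrow> 'i \<Rightarrow> ('i \<Rightarrow> 'a) \<Rightarrow> 'a" where
  "coord S s = (\<lambda>v\<in>carrier (Fr S). v s)"

text \<open>The image of \<open>\<theta> \<otimes> x\<close> under \<open>Hom(P, R) \<otimes> N \<rightarrow> Hom(P, N)\<close>.\<close>

definition scal :: "('a, 'p) module \<Rightarrow> ('a, 'n) module \<Rightarrow> ('p \<Rightarrow> 'a) \<Rightarrow> 'n \<Rightarrow> 'p \<Rightarrow> 'n" where
  "scal P N \<theta> x = (\<lambda>v\<in>carrier P. \<theta> v \<odot>\<^bsub>N\<^esub> x)"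

lemma regular_simps:
  "carrier RR = carrier R" "\<zero>\<^bsub>RR\<^esub> = \<zero>" "a \<oplus>\<^bsub>RR\<^esub> b = a \<oplus> b" "a \<odot>\<^bsub>RR\<^esub> b = a \<otimes> b"
  by (auto simp: regular_module_def)

lemma delta_closed: "delta S s \<in> carrier (Fr S)"
proof (rule free_carrierI)
  have "{t \<in> S. delta S s t \<noteq> \<zero>} \<subseteq> {s}" by (auto simp: delta_def)
  then show "finite {t \<in> S. delta S s t \<noteq> \<zero>}" by (meson finite.simps finite_subset)
qed (auto simp: delta_def)

lemma delta_apply: "t \<in> S \<Longrightarrow> delta S s t = (if t = s then \<one> else \<zero>)"
  by (simp add: delta_def)

text \<open>Induction on a finite set that contains the support of \<open>f\<close>: clearing one
  coordinate subtracts a multiple of one basis vector.\<close>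

lemma free_span:
  assumes "submodule H R (Fr S)" "\<And>s. s \<in> S \<Longrightarrow> delta S s \<in> H"
  shows "H = carrier (Fr S)"
proof -
  interpret F: module R "Fr S" by (rule free_module)
  note E = F.submoduleE[OF assms(1)] subgroup.one_closed[OF submodule.axioms(1)[OF assms(1)]]
  have "f \<in> H" if "finite T" "f \<in> carrier (Fr S)" "{s \<in> S. f s \<noteq> \<zero>} \<subseteq> T" for T f
    using that
  proof (induction T arbitrary: f rule: finite_induct)
    case empty
    then have "f = \<zero>\<^bsub>Fr S\<^esub>"
      by (intro free_eqI[OF _ F.M.zero_closed]) (auto simp: free_simps)
    then show ?case using E(7) by simp
  next
    case (insert t T)
    show ?case
    proof (cases "t \<in> S")
      case True
      define g where "g = (\<lambda>s\<in>S. if s = t then \<zero> else f s)"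
      have g: "g \<in> carrier (Fr S)"
      proof (rule free_carrierI)
        have "{s \<in> S. g s \<noteq> \<zero>} \<subseteq> {s \<in> S. f s \<noteq> \<zero>}" by (auto simp: g_def)
        then show "finite {s \<in> S. g s \<noteq> \<zero>}" using free_carrierD(3)[OF insert.prems(1)] by (rule finite_subset)
      qed (use insert.prems(1) in \<open>auto simp: g_def free_carrierD\<close>)
      have "{s \<in> S. g s \<noteq> \<zero>} \<subseteq> T" using insert.prems(2) by (auto simp: g_def)
      then have "g \<in> H" by (rule insert.IH[OF g])
      moreover have "f t \<odot>\<^bsub>Fr S\<^esub> delta S t \<in> H"
        using E(4) assms(2) True free_carrierD(1)[OF insert.prems(1)] by simp
      moreover have "f = g \<oplus>\<^bsub>Fr S\<^esub> (f t \<odot>\<^bsub>Fr S\<^esub> delta S t)"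
      proof (rule free_eqI[OF insert.prems(1) F.M.a_closed[OF g F.smult_closed]])
        fix s assume s: "s \<in> S"
        show "f s = (g \<oplus>\<^bsub>Fr S\<^esub> (f t \<odot>\<^bsub>Fr S\<^esub> delta S t)) s"
          using s free_carrierD(1)[OF insert.prems(1)] True by (simp add: free_simps(2,3) g_def delta_def)
      qed (use free_carrierD(1)[OF insert.prems(1)] True delta_closed in auto)
      ultimately show ?thesis using E(5) by metis
    next
      case False
      then show ?thesis using insert by auto
    qed
  qed
  then show ?thesis using E(1) free_carrierD(3) by blast
qed

lemma free_ext:
  assumes "module R X" "f \<in> Hom (Fr S) X" "g \<in> Hom (Fr S) X"
    and "\<And>s. s \<in> S \<Longrightarrow> f (delta S s) = g (delta S s)" "y \<in> carrier (Fr S)"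
  shows "f y = g y"
proof -
  have "{y \<in> carrier (Fr S). f y = g y} = carrier (Fr S)"
    by (rule free_span[OF equalizer_submodule[OF free_module assms(1-3)]]) (simp add: assms(4) delta_closed)
  then show ?thesis using assms(5) by blast
qed

lemma lin_finsum:
  assumes "module R M" "module R N" "finite A" "\<And>i. i \<in> A \<Longrightarrow> f i \<in> Hom M N"
  shows "(\<lambda>x\<in>carrier M. \<Oplus>\<^bsub>N\<^esub>i\<in>A. f i x) \<in> Hom M N"
proof -
  interpret N: module R N by fact
  have "(\<Oplus>\<^bsub>N\<^esub>i\<in>A. f i (x \<oplus>\<^bsub>M\<^esub> y)) = (\<Oplus>\<^bsub>N\<^esub>i\<in>A. f i x) \<oplus>\<^bsub>N\<^esub> (\<Oplus>\<^bsub>N\<^esub>i\<in>A. f i y)"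
    if "x \<in> carrier M" "y \<in> carrier M" for x y
  proof -
    have c: "(\<lambda>i. f i x) \<in> A \<rightarrow> carrier N" "(\<lambda>i. f i y) \<in> A \<rightarrow> carrier N"
      using that lin_closed[OF assms(4)] by auto
    have "(\<Oplus>\<^bsub>N\<^esub>i\<in>A. f i (x \<oplus>\<^bsub>M\<^esub> y)) = (\<Oplus>\<^bsub>N\<^esub>i\<in>A. f i x \<oplus>\<^bsub>N\<^esub> f i y)"
      using that c by (intro N.M.finsum_cong') (auto simp: lin_add[OF assms(4)])
    then show ?thesis using N.M.finsum_addf[OF c] by simp
  qed
  moreover have "(\<Oplus>\<^bsub>N\<^esub>i\<in>A. f i (a \<odot>\<^bsub>M\<^esub> x)) = a \<odot>\<^bsub>N\<^esub> (\<Oplus>\<^bsub>N\<^esub>i\<in>A. f i x)"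
    if "a \<in> carrier R" "x \<in> carrier M" for a x
    using that assms(3,4) by (subst N.finsum_smult_ldistr) (auto intro!: N.M.finsum_cong' simp: lin_smult[OF assms(4)] lin_closed[OF assms(4)])
  ultimately show ?thesis
    using assms by (intro lin_mapI) (auto intro!: N.M.finsum_closed simp: lin_closed[OF assms(4)])
qed

lemma free_extend:
  assumes "module R X" "\<And>s. s \<in> S \<Longrightarrow> b s \<in> carrier X"
  shows "\<exists>h \<in> Hom (Fr S) X. \<forall>s \<in> S. h (delta S s) = b s"
proof -
  interpret X: module R X by fact
  interpret F: module R "Fr S" by (rule free_module)
  define h where "h f = (\<Oplus>\<^bsub>X\<^esub>s\<in>{s \<in> S. f s \<noteq> \<zero>}. f s \<odot>\<^bsub>X\<^esub> b s)" for f
  \<comment> \<open>The defining sum runs over the support, which varies with \<open>f\<close>. Any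
    larger finite set gives the same value, so the sums for two vectors can be taken over a common
    set.\<close>
  have h: "h f = (\<Oplus>\<^bsub>X\<^esub>s\<in>A. f s \<odot>\<^bsub>X\<^esub> b s)"
    if "f \<in> carrier (Fr S)" "finite A" "A \<subseteq> S" "{s \<in> S. f s \<noteq> \<zero>} \<subseteq> A" for f A
    unfolding h_def
  proof (rule X.M.add.finprod_mono_neutral_cong_left[OF that(2,4)])
    fix i assume "i \<in> A - {s \<in> S. f s \<noteq> \<zero>}"
    then show "f i \<odot>\<^bsub>X\<^esub> b i = \<zero>\<^bsub>X\<^esub>" using assms(2) that(3) by auto
  qed (use that assms(2) free_carrierD(1)[OF that(1)] in auto)
  have "(\<lambda>f\<in>carrier (Fr S). h f) \<in> Hom (Fr S) X"
  proof (rule lin_mapI[OF _ _ _ free_module])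
    fix f assume f: "f \<in> carrier (Fr S)"
    note fD = free_carrierD[OF f]
    show "h f \<in> carrier X" unfolding h_def using fD assms(2) by (auto intro!: X.M.finsum_closed)
    show "h (a \<odot>\<^bsub>Fr S\<^esub> f) = a \<odot>\<^bsub>X\<^esub> h f" if a: "a \<in> carrier R" for a
    proof -
      let ?A = "{s \<in> S. f s \<noteq> \<zero>}"
      have "h (a \<odot>\<^bsub>Fr S\<^esub> f) = (\<Oplus>\<^bsub>X\<^esub>s\<in>?A. (a \<odot>\<^bsub>Fr S\<^esub> f) s \<odot>\<^bsub>X\<^esub> b s)"
        using a f fD by (intro h F.smult_closed) (auto simp: free_simps)
      also have "\<dots> = (\<Oplus>\<^bsub>X\<^esub>s\<in>?A. a \<odot>\<^bsub>X\<^esub> (f s \<odot>\<^bsub>X\<^esub> b s))"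
        using a fD assms(2) by (intro X.M.finsum_cong') (auto simp: free_simps X.smult_assoc1)
      also have "\<dots> = a \<odot>\<^bsub>X\<^esub> (\<Oplus>\<^bsub>X\<^esub>s\<in>?A. f s \<odot>\<^bsub>X\<^esub> b s)"
        using a fD assms(2) by (subst X.finsum_smult_ldistr) auto
      finally show ?thesis by (simp add: h_def)
    qed
    show "h (f \<oplus>\<^bsub>Fr S\<^esub> g) = h f \<oplus>\<^bsub>X\<^esub> h g" if g: "g \<in> carrier (Fr S)" for g
    proof -
      note gD = free_carrierD[OF g]
      let ?A = "{s \<in> S. f s \<noteq> \<zero>} \<union> {s \<in> S. g s \<noteq> \<zero>}"
      have A: "finite ?A" "?A \<subseteq> S" using fD(3) gD(3) by auto
      have "h (f \<oplus>\<^bsub>Fr S\<^esub> g) = (\<Oplus>\<^bsub>X\<^esub>s\<in>?A. (f \<oplus>\<^bsub>Fr S\<^esub> g) s \<odot>\<^bsub>X\<^esub> b s)"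
        using f g A by (intro h F.M.a_closed) (auto simp: free_simps)
      also have "\<dots> = (\<Oplus>\<^bsub>X\<^esub>s\<in>?A. f s \<odot>\<^bsub>X\<^esub> b s \<oplus>\<^bsub>X\<^esub> g s \<odot>\<^bsub>X\<^esub> b s)"
        using fD gD assms(2) by (intro X.M.finsum_cong') (auto simp: free_simps X.smult_l_distr)
      also have "\<dots> = (\<Oplus>\<^bsub>X\<^esub>s\<in>?A. f s \<odot>\<^bsub>X\<^esub> b s) \<oplus>\<^bsub>X\<^esub> (\<Oplus>\<^bsub>X\<^esub>s\<in>?A. g s \<odot>\<^bsub>X\<^esub> b s)"
        using fD gD assms(2) by (intro X.M.finsum_addf) auto
      also have "\<dots> = h f \<oplus>\<^bsub>X\<^esub> h g" using h[OF f A] h[OF g A] by simp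
      finally show ?thesis .
    qed
  qed
  moreover have "h (delta S s) = b s" if "s \<in> S" for s
  proof -
    have "h (delta S s) = (\<Oplus>\<^bsub>X\<^esub>t\<in>{s}. delta S s t \<odot>\<^bsub>X\<^esub> b t)"
      using that by (intro h delta_closed) (auto simp: delta_def)
    also have "\<dots> = b s" using that assms(2) by (simp add: delta_def)
    finally show ?thesis .
  qed
  ultimately show ?thesis by (intro bexI) (auto simp: delta_closed)
qed

text \<open>Projectivity, relative to a map whose image merely has to contain the image of
  \<open>f\<close>. In this form it applies directly to the differentials of an exact
  complex.\<close>

lemma free_lift:
  assumes "module R X" "module R B" "f \<in> Hom (Fr S) X" "p \<in> Hom B X"
    and "\<And>y. y \<in> carrier (Fr S) \<Longrightarrow> f y \<in> p ` carrier B"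
  shows "\<exists>g \<in> Hom (Fr S) B. \<forall>y \<in> carrier (Fr S). p (g y) = f y"
proof -
  obtain b where b: "\<And>s. s \<in> S \<Longrightarrow> b s \<in> carrier B \<and> p (b s) = f (delta S s)"
  proof -
    have "\<forall>s \<in> S. \<exists>x. x \<in> carrier B \<and> p x = f (delta S s)"
      using assms(5)[OF delta_closed[of S]] by (metis imageE)
    then show ?thesis using that by (metis bchoice)
  qed
  obtain g where g: "g \<in> Hom (Fr S) B" "\<And>s. s \<in> S \<Longrightarrow> g (delta S s) = b s"
    using free_extend[OF assms(2), of S b] b by blast
  have "p (g y) = f y" if y: "y \<in> carrier (Fr S)" for y
  proof -
    have "(\<lambda>x\<in>carrier (Fr S). p (g x)) y = f y"
      by (rule free_ext[OF assms(1) lin_comp[OF free_module g(1) assms(4)] assms(3) _ y])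
        (simp add: g(2) b delta_closed)
    then show ?thesis using y by simp
  qed
  then show ?thesis using g(1) by blast
qed

lemma coord_lin: "s \<in> S \<Longrightarrow> coord S s \<in> Hom (Fr S) RR"
  unfolding coord_def
  by (rule lin_mapI[OF _ _ _ free_module]) (auto simp: regular_simps free_simps free_carrierD)

lemma lin_tuple:
  assumes "module R B" "finite S" "\<And>s. s \<in> S \<Longrightarrow> h s \<in> Hom B RR"
  shows "(\<lambda>x\<in>carrier B. \<lambda>s\<in>S. h s x) \<in> Hom B (Fr S)"
proof (rule lin_mapI[OF _ _ _ assms(1)])
  show "(\<lambda>s\<in>S. h s x) \<in> carrier (Fr S)" if "x \<in> carrier B" for x
    by (rule free_carrierI)
      (use that assms lin_closed[OF assms(3), of _ x] in \<open>auto simp: regular_simps\<close>)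
qed (auto simp: free_simps lin_add[OF assms(3)] lin_smult[OF assms(3)] regular_simps intro!: ext)

lemma scal_closed:
  assumes "module R P" "module R N" "\<theta> \<in> Hom P RR" "x \<in> carrier N"
  shows "scal P N \<theta> x \<in> Hom P N"
proof -
  interpret N: module R N by fact
  have c: "\<theta> v \<in> carrier R" if "v \<in> carrier P" for v
    using lin_closed[OF assms(3) that] by (simp add: regular_simps)
  show ?thesis unfolding scal_def
    by (rule lin_mapI[OF _ _ _ assms(1)])
      (use assms(4) c in \<open>auto simp: lin_add[OF assms(3)] lin_smult[OF assms(3)] regular_simps
         N.smult_l_distr N.smult_assoc1\<close>)
qed

lemma scal_lin:
  assumes "module R P" "module R N" "\<theta> \<in> Hom P RR"
  shows "(\<lambda>x\<in>carrier N. scal P N \<theta> x) \<in> Hom N (hom_module R P N)"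
proof (rule lin_mapI[OF _ _ _ assms(2)])
  interpret N: module R N by fact
  have c: "\<theta> v \<in> carrier R" if "v \<in> carrier P" for v
    using lin_closed[OF assms(3) that] by (simp add: regular_simps)
  show "scal P N \<theta> (x \<oplus>\<^bsub>N\<^esub> y) = scal P N \<theta> x \<oplus>\<^bsub>hom_module R P N\<^esub> scal P N \<theta> y"
    if "x \<in> carrier N" "y \<in> carrier N" for x y
    using that c by (auto simp: scal_def hom_simps N.smult_r_distr intro!: ext)
  show "scal P N \<theta> (a \<odot>\<^bsub>N\<^esub> x) = a \<odot>\<^bsub>hom_module R P N\<^esub> scal P N \<theta> x"
    if "a \<in> carrier R" "x \<in> carrier N" for a x
    using that c by (auto simp: scal_def hom_simps m_comm simp flip: N.smult_assoc1 intro!: ext)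
qed (use scal_closed[OF assms] in \<open>simp add: hom_simps\<close>)

text \<open>For finite \<open>S\<close> the Hom module is a direct sum of copies of
  \<open>N\<close>, and \<open>scal (Fr S) N (coord S s) x\<close> is the element \<open>x\<close>
  placed in summand \<open>s\<close>. Together with \<open>hom_free_ext\<close> and
  \<open>hom_free_extend\<close> this takes the place of tensor products.\<close>

lemma hom_free_span:
  assumes "finite S" "module R N" "submodule H R (hom_module R (Fr S) N)"
    and "\<And>s x. s \<in> S \<Longrightarrow> x \<in> carrier N \<Longrightarrow> scal (Fr S) N (coord S s) x \<in> H"
  shows "H = Hom (Fr S) N"
proof -
  interpret N: module R N by fact
  interpret C: module R "hom_module R (Fr S) N" by (rule hom_module[OF free_module assms(2)])
  note E = C.submoduleE[OF assms(3)] subgroup.one_closed[OF submodule.axioms(1)[OF assms(3)]]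
  have "u \<in> H" if "finite T" "u \<in> Hom (Fr S) N" "\<And>s. s \<in> S - T \<Longrightarrow> u (delta S s) = \<zero>\<^bsub>N\<^esub>" for T u
    using that
  proof (induction T arbitrary: u rule: finite_induct)
    case empty
    have "u = \<zero>\<^bsub>hom_module R (Fr S) N\<^esub>"
      unfolding hom_simps
      by (rule lin_eqI[OF empty(1) lin_zero_map[OF free_module assms(2)]],
          rule free_ext[OF assms(2) empty(1) lin_zero_map[OF free_module assms(2)]])
        (use empty(2) in \<open>auto simp: delta_closed\<close>)
    then show ?case using E(7) by simp
  next
    case (insert t T)
    show ?case
    proof (cases "t \<in> S")
      case True
      \<comment> \<open>The component of \<open>u\<close> in summand \<open>t\<close>; subtracting
        it leaves a map that vanishes on one more basis vector.\<close>
      define w where "w = scal (Fr S) N (coord S t) (u (delta S t))"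
      define u' where "u' = (\<lambda>x\<in>carrier (Fr S). u x \<ominus>\<^bsub>N\<^esub> w x)"
      have ud: "u (delta S s) \<in> carrier N" for s
        using lin_closed[OF insert.prems(1) delta_closed] .
      have w: "w \<in> Hom (Fr S) N"
        unfolding w_def by (rule scal_closed[OF free_module assms(2) coord_lin[OF True] ud])
      have u': "u' \<in> Hom (Fr S) N" unfolding u'_def
        by (rule lin_diff[OF free_module assms(2) insert.prems(1) w])
      have "u' \<in> H"
      proof (rule insert.IH[OF u'])
        fix s assume s: "s \<in> S - T"
        show "u' (delta S s) = \<zero>\<^bsub>N\<^esub>"
        proof -
          have "w (delta S s) = delta S s t \<odot>\<^bsub>N\<^esub> u (delta S t)"
            by (simp add: w_def scal_def coord_def delta_closed)
          then have "w (delta S s) = u (delta S s)"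
            using s insert.prems(2)[of s] ud[of t] True by (cases "s = t") (auto simp: delta_apply)
          then show ?thesis using ud[of s] by (simp add: u'_def delta_closed a_minus_def N.M.r_neg)
        qed
      qed
      moreover have "w \<in> H" unfolding w_def by (rule assms(4)[OF True ud])
      moreover have "u = u' \<oplus>\<^bsub>hom_module R (Fr S) N\<^esub> w"
      proof (rule lin_eqI[OF insert.prems(1)])
        show "u' \<oplus>\<^bsub>hom_module R (Fr S) N\<^esub> w \<in> Hom (Fr S) N"
          unfolding hom_simps by (rule lin_sum[OF free_module assms(2) u' w])
        fix x assume x: "x \<in> carrier (Fr S)"
        show "u x = (u' \<oplus>\<^bsub>hom_module R (Fr S) N\<^esub> w) x"
          using x lin_closed[OF w x] lin_closed[OF insert.prems(1) x]
          by (simp add: hom_simps u'_def a_minus_def N.M.a_assoc N.M.l_neg)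
      qed
      ultimately show ?thesis using E(5) by metis
    next
      case False
      then show ?thesis using insert by auto
    qed
  qed
  from this[OF assms(1)] show ?thesis using E(1) unfolding hom_simps by auto
qed

lemma hom_free_ext:
  assumes "finite S" "module R N" "module R X"
    and "f \<in> Hom (hom_module R (Fr S) N) X" "g \<in> Hom (hom_module R (Fr S) N) X"
    and "\<And>s x. s \<in> S \<Longrightarrow> x \<in> carrier N \<Longrightarrow>
           f (scal (Fr S) N (coord S s) x) = g (scal (Fr S) N (coord S s) x)"
    and "u \<in> Hom (Fr S) N"
  shows "f u = g u"
proof -
  have "{u \<in> carrier (hom_module R (Fr S) N). f u = g u} = Hom (Fr S) N"
    by (rule hom_free_span[OF assms(1,2) equalizer_submodule[OF hom_module[OF free_module assms(2)] assms(3-5)]])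
      (simp add: assms(6) hom_simps scal_closed[OF free_module assms(2) coord_lin])
  then show ?thesis using assms(7) by blast
qed

text \<open>The universal property of the direct sum: the witness sends \<open>u\<close> to the sum
  over \<open>s\<close> of \<open>h s\<close> applied to the component
  \<open>u (delta S s)\<close>.\<close>

lemma hom_free_extend:
  assumes "finite S" "module R N" "module R X" "\<And>s. s \<in> S \<Longrightarrow> h s \<in> Hom N X"
  shows "\<exists>G \<in> Hom (hom_module R (Fr S) N) X. \<forall>s \<in> S. \<forall>x \<in> carrier N.
           G (scal (Fr S) N (coord S s) x) = h s x"
proof -
  interpret N: module R N by fact
  interpret X: module R X by fact
  let ?C = "hom_module R (Fr S) N"
  have C: "module R ?C" by (rule hom_module[OF free_module assms(2)])
  have ev: "(\<lambda>u\<in>carrier ?C. h s (u (delta S s))) \<in> Hom ?C X" if "s \<in> S" for s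
  proof (rule lin_mapI[OF _ _ _ C])
    note l = lin_closed[OF _ delta_closed] assms(4)[OF that]
    show "h s (u (delta S s)) \<in> carrier X" if "u \<in> carrier ?C" for u
      using that l lin_closed by (metis hom_simps(1))
  next
    note l = lin_closed[OF _ delta_closed]
    fix u v assume "u \<in> carrier ?C" "v \<in> carrier ?C"
    then show "h s ((u \<oplus>\<^bsub>?C\<^esub> v) (delta S s)) = h s (u (delta S s)) \<oplus>\<^bsub>X\<^esub> h s (v (delta S s))"
      using lin_add[OF assms(4)[OF that]] by (simp add: hom_simps delta_closed l[of u] l[of v])
  next
    note l = lin_closed[OF _ delta_closed]
    fix a u assume "a \<in> carrier R" "u \<in> carrier ?C"
    then show "h s ((a \<odot>\<^bsub>?C\<^esub> u) (delta S s)) = a \<odot>\<^bsub>X\<^esub> h s (u (delta S s))"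
      using lin_smult[OF assms(4)[OF that]] by (simp add: hom_simps delta_closed l[of u])
  qed
  define G where "G = (\<lambda>u\<in>carrier ?C. \<Oplus>\<^bsub>X\<^esub>s\<in>S. (\<lambda>u\<in>carrier ?C. h s (u (delta S s))) u)"
  have "G \<in> Hom ?C X" unfolding G_def by (rule lin_finsum[OF C assms(3,1) ev])
  moreover have "G (scal (Fr S) N (coord S s) x) = h s x" if s: "s \<in> S" and x: "x \<in> carrier N" for s x
  proof -
    have sc: "scal (Fr S) N (coord S s) x \<in> Hom (Fr S) N"
      by (rule scal_closed[OF free_module assms(2) coord_lin[OF s] x])
    have "scal (Fr S) N (coord S s) x (delta S t) = (if t = s then x else \<zero>\<^bsub>N\<^esub>)" if "t \<in> S" for t
      using s x by (auto simp: scal_def coord_def delta_closed) (auto simp: delta_def)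
    then have "G (scal (Fr S) N (coord S s) x) = (\<Oplus>\<^bsub>X\<^esub>t\<in>S. if s = t then h s x else \<zero>\<^bsub>X\<^esub>)"
      unfolding G_def using sc x assms(4) lin_closed[OF assms(4)[OF s] x]
      by (auto simp: hom_simps lin_zero[OF assms(2,3)] intro!: X.M.finsum_cong')
    also have "\<dots> = h s x"
      by (rule X.M.add.finprod_singleton[OF s assms(1)]) (use lin_closed[OF assms(4)[OF s] x] in auto)
    finally show ?thesis .
  qed
  ultimately show ?thesis by blast
qed

section \<open>Finitely generated modules\<close>

lemma submodule_trans:
  assumes "module R M" "submodule H R M" "submodule K R (M\<lparr>carrier := H\<rparr>)"
  shows "submodule K R M"
proof -
  note E = module.submoduleE[OF submodule_module[OF assms(1,2)] assms(3)]
    subgroup.one_closed[OF submodule.axioms(1)[OF assms(3)]] submodule_carrier[OF assms(2)]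
  show ?thesis by (rule submodule_I[OF assms(1)]) (use E in auto)
qed

lemma submodule_sub:
  assumes "module R M" "submodule H R M" "submodule K R M" "K \<subseteq> H"
  shows "submodule K R (M\<lparr>carrier := H\<rparr>)"
proof -
  note E = module.submoduleE[OF assms(1,3)] subgroup.one_closed[OF submodule.axioms(1)[OF assms(3)]]
  show ?thesis by (rule submodule_I[OF submodule_module[OF assms(1,2)]]) (use E assms(4) in auto)
qed

lemma submodule_Int:
  assumes "module R M" "submodule H R M" "submodule K R M"
  shows "submodule (H \<inter> K) R M"
proof -
  note E = module.submoduleE[OF assms(1,3)] subgroup.one_closed[OF submodule.axioms(1)[OF assms(3)]]
     module.submoduleE[OF assms(1,2)] subgroup.one_closed[OF submodule.axioms(1)[OF assms(2)]]
  show ?thesis by (rule submodule_I[OF assms(1)]) (use E in auto)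
qed

text \<open>Generation of \<open>H\<close> is tested against submodules of the ambient module, which
  can be intersected and pulled back without changing the record.\<close>

lemma fg_submoduleI:
  assumes "module R M" "submodule H R M" "finite A" "A \<subseteq> H"
    and "\<And>K. submodule K R M \<Longrightarrow> A \<subseteq> K \<Longrightarrow> H \<subseteq> K"
  shows "fg_module R (M\<lparr>carrier := H\<rparr>)"
  unfolding fg_module_def
proof (intro conjI exI[of _ A] allI impI)
  fix K assume K: "submodule K R (M\<lparr>carrier := H\<rparr>) \<and> A \<subseteq> K"
  have "K \<subseteq> H" using submodule_carrier[of K "M\<lparr>carrier := H\<rparr>"] K by simp
  moreover have "H \<subseteq> K" using assms(5)[of K] submodule_trans[OF assms(1,2), of K] K by blast
  ultimately show "K = carrier (M\<lparr>carrier := H\<rparr>)" by simp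
qed (use assms submodule_module in auto)

lemma fg_submoduleD:
  assumes "module R M" "submodule H R M" "fg_module R (M\<lparr>carrier := H\<rparr>)"
  shows "\<exists>A. finite A \<and> A \<subseteq> H \<and> (\<forall>K. submodule K R M \<and> A \<subseteq> K \<longrightarrow> H \<subseteq> K)"
proof -
  obtain A where A: "finite A" "A \<subseteq> H"
    "\<And>K. submodule K R (M\<lparr>carrier := H\<rparr>) \<Longrightarrow> A \<subseteq> K \<Longrightarrow> K = H"
    using assms(3) unfolding fg_module_def by auto
  have "H \<subseteq> K" if "submodule K R M" "A \<subseteq> K" for K
    using A(3)[OF submodule_sub[OF assms(1,2) submodule_Int[OF assms(1,2) that(1)]]] A(2) that(2) by blast
  then show ?thesis using A(1,2) by blast
qed

lemma fg_moduleD: "fg_module R M \<Longrightarrow> module R M"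
  by (simp add: fg_module_def)

lemma fg_image:
  assumes "fg_module R M" "module R N" "f \<in> Hom M N"
  shows "fg_module R (N\<lparr>carrier := f ` carrier M\<rparr>)"
proof -
  note M = fg_moduleD[OF assms(1)]
  obtain A where A: "finite A" "A \<subseteq> carrier M"
    "\<And>K. submodule K R M \<Longrightarrow> A \<subseteq> K \<Longrightarrow> K = carrier M"
    using assms(1) unfolding fg_module_def by blast
  show ?thesis
  proof (rule fg_submoduleI[OF assms(2) range_submodule[OF M assms(2,3)], of "f ` A"])
    fix K assume K: "submodule K R N" "f ` A \<subseteq> K"
    have "{x \<in> carrier M. f x \<in> K} = carrier M"
      by (rule A(3)[OF preimage_submodule[OF M assms(2,3) K(1)]]) (use A(2) K(2) in auto)
    then show "f ` carrier M \<subseteq> K" by blast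
  qed (use A in auto)
qed

lemma fg_free: "finite S \<Longrightarrow> fg_module R (Fr S)"
  unfolding fg_module_def
proof (intro conjI exI[of _ "delta S ` S"] allI impI)
  fix H assume "submodule H R (Fr S) \<and> delta S ` S \<subseteq> H"
  then show "H = carrier (Fr S)" by (intro free_span) auto
qed (auto simp: delta_closed free_module)

lemma fg_regular: "fg_module R RR"
  unfolding fg_module_def
proof (intro conjI exI[of _ "{\<one>}"] allI impI)
  fix H assume H: "submodule H R RR \<and> {\<one>} \<subseteq> H"
  have "x \<in> H" if "x \<in> carrier R" for x
    using submodule.smult_closed[of H R RR x \<one>] H that by (simp add: regular_simps)
  then show "H = carrier RR" using submodule_carrier[of H RR] H by (auto simp: regular_simps)
qed (auto simp: regular_module regular_simps)

text \<open>Generators are the elements of a generating set of \<open>N\<close> placed in the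
  various summands. For fixed \<open>s\<close>, the \<open>x\<close> whose placement lies in
  \<open>H\<close> form a submodule of \<open>N\<close>.\<close>

lemma fg_hom_free:
  assumes "finite S" "fg_module R N"
  shows "fg_module R (hom_module R (Fr S) N)"
proof -
  note N = fg_moduleD[OF assms(2)]
  obtain A where A: "finite A" "A \<subseteq> carrier N"
    "\<And>K. submodule K R N \<Longrightarrow> A \<subseteq> K \<Longrightarrow> K = carrier N"
    using assms(2) unfolding fg_module_def by blast
  let ?C = "hom_module R (Fr S) N"
  have C: "module R ?C" by (rule hom_module[OF free_module N])
  let ?A = "(\<lambda>(s, x). scal (Fr S) N (coord S s) x) ` (S \<times> A)"
  show ?thesis
    unfolding fg_module_def
  proof (intro conjI exI[of _ ?A] allI impI)
    fix H assume H: "submodule H R ?C \<and> ?A \<subseteq> H"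
    have "scal (Fr S) N (coord S s) x \<in> H" if "s \<in> S" "x \<in> carrier N" for s x
    proof -
      have "{x \<in> carrier N. (\<lambda>x\<in>carrier N. scal (Fr S) N (coord S s) x) x \<in> H} = carrier N"
        by (rule A(3)[OF preimage_submodule[OF N C scal_lin[OF free_module N coord_lin[OF that(1)]]]])
          (use A(2) H that(1) in auto)
      then have "x \<in> {x \<in> carrier N. (\<lambda>x\<in>carrier N. scal (Fr S) N (coord S s) x) x \<in> H}"
        using that(2) by metis
      then show ?thesis using that(2) by simp
    qed
    then show "H = carrier ?C" using hom_free_span[OF assms(1) N] H by (simp add: hom_simps)
  next
    have "scal (Fr S) N (coord S s) x \<in> Hom (Fr S) N" if "s \<in> S" "x \<in> A" for s x
      using that A(2) by (intro scal_closed[OF free_module N coord_lin]) auto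
    then show "?A \<subseteq> carrier ?C" by (auto simp: hom_simps)
  qed (use C A assms(1) in auto)
qed

text \<open>Infinity of the index type supplies a basis of the same size as a given finite
  generating set.\<close>

lemma fg_cover:
  assumes "fg_module R M" "infinite (UNIV :: 'i set)"
  shows "\<exists>(S :: 'i set) p. finite S \<and> p \<in> Hom (Fr S) M \<and> p ` carrier (Fr S) = carrier M"
proof -
  note M = fg_moduleD[OF assms(1)]
  obtain A where A: "finite A" "A \<subseteq> carrier M"
    "\<And>K. submodule K R M \<Longrightarrow> A \<subseteq> K \<Longrightarrow> K = carrier M"
    using assms(1) unfolding fg_module_def by blast
  obtain S :: "'i set" where S: "finite S" "card S = card A"
    using infinite_arbitrarily_large[OF assms(2)] by blast
  then obtain b where b: "bij_betw b S A"
    using A(1) finite_same_card_bij by blast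
  then have "b s \<in> carrier M" if "s \<in> S" for s using that A(2) by (auto simp: bij_betw_def)
  then obtain p where p: "p \<in> Hom (Fr S) M" "\<And>s. s \<in> S \<Longrightarrow> p (delta S s) = b s"
    using free_extend[OF M, of S b] by blast
  have "p ` carrier (Fr S) = carrier M"
  proof (rule A(3)[OF range_submodule[OF free_module M p(1)]])
    show "A \<subseteq> p ` carrier (Fr S)"
    proof
      fix x assume "x \<in> A"
      then obtain s where "s \<in> S" "b s = x" using b by (auto simp: bij_betw_def)
      then have "x = p (delta S s)" using p(2) by simp
      then show "x \<in> p ` carrier (Fr S)" by (rule image_eqI[OF _ delta_closed])
    qed
  qed
  then show ?thesis using S(1) p(1) by blast
qed

end

section \<open>Submodules of finitely generated modules over a Noetherian ring\<close>

locale noetherian_base_ring = base_ring + noetherian_ring R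
begin

text \<open>Induction on the set \<open>T\<close> of coordinates that may be nonzero on
  \<open>H\<close>. The \<open>t\<close>-th coordinates of \<open>H\<close> form a finitely
  generated ideal; lifts of its generators, together with generators of the part of \<open>H\<close>
  whose \<open>t\<close>-th coordinate is zero, generate \<open>H\<close>.\<close>

lemma free_noetherian:
  assumes "finite S" "submodule H R (Fr S)"
  shows "\<exists>A. finite A \<and> A \<subseteq> H \<and> (\<forall>K. submodule K R (Fr S) \<and> A \<subseteq> K \<longrightarrow> H \<subseteq> K)"
proof -
  interpret F: module R "Fr S" by (rule free_module)
  have "\<exists>A. finite A \<and> A \<subseteq> H \<and> (\<forall>K. submodule K R (Fr S) \<and> A \<subseteq> K \<longrightarrow> H \<subseteq> K)"
    if "finite T" "submodule H R (Fr S)" "\<And>f s. f \<in> H \<Longrightarrow> s \<in> S - T \<Longrightarrow> f s = \<zero>" for T H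
    using that
  proof (induction T arbitrary: H rule: finite_induct)
    case empty
    have "f = \<zero>\<^bsub>Fr S\<^esub>" if "f \<in> H" for f
      using empty(2)[OF that] submodule_carrier[OF empty(1)] that
      by (intro free_eqI[OF _ F.M.zero_closed]) (auto simp: free_simps)
    then have "H \<subseteq> {\<zero>\<^bsub>Fr S\<^esub>}" by blast
    then show ?case
      using subgroup.one_closed[OF submodule.axioms(1)]
      by (intro exI[of _ "{}"]) fastforce
  next
    case (insert t T)
    show ?case
    proof (cases "t \<in> S")
      case False
      then show ?thesis using insert by blast
    next
      case True
      note HS = submodule_carrier[OF insert.prems(1)]
      \<comment> \<open>Stated for every submodule because it serves twice: for \<open>H\<close> and
        for the intersection of \<open>H\<close> with a test submodule \<open>K\<close>.\<close>
      have ideal: "ideal (coord S t ` K) R" if "submodule K R (Fr S)" for K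
      proof -
        have "submodule (coord S t ` K) R RR"
          by (rule image_submodule[OF free_module regular_module coord_lin[OF True] that])
        note E = module.submoduleE[OF regular_module this] subgroup.one_closed[OF submodule.axioms(1)[OF this]]
        show ?thesis
        proof (rule idealI[OF ring_axioms])
          show "subgroup (coord S t ` K) (add_monoid R)"
          proof (rule add.subgroupI)
            fix a assume a: "a \<in> coord S t ` K"
            then have aR: "a \<in> carrier R" using E(1) by (auto simp: regular_simps)
            have "(\<ominus> \<one>) \<odot>\<^bsub>RR\<^esub> a \<in> coord S t ` K" using a E(4) by simp
            then show "\<ominus> a \<in> coord S t ` K" using aR by (simp add: regular_simps l_minus)
          qed (use E in \<open>auto simp: regular_simps\<close>)
          fix a x assume a: "a \<in> coord S t ` K" "x \<in> carrier R"
          then show "x \<otimes> a \<in> coord S t ` K" using E(4)[of x a] by (simp add: regular_simps)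
          moreover have "a \<in> carrier R" using E(1) a by (auto simp: regular_simps)
          ultimately show "a \<otimes> x \<in> coord S t ` K" using a(2) by (simp add: m_comm)
        qed
      qed
      obtain G where G: "G \<subseteq> carrier R" "finite G" "coord S t ` H = Idl G"
        using finetely_gen[OF ideal[OF insert.prems(1)]] by (elim exE conjE) (rule that)
      have "G \<subseteq> coord S t ` H" using genideal_self[OF G(1)] G(3) by simp
      then obtain A1 where A1: "finite A1" "A1 \<subseteq> H" "G = coord S t ` A1"
        using finite_subset_image[OF G(2), of "coord S t" H] that by blast
      let ?H0 = "H \<inter> {f \<in> carrier (Fr S). coord S t f = \<zero>\<^bsub>RR\<^esub>}"
      have H0: "submodule ?H0 R (Fr S)"
        by (rule submodule_Int[OF free_module insert.prems(1) kernel_submodule[OF free_module regular_module coord_lin[OF True]]])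
      have "\<exists>A. finite A \<and> A \<subseteq> ?H0 \<and> (\<forall>K. submodule K R (Fr S) \<and> A \<subseteq> K \<longrightarrow> ?H0 \<subseteq> K)"
      proof (rule insert.IH[OF H0])
        fix f s assume "f \<in> ?H0" "s \<in> S - T"
        then show "f s = \<zero>" using insert.prems(2)[of f s] by (cases "s = t") (auto simp: coord_def regular_simps)
      qed
      then obtain A0 where A0: "finite A0" "A0 \<subseteq> ?H0"
        "\<forall>K. submodule K R (Fr S) \<and> A0 \<subseteq> K \<longrightarrow> ?H0 \<subseteq> K"
        by (elim exE conjE) (rule that)
      have "H \<subseteq> K" if K: "submodule K R (Fr S)" "A0 \<union> A1 \<subseteq> K" for K
      proof
        fix f assume f: "f \<in> H"
        \<comment> \<open>The \<open>t\<close>-th coordinate of \<open>f\<close> is thus also that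
          of some \<open>h\<close> in both \<open>H\<close> and \<open>K\<close>, and
          \<open>f\<close> minus \<open>h\<close> falls under the induction hypothesis.\<close>
        have "Idl G \<subseteq> coord S t ` (H \<inter> K)"
          by (rule genideal_minimal[OF ideal[OF submodule_Int[OF free_module insert.prems(1) K(1)]]])
            (use A1 K(2) in auto)
        then obtain h where h: "h \<in> H" "h \<in> K" "coord S t f = coord S t h" using f G(3) by blast
        have car: "f \<in> carrier (Fr S)" "h \<in> carrier (Fr S)" using f h HS by auto
        have "coord S t (f \<ominus>\<^bsub>Fr S\<^esub> h) = coord S t f \<ominus>\<^bsub>RR\<^esub> coord S t h"
          by (rule lin_minus[OF free_module regular_module coord_lin[OF True] car])
        also have "\<dots> = \<zero>\<^bsub>RR\<^esub>"
          using h(3) lin_closed[OF coord_lin[OF True] car(2)] module.axioms(2)[OF regular_module]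
          by (simp add: a_minus_def abelian_group.r_neg)
        finally have "f \<ominus>\<^bsub>Fr S\<^esub> h \<in> ?H0"
          using submodule_minus[OF free_module insert.prems(1) f h(1)] car by simp
        moreover have "?H0 \<subseteq> K" by (rule A0(3)[rule_format]) (use K in auto)
        ultimately have "f \<ominus>\<^bsub>Fr S\<^esub> h \<in> K" by (rule rev_subsetD)
        then have "(f \<ominus>\<^bsub>Fr S\<^esub> h) \<oplus>\<^bsub>Fr S\<^esub> h \<in> K" using F.submoduleE(5)[OF K(1)] h(2) by blast
        then show "f \<in> K" using car by (simp add: a_minus_def F.M.a_assoc F.M.l_neg)
      qed
      then show ?thesis using A0(1,2) A1(1,2) by (intro exI[of _ "A0 \<union> A1"]) blast
    qed
  qed
  from this[OF assms(1,2)] show ?thesis by blast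
qed

text \<open>Pull \<open>H\<close> back along a finite free cover of \<open>M\<close>; the images of
  generators of the preimage generate \<open>H\<close>.\<close>

lemma fg_submodule:
  assumes "fg_module R M" "submodule H R M"
  shows "fg_module R (M\<lparr>carrier := H\<rparr>)"
proof -
  note M = fg_moduleD[OF assms(1)]
  obtain S :: "nat set" and p where S: "finite S" "p \<in> Hom (Fr S) M" "p ` carrier (Fr S) = carrier M"
    using fg_cover[OF assms(1), where 'i = nat] by auto
  let ?P = "{x \<in> carrier (Fr S). p x \<in> H}"
  have P: "submodule ?P R (Fr S)" by (rule preimage_submodule[OF free_module M S(2) assms(2)])
  obtain A where A: "finite A" "A \<subseteq> ?P" "\<forall>K. submodule K R (Fr S) \<and> A \<subseteq> K \<longrightarrow> ?P \<subseteq> K"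
    using free_noetherian[OF S(1) P] by (elim exE conjE) (rule that)
  show ?thesis
  proof (rule fg_submoduleI[OF M assms(2), of "p ` A"])
    fix K assume K: "submodule K R M" "p ` A \<subseteq> K"
    have *: "?P \<subseteq> {x \<in> carrier (Fr S). p x \<in> K}"
      by (rule A(3)[rule_format]) (use preimage_submodule[OF free_module M S(2) K(1)] A(2) K(2) in auto)
    show "H \<subseteq> K"
    proof
      fix x assume x: "x \<in> H"
      then have "x \<in> p ` carrier (Fr S)" using S(3) submodule_carrier[OF assms(2)] by auto
      then show "x \<in> K" using x * by blast
    qed
  qed (use A in auto)
qed

section \<open>Free resolutions and Ext\<close>

lemma free_resolutionD:
  assumes "free_resolution R M S d e"
  shows "e \<in> Hom (Fr (S 0)) M" "d n \<in> Hom (Fr (S (Suc n))) (Fr (S n))"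
    and "e ` carrier (Fr (S 0)) = carrier M"
    and "y \<in> carrier (Fr (S (Suc 0))) \<Longrightarrow> e (d 0 y) = \<zero>\<^bsub>M\<^esub>"
    and "y \<in> carrier (Fr (S (Suc (Suc n)))) \<Longrightarrow> d n (d (Suc n) y) = \<zero>\<^bsub>Fr (S n)\<^esub>"
    and "x \<in> carrier (Fr (S 0)) \<Longrightarrow> e x = \<zero>\<^bsub>M\<^esub> \<Longrightarrow> x \<in> d 0 ` carrier (Fr (S (Suc 0)))"
    and "x \<in> carrier (Fr (S (Suc n))) \<Longrightarrow> d n x = \<zero>\<^bsub>Fr (S n)\<^esub> \<Longrightarrow>
           x \<in> d (Suc n) ` carrier (Fr (S (Suc (Suc n))))"
proof -
  have A: "e \<in> Hom (Fr (S 0)) M" "\<And>n. d n \<in> Hom (Fr (S (Suc n))) (Fr (S n))"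
    "e ` carrier (Fr (S 0)) = carrier M"
    "d 0 ` carrier (Fr (S (Suc 0))) = {x \<in> carrier (Fr (S 0)). e x = \<zero>\<^bsub>M\<^esub>}"
    "\<And>n. d (Suc n) ` carrier (Fr (S (Suc (Suc n)))) =
       {x \<in> carrier (Fr (S (Suc n))). d n x = \<zero>\<^bsub>Fr (S n)\<^esub>}"
    using assms unfolding free_resolution_def a_kernel_def' by simp_all
  show "e \<in> Hom (Fr (S 0)) M" "d n \<in> Hom (Fr (S (Suc n))) (Fr (S n))"
    "e ` carrier (Fr (S 0)) = carrier M" by (fact A)+
  show "e (d 0 y) = \<zero>\<^bsub>M\<^esub>" if "y \<in> carrier (Fr (S (Suc 0)))"
    using A(4) imageI[OF that, of "d 0"] by simp
  show "d n (d (Suc n) y) = \<zero>\<^bsub>Fr (S n)\<^esub>" if "y \<in> carrier (Fr (S (Suc (Suc n))))"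
    using A(5)[of n] imageI[OF that, of "d (Suc n)"] by simp
  show "x \<in> d 0 ` carrier (Fr (S (Suc 0)))" if "x \<in> carrier (Fr (S 0))" "e x = \<zero>\<^bsub>M\<^esub>"
    using A(4) that by simp
  show "x \<in> d (Suc n) ` carrier (Fr (S (Suc (Suc n))))"
    if "x \<in> carrier (Fr (S (Suc n)))" "d n x = \<zero>\<^bsub>Fr (S n)\<^esub>"
    using A(5)[of n] that by simp
qed

lemma free_resolution_exact:
  assumes "free_resolution R M S d e"
  shows "d 0 ` carrier (Fr (S (Suc 0))) = {x \<in> carrier (Fr (S 0)). e x = \<zero>\<^bsub>M\<^esub>}"
    and "d (Suc n) ` carrier (Fr (S (Suc (Suc n)))) =
       {x \<in> carrier (Fr (S (Suc n))). d n x = \<zero>\<^bsub>Fr (S n)\<^esub>}"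
  using assms unfolding free_resolution_def a_kernel_def' by simp_all

lemma free_resolutionI:
  assumes "e \<in> Hom (Fr (S 0)) M" "\<And>n. d n \<in> Hom (Fr (S (Suc n))) (Fr (S n))"
    and "e ` carrier (Fr (S 0)) = carrier M"
    and "\<And>y. y \<in> carrier (Fr (S (Suc 0))) \<Longrightarrow> e (d 0 y) = \<zero>\<^bsub>M\<^esub>"
    and "\<And>n y. y \<in> carrier (Fr (S (Suc (Suc n)))) \<Longrightarrow> d n (d (Suc n) y) = \<zero>\<^bsub>Fr (S n)\<^esub>"
    and "\<And>x. x \<in> carrier (Fr (S 0)) \<Longrightarrow> e x = \<zero>\<^bsub>M\<^esub> \<Longrightarrow> x \<in> d 0 ` carrier (Fr (S (Suc 0)))"
    and "\<And>n x. x \<in> carrier (Fr (S (Suc n))) \<Longrightarrow> d n x = \<zero>\<^bsub>Fr (S n)\<^esub> \<Longrightarrow>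
           x \<in> d (Suc n) ` carrier (Fr (S (Suc (Suc n))))"
  shows "free_resolution R M S d e"
  unfolding free_resolution_def a_kernel_def'
proof (intro conjI allI)
  show "d 0 ` carrier (Fr (S 1)) = {x \<in> carrier (Fr (S 0)). e x = \<zero>\<^bsub>M\<^esub>}"
    using assms(4,6) lin_closed[OF assms(2)[of 0]] by auto
  show "d (Suc n) ` carrier (Fr (S (Suc (Suc n)))) =
       {x \<in> carrier (Fr (S (Suc n))). d n x = \<zero>\<^bsub>Fr (S n)\<^esub>}" for n
    using assms(5,7) lin_closed[OF assms(2)[of "Suc n"]] by auto
qed (use assms in auto)

lemma chain_map_exists:
  assumes "free_resolution R M S d e" "free_resolution R M S' d' e'" "module R M"
  shows "\<exists>\<phi>. (\<forall>n. \<phi> n \<in> Hom (Fr (S n)) (Fr (S' n))) \<and>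
           (\<forall>y \<in> carrier (Fr (S 0)). e' (\<phi> 0 y) = e y) \<and>
           (\<forall>n. \<forall>y \<in> carrier (Fr (S (Suc n))). d' n (\<phi> (Suc n) y) = \<phi> n (d n y))"
proof -
  note D = free_resolutionD[OF assms(1)] and D' = free_resolutionD[OF assms(2)]
  \<comment> \<open>The invariant is what makes the next lift possible: \<open>x\<close> after the
    differential lands in the cycles of the second resolution. In degree 0 compatibility with the
    augmentations plays that part.\<close>
  define P where "P n x \<longleftrightarrow> x \<in> Hom (Fr (S n)) (Fr (S' n)) \<and>
     (case n of 0 \<Rightarrow> \<forall>y \<in> carrier (Fr (S 0)). e' (x y) = e y
      | Suc m \<Rightarrow> \<forall>y \<in> carrier (Fr (S (Suc n))). d' m (x (d n y)) = \<zero>\<^bsub>Fr (S' m)\<^esub>)" for n x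
  have "\<exists>x. P 0 x"
    using free_lift[OF assms(3) free_module D(1) D'(1)] D'(3) lin_closed[OF D(1)]
    unfolding P_def by auto
  moreover have "\<exists>x'. P (Suc n) x' \<and> (\<forall>y \<in> carrier (Fr (S (Suc n))). d' n (x' y) = x (d n y))"
    if P: "P n x" for n x
  proof -
    have x: "x \<in> Hom (Fr (S n)) (Fr (S' n))" using P by (simp add: P_def)
    have "x (d n y) \<in> d' n ` carrier (Fr (S' (Suc n)))" if y: "y \<in> carrier (Fr (S (Suc n)))" for y
    proof (cases n)
      case 0
      then have "e' (x (d 0 y)) = \<zero>\<^bsub>M\<^esub>"
        using P D(4) y lin_closed[OF D(2)[of 0]] by (simp add: P_def)
      moreover have "x (d 0 y) \<in> carrier (Fr (S' 0))"
        using x y 0 lin_closed[OF x] lin_closed[OF D(2)[of 0]] by simp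
      ultimately show ?thesis using D'(6) 0 by simp
    next
      case (Suc m)
      then have "d' m (x (d n y)) = \<zero>\<^bsub>Fr (S' m)\<^esub>" using P y by (simp add: P_def)
      moreover have "x (d n y) \<in> carrier (Fr (S' (Suc m)))"
        using lin_closed[OF x] lin_closed[OF D(2)[of n] y] Suc by simp
      ultimately show ?thesis using D'(7)[of "x (d n y)" m] Suc by simp
    qed
    then obtain x' where x': "x' \<in> Hom (Fr (S (Suc n))) (Fr (S' (Suc n)))"
      "\<And>y. y \<in> carrier (Fr (S (Suc n))) \<Longrightarrow> d' n (x' y) = x (d n y)"
      using free_lift[OF free_module free_module lin_comp[OF free_module D(2)[of n] x] D'(2)[of n]]
      by auto
    have "d' n (x' (d (Suc n) y)) = \<zero>\<^bsub>Fr (S' n)\<^esub>" if "y \<in> carrier (Fr (S (Suc (Suc n))))" for y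
      using x'(2)[OF lin_closed[OF D(2)[of "Suc n"] that]] D(5)[OF that] lin_zero[OF free_module free_module x]
      by simp
    then show ?thesis using x' unfolding P_def by auto
  qed
  ultimately obtain \<phi> where \<phi>: "\<And>n. P n (\<phi> n)"
      "\<And>n. \<forall>y \<in> carrier (Fr (S (Suc n))). d' n (\<phi> (Suc n) y) = \<phi> n (d n y)"
    using dependent_nat_choice[of P "\<lambda>n x x'. \<forall>y \<in> carrier (Fr (S (Suc n))). d' n (x' y) = x (d n y)"]
    by blast
  show ?thesis
  proof (intro exI[of _ \<phi>] conjI allI)
    show "\<phi> n \<in> Hom (Fr (S n)) (Fr (S' n))" for n using \<phi>(1)[of n] by (simp add: P_def)
    show "\<forall>y \<in> carrier (Fr (S 0)). e' (\<phi> 0 y) = e y" using \<phi>(1)[of 0] by (simp add: P_def)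
  qed (use \<phi>(2) in auto)
qed

text \<open>The chain map \<open>\<alpha>\<close> covers the zero map of \<open>M\<close>. The
  homotopy relation is recorded in positive degrees, which are those that
  \<open>ext_vanishes\<close> speaks of.\<close>

lemma null_homotopy_exists:
  assumes "free_resolution R M S d e" "module R M"
    and a: "\<And>n. \<alpha> n \<in> Hom (Fr (S n)) (Fr (S n))"
    and "\<And>y. y \<in> carrier (Fr (S 0)) \<Longrightarrow> e (\<alpha> 0 y) = \<zero>\<^bsub>M\<^esub>"
    and ac: "\<And>n y. y \<in> carrier (Fr (S (Suc n))) \<Longrightarrow> d n (\<alpha> (Suc n) y) = \<alpha> n (d n y)"
  shows "\<exists>s. (\<forall>n. s n \<in> Hom (Fr (S n)) (Fr (S (Suc n)))) \<and>
           (\<forall>n. \<forall>y \<in> carrier (Fr (S (Suc n))).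
              d (Suc n) (s (Suc n) y) = \<alpha> (Suc n) y \<ominus>\<^bsub>Fr (S (Suc n))\<^esub> s n (d n y))"
proof -
  note D = free_resolutionD[OF assms(1)]
  \<comment> \<open>The second clause says that \<open>\<alpha> (Suc n)\<close> minus
    \<open>s\<close> after \<open>d n\<close> lands in the kernel of \<open>d n\<close>, so that
    exactness yields the next map.\<close>
  define P where "P n s \<longleftrightarrow> s \<in> Hom (Fr (S n)) (Fr (S (Suc n))) \<and>
     (\<forall>y \<in> carrier (Fr (S (Suc n))). d n (s (d n y)) = d n (\<alpha> (Suc n) y))" for n s
  have "\<exists>s. P 0 s"
  proof -
    have "\<alpha> 0 y \<in> d 0 ` carrier (Fr (S (Suc 0)))" if "y \<in> carrier (Fr (S 0))" for y
      using D(6) lin_closed[OF a that] assms(4)[OF that] by blast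
    then obtain s where s: "s \<in> Hom (Fr (S 0)) (Fr (S (Suc 0)))"
        "\<And>y. y \<in> carrier (Fr (S 0)) \<Longrightarrow> d 0 (s y) = \<alpha> 0 y"
      using free_lift[OF free_module free_module a D(2)[of 0]] by blast
    then show ?thesis
      using ac lin_closed[OF D(2)[of 0]] unfolding P_def by auto
  qed
  moreover have "\<exists>s'. P (Suc n) s' \<and> (\<forall>y \<in> carrier (Fr (S (Suc n))).
              d (Suc n) (s' y) = \<alpha> (Suc n) y \<ominus>\<^bsub>Fr (S (Suc n))\<^esub> s (d n y))"
    if P: "P n s" for n s
  proof -
    interpret F: module R "Fr (S n)" by (rule free_module)
    interpret F1: module R "Fr (S (Suc n))" by (rule free_module)
    have s: "s \<in> Hom (Fr (S n)) (Fr (S (Suc n)))" using P by (simp add: P_def)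
    have sd: "(\<lambda>y\<in>carrier (Fr (S (Suc n))). s (d n y)) \<in> Hom (Fr (S (Suc n))) (Fr (S (Suc n)))"
      by (rule lin_comp[OF free_module D(2) s])
    define t where "t = (\<lambda>y\<in>carrier (Fr (S (Suc n))). \<alpha> (Suc n) y \<ominus>\<^bsub>Fr (S (Suc n))\<^esub>
        (\<lambda>y\<in>carrier (Fr (S (Suc n))). s (d n y)) y)"
    have t: "t \<in> Hom (Fr (S (Suc n))) (Fr (S (Suc n)))"
      unfolding t_def by (rule lin_diff[OF free_module free_module a sd])
    have tv: "t y = \<alpha> (Suc n) y \<ominus>\<^bsub>Fr (S (Suc n))\<^esub> s (d n y)" if "y \<in> carrier (Fr (S (Suc n)))" for y
      using that by (simp add: t_def)
    have "t y \<in> d (Suc n) ` carrier (Fr (S (Suc (Suc n))))" if y: "y \<in> carrier (Fr (S (Suc n)))" for y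
    proof (rule D(7)[OF lin_closed[OF t y]])
      have c: "\<alpha> (Suc n) y \<in> carrier (Fr (S (Suc n)))" "s (d n y) \<in> carrier (Fr (S (Suc n)))"
        using lin_closed[OF a y] lin_closed[OF s lin_closed[OF D(2) y]] by auto
      have "d n (t y) = d n (\<alpha> (Suc n) y) \<ominus>\<^bsub>Fr (S n)\<^esub> d n (s (d n y))"
        unfolding tv[OF y] by (rule lin_minus[OF free_module free_module D(2) c])
      also have "\<dots> = d n (\<alpha> (Suc n) y) \<ominus>\<^bsub>Fr (S n)\<^esub> d n (\<alpha> (Suc n) y)"
        using P y by (simp add: P_def)
      also have "\<dots> = \<zero>\<^bsub>Fr (S n)\<^esub>" using lin_closed[OF D(2) c(1)] by (simp add: a_minus_def F.M.r_neg)
      finally show "d n (t y) = \<zero>\<^bsub>Fr (S n)\<^esub>" .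
    qed
    then obtain s' where s': "s' \<in> Hom (Fr (S (Suc n))) (Fr (S (Suc (Suc n))))"
        "\<And>y. y \<in> carrier (Fr (S (Suc n))) \<Longrightarrow> d (Suc n) (s' y) = t y"
      using free_lift[OF free_module free_module t D(2)[of "Suc n"]] by blast
    have "d (Suc n) (s' (d (Suc n) y)) = d (Suc n) (\<alpha> (Suc (Suc n)) y)"
      if y: "y \<in> carrier (Fr (S (Suc (Suc n))))" for y
    proof -
      have dy: "d (Suc n) y \<in> carrier (Fr (S (Suc n)))" by (rule lin_closed[OF D(2) y])
      have "d (Suc n) (s' (d (Suc n) y)) = \<alpha> (Suc n) (d (Suc n) y) \<ominus>\<^bsub>Fr (S (Suc n))\<^esub> \<zero>\<^bsub>Fr (S (Suc n))\<^esub>"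
        using s'(2)[OF dy] tv[OF dy] D(5)[OF y] lin_zero[OF free_module free_module s] by simp
      also have "\<dots> = \<alpha> (Suc n) (d (Suc n) y)"
        using lin_closed[OF a dy] by (simp add: a_minus_def)
      finally show ?thesis using ac[OF y] by simp
    qed
    then show ?thesis using s' tv unfolding P_def by auto
  qed
  ultimately obtain s where s: "\<And>n. P n (s n)" "\<And>n. \<forall>y \<in> carrier (Fr (S (Suc n))).
        d (Suc n) (s (Suc n) y) = \<alpha> (Suc n) y \<ominus>\<^bsub>Fr (S (Suc n))\<^esub> s n (d n y)"
    using dependent_nat_choice[of P "\<lambda>n s s'. \<forall>y \<in> carrier (Fr (S (Suc n))).
              d (Suc n) (s' y) = \<alpha> (Suc n) y \<ominus>\<^bsub>Fr (S (Suc n))\<^esub> s (d n y)"]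
    by blast
  then show ?thesis unfolding P_def by blast
qed

lemma ext_vanishesD:
  assumes "ext_vanishes R S d X i" "f \<in> Hom (Fr (S (Suc i))) X"
    and "\<And>y. y \<in> carrier (Fr (S (Suc (Suc i)))) \<Longrightarrow> f (d (Suc i) y) = \<zero>\<^bsub>X\<^esub>"
  obtains g where "g \<in> Hom (Fr (S i)) X" "\<And>y. y \<in> carrier (Fr (S (Suc i))) \<Longrightarrow> f y = g (d i y)"
  using assms unfolding ext_vanishes_def by blast

lemma ext_vanishesI:
  assumes "\<And>f. f \<in> Hom (Fr (S (Suc i))) X \<Longrightarrow>
       (\<And>y. y \<in> carrier (Fr (S (Suc (Suc i)))) \<Longrightarrow> f (d (Suc i) y) = \<zero>\<^bsub>X\<^esub>) \<Longrightarrow>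
       \<exists>g \<in> Hom (Fr (S i)) X. \<forall>y \<in> carrier (Fr (S (Suc i))). f y = g (d i y)"
  shows "ext_vanishes R S d X i"
  using assms unfolding ext_vanishes_def by blast

text \<open>Transport the cocycle \<open>f\<close> along a chain map \<open>\<psi>\<close>, bound it
  in the other resolution by \<open>g\<close>, and come back along \<open>\<phi>\<close>. The error,
  the difference of \<open>\<psi>\<close> after \<open>\<phi>\<close> and the identity, is null
  homotopic.\<close>

lemma ext_vanishes_independent:
  assumes "free_resolution R M S d e" "free_resolution R M S' d' e'" "module R M" "module R X"
    and "ext_vanishes R S' d' X i"
  shows "ext_vanishes R S d X i"
proof (rule ext_vanishesI)
  interpret X: module R X by fact
  note D = free_resolutionD[OF assms(1)] and D' = free_resolutionD[OF assms(2)]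
  fix f assume f: "f \<in> Hom (Fr (S (Suc i))) X"
    and fz: "\<And>y. y \<in> carrier (Fr (S (Suc (Suc i)))) \<Longrightarrow> f (d (Suc i) y) = \<zero>\<^bsub>X\<^esub>"
  obtain \<phi> where \<phi>: "\<And>n. \<phi> n \<in> Hom (Fr (S n)) (Fr (S' n))"
      "\<And>y. y \<in> carrier (Fr (S 0)) \<Longrightarrow> e' (\<phi> 0 y) = e y"
      "\<And>n y. y \<in> carrier (Fr (S (Suc n))) \<Longrightarrow> d' n (\<phi> (Suc n) y) = \<phi> n (d n y)"
    using chain_map_exists[OF assms(1-3)] by blast
  obtain \<psi> where \<psi>: "\<And>n. \<psi> n \<in> Hom (Fr (S' n)) (Fr (S n))"
      "\<And>y. y \<in> carrier (Fr (S' 0)) \<Longrightarrow> e (\<psi> 0 y) = e' y"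
      "\<And>n y. y \<in> carrier (Fr (S' (Suc n))) \<Longrightarrow> d n (\<psi> (Suc n) y) = \<psi> n (d' n y)"
    using chain_map_exists[OF assms(2,1,3)] by blast
  define \<beta> where "\<beta> n = (\<lambda>y\<in>carrier (Fr (S n)). \<psi> n (\<phi> n y))" for n
  have \<beta>: "\<beta> n \<in> Hom (Fr (S n)) (Fr (S n))" for n
    unfolding \<beta>_def by (rule lin_comp[OF free_module \<phi>(1) \<psi>(1)])
  have id: "(\<lambda>y\<in>carrier (Fr (S n)). y) \<in> Hom (Fr (S n)) (Fr (S n))" for n
    by (rule lin_mapI[OF _ _ _ free_module]) auto
  define \<alpha> where "\<alpha> n = (\<lambda>y\<in>carrier (Fr (S n)). \<beta> n y \<ominus>\<^bsub>Fr (S n)\<^esub> (\<lambda>y\<in>carrier (Fr (S n)). y) y)" for n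
  have \<alpha>: "\<alpha> n \<in> Hom (Fr (S n)) (Fr (S n))" for n
    unfolding \<alpha>_def by (rule lin_diff[OF free_module free_module \<beta> id])
  have \<alpha>v: "\<alpha> n y = \<psi> n (\<phi> n y) \<ominus>\<^bsub>Fr (S n)\<^esub> y" if "y \<in> carrier (Fr (S n))" for n y
    using that by (simp add: \<alpha>_def \<beta>_def)
  have c: "\<phi> n y \<in> carrier (Fr (S' n))" "\<psi> n (\<phi> n y) \<in> carrier (Fr (S n))"
    if "y \<in> carrier (Fr (S n))" for n y
    using lin_closed[OF \<phi>(1) that] lin_closed[OF \<psi>(1)] by auto
  have e0: "e (\<alpha> 0 y) = \<zero>\<^bsub>M\<^esub>" if y: "y \<in> carrier (Fr (S 0))" for y
  proof -
    have "e (\<alpha> 0 y) = e (\<psi> 0 (\<phi> 0 y)) \<ominus>\<^bsub>M\<^esub> e y"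
      unfolding \<alpha>v[OF y] by (rule lin_minus[OF free_module assms(3) D(1) c(2)[OF y] y])
    also have "\<dots> = e y \<ominus>\<^bsub>M\<^esub> e y" using \<psi>(2)[OF c(1)[OF y]] \<phi>(2)[OF y] by simp
    finally show ?thesis using lin_closed[OF D(1) y] module.axioms(2)[OF assms(3)]
      by (simp add: a_minus_def abelian_group.r_neg)
  qed
  have ac: "d n (\<alpha> (Suc n) y) = \<alpha> n (d n y)" if y: "y \<in> carrier (Fr (S (Suc n)))" for n y
  proof -
    have dy: "d n y \<in> carrier (Fr (S n))" by (rule lin_closed[OF D(2) y])
    have "d n (\<alpha> (Suc n) y) = d n (\<psi> (Suc n) (\<phi> (Suc n) y)) \<ominus>\<^bsub>Fr (S n)\<^esub> d n y"
      unfolding \<alpha>v[OF y] by (rule lin_minus[OF free_module free_module D(2) c(2)[OF y] y])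
    also have "d n (\<psi> (Suc n) (\<phi> (Suc n) y)) = \<psi> n (\<phi> n (d n y))"
      using \<psi>(3)[OF c(1)[OF y]] \<phi>(3)[OF y] by simp
    finally show ?thesis using \<alpha>v[OF dy] by simp
  qed
  obtain s where s: "\<And>n. s n \<in> Hom (Fr (S n)) (Fr (S (Suc n)))"
     "\<And>n y. y \<in> carrier (Fr (S (Suc n))) \<Longrightarrow>
        d (Suc n) (s (Suc n) y) = \<alpha> (Suc n) y \<ominus>\<^bsub>Fr (S (Suc n))\<^esub> s n (d n y)"
    using null_homotopy_exists[OF assms(1,3) \<alpha> e0 ac] by blast
  have f\<psi>: "(\<lambda>y\<in>carrier (Fr (S' (Suc i))). f (\<psi> (Suc i) y)) \<in> Hom (Fr (S' (Suc i))) X"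
    by (rule lin_comp[OF free_module \<psi>(1) f])
  have "(\<lambda>y\<in>carrier (Fr (S' (Suc i))). f (\<psi> (Suc i) y)) (d' (Suc i) y) = \<zero>\<^bsub>X\<^esub>"
    if "y \<in> carrier (Fr (S' (Suc (Suc i))))" for y
    using lin_closed[OF D'(2) that] \<psi>(3)[OF that] fz[OF lin_closed[OF \<psi>(1) that]] by simp
  then obtain g where g: "g \<in> Hom (Fr (S' i)) X"
     "\<And>y. y \<in> carrier (Fr (S' (Suc i))) \<Longrightarrow> (\<lambda>y\<in>carrier (Fr (S' (Suc i))). f (\<psi> (Suc i) y)) y = g (d' i y)"
    using ext_vanishesD[OF assms(5) f\<psi>] by blast
  \<comment> \<open>Since \<open>f\<close> kills boundaries, \<open>f\<close> after
    \<open>\<alpha>\<close> equals \<open>f\<close> after \<open>s\<close> after \<open>d\<close>.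
    Hence \<open>f\<close> is the coboundary of \<open>u\<close> minus \<open>v\<close>, where
    \<open>v\<close> corrects for the homotopy.\<close>
  define u where "u = (\<lambda>y\<in>carrier (Fr (S i)). g (\<phi> i y))"
  define v where "v = (\<lambda>y\<in>carrier (Fr (S i)). f (s i y))"
  have u: "u \<in> Hom (Fr (S i)) X" unfolding u_def by (rule lin_comp[OF free_module \<phi>(1) g(1)])
  have v: "v \<in> Hom (Fr (S i)) X" unfolding v_def by (rule lin_comp[OF free_module s(1) f])
  show "\<exists>g \<in> Hom (Fr (S i)) X. \<forall>y \<in> carrier (Fr (S (Suc i))). f y = g (d i y)"
  proof (rule bexI[OF _ lin_diff[OF free_module assms(4) u v]], rule ballI)
    fix y assume y: "y \<in> carrier (Fr (S (Suc i)))"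
    have dy: "d i y \<in> carrier (Fr (S i))" by (rule lin_closed[OF D(2) y])
    note cy = c[OF y]
    have sdy: "s i (d i y) \<in> carrier (Fr (S (Suc i)))" by (rule lin_closed[OF s(1) dy])
    have "\<zero>\<^bsub>X\<^esub> = f (\<alpha> (Suc i) y \<ominus>\<^bsub>Fr (S (Suc i))\<^esub> s i (d i y))"
      using s(2)[OF y] fz[OF lin_closed[OF s(1) y]] by simp
    also have "\<dots> = f (\<alpha> (Suc i) y) \<ominus>\<^bsub>X\<^esub> f (s i (d i y))"
      by (rule lin_minus[OF free_module assms(4) f lin_closed[OF \<alpha> y] sdy])
    finally have "f (\<alpha> (Suc i) y) = f (s i (d i y))"
      using minus_eq_zeroD[OF assms(4) lin_closed[OF f lin_closed[OF \<alpha> y]] lin_closed[OF f sdy]] by simp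
    moreover have "f (\<alpha> (Suc i) y) = f (\<psi> (Suc i) (\<phi> (Suc i) y)) \<ominus>\<^bsub>X\<^esub> f y"
      unfolding \<alpha>v[OF y] by (rule lin_minus[OF free_module assms(4) f cy(2) y])
    moreover have "f (\<psi> (Suc i) (\<phi> (Suc i) y)) = g (\<phi> i (d i y))"
      using g(2)[OF cy(1)] \<phi>(3)[OF y] cy(1) by simp
    ultimately have eq: "g (\<phi> i (d i y)) \<ominus>\<^bsub>X\<^esub> f y = f (s i (d i y))" by simp
    have cl: "g (\<phi> i (d i y)) \<in> carrier X" "f y \<in> carrier X"
      using lin_closed[OF g(1) c(1)[OF dy]] lin_closed[OF f y] by auto
    have "g (\<phi> i (d i y)) \<ominus>\<^bsub>X\<^esub> f (s i (d i y)) = f y"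
      unfolding eq[symmetric] using cl by (simp add: a_minus_def X.M.minus_add X.M.a_assoc[symmetric] X.M.r_neg)
    then show "f y = (\<lambda>x\<in>carrier (Fr (S i)). u x \<ominus>\<^bsub>X\<^esub> v x) (d i y)"
      using dy by (simp add: u_def v_def)
  qed
qed

text \<open>The map \<open>ext_coboundary\<close> cut down to the cochains. Being extensional, it is
  itself a member of a Hom set, so the lemmas on kernels, images and factorizations apply to
  it.\<close>

definition coboundary ::
  "(nat \<Rightarrow> 'i set) \<Rightarrow> (nat \<Rightarrow> ('i \<Rightarrow> 'a) \<Rightarrow> 'i \<Rightarrow> 'a) \<Rightarrow> ('a, 'n) module \<Rightarrow> nat \<Rightarrow>
     (('i \<Rightarrow> 'a) \<Rightarrow> 'n) \<Rightarrow> ('i \<Rightarrow> 'a) \<Rightarrow> 'n" where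
  "coboundary S d N n =
     (\<lambda>f\<in>Hom (Fr (S n)) N. \<lambda>y\<in>carrier (Fr (S (Suc n))). f (d n y))"

lemma coboundary_lin:
  assumes "module R N" "d n \<in> Hom (Fr (S (Suc n))) (Fr (S n))"
  shows "coboundary S d N n \<in> Hom (hom_module R (Fr (S n)) N) (hom_module R (Fr (S (Suc n))) N)"
proof -
  let ?C = "hom_module R (Fr (S n)) N"
  have "(\<lambda>f\<in>carrier ?C. \<lambda>y\<in>carrier (Fr (S (Suc n))). f (d n y)) \<in> Hom ?C (hom_module R (Fr (S (Suc n))) N)"
  proof (rule lin_mapI[OF _ _ _ hom_module[OF free_module assms(1)]])
    show "(\<lambda>y\<in>carrier (Fr (S (Suc n))). f (d n y)) \<in> carrier (hom_module R (Fr (S (Suc n))) N)"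
      if "f \<in> carrier ?C" for f
      unfolding hom_simps using lin_comp[OF free_module assms(2)] that by (simp add: hom_simps)
  qed (auto simp: hom_simps lin_closed[OF assms(2)] intro!: ext)
  then show ?thesis by (simp add: coboundary_def hom_simps)
qed

lemma coboundary_eq_zero_iff:
  assumes "f \<in> Hom (Fr (S n)) N"
  shows "coboundary S d N n f = \<zero>\<^bsub>hom_module R (Fr (S (Suc n))) N\<^esub> \<longleftrightarrow>
    (\<forall>y \<in> carrier (Fr (S (Suc n))). f (d n y) = \<zero>\<^bsub>N\<^esub>)"
  using assms by (auto simp: coboundary_def hom_simps restrict_def fun_eq_iff)

lemma coboundary_eq_iff:
  assumes "f \<in> Hom (Fr (S (Suc n))) N" "g \<in> Hom (Fr (S n)) N" "d n \<in> Hom (Fr (S (Suc n))) (Fr (S n))"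
  shows "f = coboundary S d N n g \<longleftrightarrow> (\<forall>y \<in> carrier (Fr (S (Suc n))). f y = g (d n y))"
proof -
  have "f = (\<lambda>y\<in>carrier (Fr (S (Suc n))). g (d n y)) \<longleftrightarrow> (\<forall>y \<in> carrier (Fr (S (Suc n))). f y = g (d n y))"
    using lin_eqI[OF assms(1) lin_comp[OF free_module assms(3,2)]] by auto
  then show ?thesis using assms(2) by (simp add: coboundary_def)
qed

lemma ext_vanishes_iff_exact:
  fixes i :: nat
  assumes "module R N" and d: "\<And>n. d n \<in> Hom (Fr (S (Suc n))) (Fr (S n))"
    and dd: "\<And>n y. y \<in> carrier (Fr (S (Suc (Suc n)))) \<Longrightarrow> d n (d (Suc n) y) = \<zero>\<^bsub>Fr (S n)\<^esub>"
  defines "Z \<equiv> {f \<in> Hom (Fr (S (Suc i))) N.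
      coboundary S d N (Suc i) f = \<zero>\<^bsub>hom_module R (Fr (S (Suc (Suc i)))) N\<^esub>}"
  shows "coboundary S d N i ` Hom (Fr (S i)) N \<subseteq> Z"
    and "ext_vanishes R S d N i \<longleftrightarrow> Z \<subseteq> coboundary S d N i ` Hom (Fr (S i)) N"
proof -
  show "coboundary S d N i ` Hom (Fr (S i)) N \<subseteq> Z"
  proof
    fix f assume "f \<in> coboundary S d N i ` Hom (Fr (S i)) N"
    then obtain g where g: "g \<in> Hom (Fr (S i)) N" "f = coboundary S d N i g" by blast
    have f: "f \<in> Hom (Fr (S (Suc i))) N"
      using lin_closed[OF coboundary_lin[where d = d, OF assms(1) d]] g by (simp add: hom_simps)
    have fy: "f y = g (d i y)" if "y \<in> carrier (Fr (S (Suc i)))" for y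
      using coboundary_eq_iff[where d = d and S = S and n = i, OF f g(1) d] g(2) that by blast
    have "f (d (Suc i) y) = \<zero>\<^bsub>N\<^esub>" if "y \<in> carrier (Fr (S (Suc (Suc i))))" for y
      using fy[OF lin_closed[OF d that]] dd[OF that] lin_zero[OF free_module assms(1) g(1)] by simp
    then show "f \<in> Z" using f coboundary_eq_zero_iff[where d = d and S = S and n = "Suc i", OF f] by (simp add: Z_def)
  qed
  have "f \<in> coboundary S d N i ` Hom (Fr (S i)) N \<longleftrightarrow>
      (\<exists>g \<in> Hom (Fr (S i)) N. \<forall>y \<in> carrier (Fr (S (Suc i))). f y = g (d i y))"
    if "f \<in> Hom (Fr (S (Suc i))) N" for f
    using coboundary_eq_iff[where d = d and S = S and n = i, OF that _ d] unfolding image_iff by (intro bex_cong) auto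
  moreover have "f \<in> Z \<longleftrightarrow> f \<in> Hom (Fr (S (Suc i))) N \<and>
      (\<forall>y \<in> carrier (Fr (S (Suc (Suc i)))). f (d (Suc i) y) = \<zero>\<^bsub>N\<^esub>)" for f
    using coboundary_eq_zero_iff[of f S "Suc i" N d] unfolding Z_def by auto
  ultimately show "ext_vanishes R S d N i \<longleftrightarrow> Z \<subseteq> coboundary S d N i ` Hom (Fr (S i)) N"
    unfolding ext_vanishes_def subset_iff by blast
qed

text \<open>The factor group has a single coset exactly when the coboundaries exhaust the cocycles.
  Only degrees \<open>Suc i\<close> are treated, where the coboundaries are an image.\<close>

lemma trivial_ext_iff:
  assumes "module R N" and d: "\<And>n. d n \<in> Hom (Fr (S (Suc n))) (Fr (S n))"
    and dd: "\<And>n y. y \<in> carrier (Fr (S (Suc (Suc n)))) \<Longrightarrow> d n (d (Suc n) y) = \<zero>\<^bsub>Fr (S n)\<^esub>"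
  shows "trivial_group (ext_of_resolution R S d N (Suc i)) \<longleftrightarrow> ext_vanishes R S d N i"
proof -
  let ?C = "\<lambda>n. hom_module R (Fr (S n)) N"
  have C: "module R (?C n)" for n by (rule hom_module[OF free_module assms(1)])
  have \<delta>: "coboundary S d N n \<in> Hom (?C n) (?C (Suc n))" for n
    by (rule coboundary_lin[where d = d, OF assms(1) d])
  have cb: "ext_coboundary R S d n f = coboundary S d N n f" if "f \<in> Hom (Fr (S n)) N" for n f
    using that by (simp add: ext_coboundary_def compose_def coboundary_def)
  define Z where "Z = {f \<in> Hom (Fr (S (Suc i))) N. coboundary S d N (Suc i) f = \<zero>\<^bsub>?C (Suc (Suc i))\<^esub>}"
  define B where "B = coboundary S d N i ` Hom (Fr (S i)) N"
  have Z: "submodule Z R (?C (Suc i))"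
    unfolding Z_def using kernel_submodule[OF C C \<delta>[of "Suc i"]] by (simp add: hom_simps)
  have B: "submodule B R (?C (Suc i))"
    unfolding B_def using range_submodule[OF C C \<delta>] by (simp add: hom_simps)
  have BZ: "B \<subseteq> Z" unfolding B_def Z_def by (rule ext_vanishes_iff_exact(1)[where d = d, OF assms(1) d dd])
  have Zeq: "ext_cocycles R S d N (Suc i) = Z"
    unfolding ext_cocycles_def a_kernel_def' Z_def using cb by (auto simp: hom_simps)
  have Beq: "ext_coboundaries R S d N (Suc i) = B"
    unfolding B_def using cb by (auto simp: hom_simps)
  let ?Z = "?C (Suc i)\<lparr>carrier := Z\<rparr>"
  interpret ZM: module R ?Z by (rule submodule_module[OF C Z])
  have sg: "subgroup B (add_monoid ?Z)"
    by (rule submodule.axioms(1)[OF submodule_sub[OF C Z B BZ]])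
  then have "additive_subgroup B ?Z" by (rule additive_subgroup.intro)
  then interpret Q: abelian_subgroup B ?Z by (rule abelian_subgroupI3) (rule ZM.M.abelian_group_axioms)
  have "trivial_group (?Z A_Mod B) \<longleftrightarrow> carrier (?Z A_Mod B) = {B}"
    unfolding trivial_group_def using Q.a_factorgroup_is_group by (simp add: A_FactGroup_def')
  also have "\<dots> \<longleftrightarrow> Z \<subseteq> B"
  proof
    assume *: "carrier (?Z A_Mod B) = {B}"
    show "Z \<subseteq> B"
    proof
      fix z assume z: "z \<in> Z"
      then have "B +>\<^bsub>?Z\<^esub> z \<in> carrier (?Z A_Mod B)"
        by (auto simp: A_FactGroup_def' A_RCOSETS_def')
      then show "z \<in> B" using * Q.a_rcos_self[of z] z by simp
    qed
  next
    assume "Z \<subseteq> B"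
    then have "B +>\<^bsub>?Z\<^esub> z = B" if "z \<in> Z" for z
      using that by (intro ZM.M.a_coset_join2[OF _ sg]) auto
    moreover have "Z \<noteq> {}" using ZM.M.zero_closed by auto
    ultimately show "carrier (?Z A_Mod B) = {B}"
      by (auto simp: A_FactGroup_def' A_RCOSETS_def')
  qed
  also have "\<dots> \<longleftrightarrow> ext_vanishes R S d N i"
    unfolding Z_def B_def by (rule ext_vanishes_iff_exact(2)[where d = d, OF assms(1) d dd, symmetric])
  finally show ?thesis unfolding ext_of_resolution_def Zeq Beq .
qed

lemma free_resolution_iso:
  assumes "free_resolution R M S d e" "module R M" "module R M'" "\<theta> \<in> Hom M M'"
    and "bij_betw \<theta> (carrier M) (carrier M')"
  shows "free_resolution R M' S d (\<lambda>y\<in>carrier (Fr (S 0)). \<theta> (e y))"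
proof -
  note D = free_resolutionD[OF assms(1)]
  have inj: "x = \<zero>\<^bsub>M\<^esub>" if "x \<in> carrier M" "\<theta> x = \<zero>\<^bsub>M'\<^esub>" for x
  proof -
    interpret M: module R M by fact
    show ?thesis using inj_onD[of \<theta> "carrier M" x "\<zero>\<^bsub>M\<^esub>"] assms(5) that lin_zero[OF assms(2-4)]
      by (auto simp: bij_betw_def)
  qed
  show ?thesis
  proof (rule free_resolutionI)
    show "(\<lambda>y\<in>carrier (Fr (S 0)). \<theta> (e y)) \<in> Hom (Fr (S 0)) M'"
      by (rule lin_comp[OF free_module D(1) assms(4)])
    have "(\<lambda>y\<in>carrier (Fr (S 0)). \<theta> (e y)) ` carrier (Fr (S 0)) = \<theta> ` (e ` carrier (Fr (S 0)))"
      by (auto simp: image_image)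
    then show "(\<lambda>y\<in>carrier (Fr (S 0)). \<theta> (e y)) ` carrier (Fr (S 0)) = carrier M'"
      using D(3) assms(5) by (simp add: bij_betw_def)
    show "(\<lambda>y\<in>carrier (Fr (S 0)). \<theta> (e y)) (d 0 y) = \<zero>\<^bsub>M'\<^esub>" if "y \<in> carrier (Fr (S (Suc 0)))" for y
      using lin_closed[OF D(2) that] D(4)[OF that] lin_zero[OF assms(2-4)] by simp
    show "x \<in> d 0 ` carrier (Fr (S (Suc 0)))"
      if "x \<in> carrier (Fr (S 0))" "(\<lambda>y\<in>carrier (Fr (S 0)). \<theta> (e y)) x = \<zero>\<^bsub>M'\<^esub>" for x
      using D(6)[OF that(1)] inj[OF lin_closed[OF D(1) that(1)]] that by simp
  qed (use D in auto)
qed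

text \<open>Push the cocycle forward along \<open>\<theta>\<close>, bound it there and pull back
  along \<open>\<eta>\<close>. Applied in both directions, this transports vanishing along an
  isomorphism of the second argument.\<close>

lemma ext_vanishes_retract:
  assumes "module R X" "module R X'" "\<theta> \<in> Hom X X'" "\<eta> \<in> Hom X' X"
    and "\<And>x. x \<in> carrier X \<Longrightarrow> \<eta> (\<theta> x) = x"
    and d: "\<And>n. d n \<in> Hom (Fr (S (Suc n))) (Fr (S n))"
    and "ext_vanishes R S d X' i"
  shows "ext_vanishes R S d X i"
proof (rule ext_vanishesI)
  fix f assume f: "f \<in> Hom (Fr (S (Suc i))) X"
    and fz: "\<And>y. y \<in> carrier (Fr (S (Suc (Suc i)))) \<Longrightarrow> f (d (Suc i) y) = \<zero>\<^bsub>X\<^esub>"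
  have "(\<lambda>y\<in>carrier (Fr (S (Suc i))). \<theta> (f y)) (d (Suc i) y) = \<zero>\<^bsub>X'\<^esub>"
    if "y \<in> carrier (Fr (S (Suc (Suc i))))" for y
    using fz[OF that] lin_closed[OF d that] lin_zero[OF assms(1-3)] by simp
  then obtain g where g: "g \<in> Hom (Fr (S i)) X'"
    "\<And>y. y \<in> carrier (Fr (S (Suc i))) \<Longrightarrow> (\<lambda>y\<in>carrier (Fr (S (Suc i))). \<theta> (f y)) y = g (d i y)"
    using ext_vanishesD[OF assms(7) lin_comp[OF free_module f assms(3)]] by blast
  show "\<exists>g \<in> Hom (Fr (S i)) X. \<forall>y \<in> carrier (Fr (S (Suc i))). f y = g (d i y)"
  proof (rule bexI[OF _ lin_comp[OF free_module g(1) assms(4)]], rule ballI)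
    fix y assume y: "y \<in> carrier (Fr (S (Suc i)))"
    have "\<theta> (f y) = g (d i y)" using g(2)[OF y] y by simp
    then show "f y = (\<lambda>x\<in>carrier (Fr (S i)). \<eta> (g x)) (d i y)"
      using assms(5)[OF lin_closed[OF f y]] lin_closed[OF d y] by simp
  qed
qed

section \<open>Isomorphic copies\<close>

text \<open>Transport of structure along an injection. Copies are made because the Ext-index and
  injectivity quantify over modules with carrier in one fixed type.\<close>

definition copy_module :: "('m \<Rightarrow> 'n) \<Rightarrow> ('a, 'm) module \<Rightarrow> ('a, 'n) module" where
  "copy_module \<phi> M = \<lparr>carrier = \<phi> ` carrier M, mult = undefined, one = undefined,
     zero = \<phi> \<zero>\<^bsub>M\<^esub>,
     add = (\<lambda>x y. \<phi> (inv_into (carrier M) \<phi> x \<oplus>\<^bsub>M\<^esub> inv_into (carrier M) \<phi> y)),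
     smult = (\<lambda>a x. \<phi> (a \<odot>\<^bsub>M\<^esub> inv_into (carrier M) \<phi> x))\<rparr>"

lemma copy_module_exists:
  assumes "module R M" "inj_on (\<phi> :: 'm \<Rightarrow> 'n) (carrier M)"
  shows "\<exists>(M' :: ('a, 'n) module) \<theta> \<eta>. module R M' \<and> \<theta> \<in> Hom M M' \<and> \<eta> \<in> Hom M' M \<and>
     bij_betw \<theta> (carrier M) (carrier M') \<and> (\<forall>x \<in> carrier M. \<eta> (\<theta> x) = x) \<and> (\<forall>x \<in> carrier M'. \<theta> (\<eta> x) = x)"
proof -
  interpret M: module R M by fact
  let ?M = "copy_module \<phi> M"
  let ?i = "inv_into (carrier M) \<phi>"
  note s = copy_module_def inv_into_f_f[OF assms(2)]
  have cM: "carrier ?M = \<phi> ` carrier M" by (simp add: copy_module_def)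
  have M': "module R ?M"
  proof (rule moduleI)
    show "abelian_group ?M"
    proof (rule abelian_groupI)
      fix x assume "x \<in> carrier ?M"
      then obtain u where u: "u \<in> carrier M" "x = \<phi> u" by (auto simp: cM)
      then show "\<exists>y\<in>carrier ?M. y \<oplus>\<^bsub>?M\<^esub> x = \<zero>\<^bsub>?M\<^esub>"
        by (intro bexI[of _ "\<phi> (\<ominus>\<^bsub>M\<^esub> u)"]) (auto simp: s M.M.l_neg)
    qed (auto simp: s M.M.a_ac)
  qed (auto simp: s is_cring M.smult_l_distr M.smult_r_distr M.smult_assoc1)
  have \<theta>: "(\<lambda>x\<in>carrier M. \<phi> x) \<in> Hom M ?M"
    by (rule lin_mapI[OF _ _ _ assms(1)]) (auto simp: s)
  have \<eta>: "(\<lambda>x\<in>carrier ?M. ?i x) \<in> Hom ?M M"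
    by (rule lin_mapI[OF _ _ _ M']) (auto simp: s)
  have "bij_betw (\<lambda>x\<in>carrier M. \<phi> x) (carrier M) (carrier ?M)"
    using assms(2) by (auto simp: bij_betw_def cM inj_on_def)
  then show ?thesis
    using M' \<theta> \<eta> by (intro exI conjI) (auto simp: s)
qed

lemma fg_iso:
  assumes "fg_module R M" "module R M'" "\<theta> \<in> Hom M M'" "\<theta> ` carrier M = carrier M'"
  shows "fg_module R M'"
proof -
  have "M'\<lparr>carrier := \<theta> ` carrier M\<rparr> = M'" using assms(4) by simp
  then show ?thesis using fg_image[OF assms(1-3)] by simp
qed

text \<open>Send an element to its fibre under a finite free cover, with vectors written as lists
  along an enumeration \<open>l\<close> of the basis. Fibres are nonempty and disjoint, so they tell
  elements apart.\<close>

lemma fg_inj: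
  fixes M :: "('a, 'm) module"
  assumes "fg_module R M"
  shows "\<exists>\<phi> :: 'm \<Rightarrow> 'a list set. inj_on \<phi> (carrier M)"
proof -
  obtain S :: "nat set" and p where S: "finite S" "p \<in> Hom (Fr S) M" "p ` carrier (Fr S) = carrier M"
    using fg_cover[OF assms, where 'i = nat] by auto
  obtain l where l: "set l = S" using finite_list[OF S(1)] by blast
  have "inj_on (\<lambda>x. (\<lambda>y. map y l) ` {y \<in> carrier (Fr S). p y = x}) (carrier M)"
  proof (rule inj_onI)
    fix x x' assume x: "x \<in> carrier M"
      and eq: "(\<lambda>y. map y l) ` {y \<in> carrier (Fr S). p y = x} = (\<lambda>y. map y l) ` {y \<in> carrier (Fr S). p y = x'}"
    obtain y where y: "y \<in> carrier (Fr S)" "p y = x" using x S(3) by (metis imageE)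
    then have "map y l \<in> (\<lambda>y. map y l) ` {y \<in> carrier (Fr S). p y = x'}" unfolding eq[symmetric] by blast
    then obtain y' where y': "y' \<in> carrier (Fr S)" "p y' = x'" "map y l = map y' l" by auto
    have "y = y'" by (rule free_eqI[OF y(1) y'(1)]) (use y'(3) l in auto)
    then show "x = x'" using y y' by simp
  qed
  then show ?thesis by blast
qed

end

section \<open>Finite free resolutions and the comparison with the chosen Ext\<close>

context noetherian_base_ring
begin

lemma cover_submodule:
  assumes "finite T" "submodule K R (Fr T)" "infinite (UNIV :: 'i set)"
  shows "\<exists>(S :: 'i set) d. finite S \<and> d \<in> Hom (Fr S) (Fr T) \<and> d ` carrier (Fr S) = K"
proof -
  have "fg_module R (Fr T\<lparr>carrier := K\<rparr>)" by (rule fg_submodule[OF fg_free[OF assms(1)] assms(2)])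
  from fg_cover[OF this assms(3)] obtain S :: "'i set" and p where
    S: "finite S" "p \<in> Hom (Fr S) (Fr T\<lparr>carrier := K\<rparr>)" "p ` carrier (Fr S) = K" by auto
  moreover have "p \<in> Hom (Fr S) (Fr T)"
    by (rule lin_codomainD[OF S(2)]) (rule submodule_carrier[OF assms(2)])
  ultimately show ?thesis by blast
qed

lemma fg_resolution_exists:
  fixes M :: "('a, 'm) module"
  assumes "fg_module R M" and inf: "infinite (UNIV :: 'i set)"
  shows "\<exists>(S :: nat \<Rightarrow> 'i set) d e. free_resolution R M S d e \<and> (\<forall>n. finite (S n))"
proof -
  note M = fg_moduleD[OF assms(1)]
  obtain S0 :: "'i set" and e where e: "finite S0" "e \<in> Hom (Fr S0) M" "e ` carrier (Fr S0) = carrier M"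
    using fg_cover[OF assms] by blast
  have "\<exists>(S :: 'i set) d. finite S \<and> d \<in> Hom (Fr S) (Fr S0) \<and>
      d ` carrier (Fr S) = {x \<in> carrier (Fr S0). e x = \<zero>\<^bsub>M\<^esub>}"
    by (rule cover_submodule[OF e(1) kernel_submodule[OF free_module M e(2)] inf])
  then obtain S1 :: "'i set" and d0 where d0: "finite S1" "d0 \<in> Hom (Fr S1) (Fr S0)"
     "d0 ` carrier (Fr S1) = {x \<in> carrier (Fr S0). e x = \<zero>\<^bsub>M\<^esub>}" by blast
  \<comment> \<open>The recursion builds differentials rather than modules: a triple
    \<open>(S, T, d)\<close> has \<open>d\<close> going from \<open>Fr T\<close> to
    \<open>Fr S\<close>, and \<open>Q\<close> makes the next triple start at \<open>T\<close> and
    cover the kernel of \<open>d\<close>. The clause for index 0 fixes the part already adapted to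
    the augmentation.\<close>
  define P where "P n x \<longleftrightarrow> (case x of (S, T, d) \<Rightarrow> finite S \<and> finite T \<and> d \<in> Hom (Fr T) (Fr S)
     \<and> (n = (0::nat) \<longrightarrow> x = (S0, S1, d0)))" for n and x :: "'i set \<times> 'i set \<times> (('i \<Rightarrow> 'a) \<Rightarrow> 'i \<Rightarrow> 'a)"
  define Q where "Q n x x' \<longleftrightarrow> (case x of (S, T, d) \<Rightarrow> case x' of (S', T', d') \<Rightarrow>
     S' = T \<and> d' ` carrier (Fr T') = {x \<in> carrier (Fr T). d x = \<zero>\<^bsub>Fr S\<^esub>})"
     for n :: nat and x x' :: "'i set \<times> 'i set \<times> (('i \<Rightarrow> 'a) \<Rightarrow> 'i \<Rightarrow> 'a)"
  have "\<exists>x. P 0 x" using e(1) d0 unfolding P_def by auto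
  moreover have "\<exists>x'. P (Suc n) x' \<and> Q n x x'" if P: "P n x" for n x
  proof -
    obtain S T d where x: "x = (S, T, d)" by (cases x)
    have d: "finite T" "d \<in> Hom (Fr T) (Fr S)" using P x by (auto simp: P_def)
    have "\<exists>(S' :: 'i set) d'. finite S' \<and> d' \<in> Hom (Fr S') (Fr T) \<and>
        d' ` carrier (Fr S') = {x \<in> carrier (Fr T). d x = \<zero>\<^bsub>Fr S\<^esub>}"
      by (rule cover_submodule[OF d(1) kernel_submodule[OF free_module free_module d(2)] inf])
    then obtain S' :: "'i set" and d' where "finite S'" "d' \<in> Hom (Fr S') (Fr T)"
        "d' ` carrier (Fr S') = {x \<in> carrier (Fr T). d x = \<zero>\<^bsub>Fr S\<^esub>}" by blast
    then show ?thesis using x d by (intro exI[of _ "(T, S', d')"]) (auto simp: P_def Q_def)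
  qed
  ultimately obtain F where F: "\<And>n. P n (F n)" "\<And>n. Q n (F n) (F (Suc n))"
    using dependent_nat_choice[of P Q] by blast
  define S where "S n = fst (F n)" for n
  define d where "d n = snd (snd (F n))" for n
  have T: "fst (snd (F n)) = S (Suc n)" for n
    using F(2)[of n] by (auto simp: Q_def S_def split: prod.splits)
  have F': "F n = (S n, S (Suc n), d n)" for n using T[of n] by (simp add: S_def d_def prod_eq_iff)
  have *: "finite (S n)" "d n \<in> Hom (Fr (S (Suc n))) (Fr (S n))" for n
    using F(1)[of n] by (auto simp: P_def F')
  have **: "d (Suc n) ` carrier (Fr (S (Suc (Suc n)))) =
      {x \<in> carrier (Fr (S (Suc n))). d n x = \<zero>\<^bsub>Fr (S n)\<^esub>}" for n
    using F(2)[of n] by (simp add: Q_def F')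
  have "S 0 = S0" "S (Suc 0) = S1" "d 0 = d0" using F(1)[of 0] by (auto simp: P_def F')
  then have "free_resolution R M S d e"
    unfolding free_resolution_def a_kernel_def' using e d0 * ** by simp
  then show ?thesis using * by blast
qed

text \<open>The resolution behind \<open>Ext\<close> comes from a choice operator. It is a genuine
  resolution because one exists over the infinite type of lists, and independence of the resolution
  then allows any index type.\<close>

lemma trivial_Ext_iff:
  fixes M :: "('a, 'm) module" and N :: "('a, 'n) module"
  assumes "free_resolution R M S d e" "fg_module R M" "module R N"
  shows "trivial_group (Ext R (Suc i) M N) \<longleftrightarrow> ext_vanishes R S d N i"
proof -
  note M = fg_moduleD[OF assms(2)]
  have "infinite (UNIV :: ('a + 'm) list set)" by (rule infinite_UNIV_listI)
  then have ex: "\<exists>x. case x of (S, d) \<Rightarrow> \<exists>e. free_resolution R M S (d :: nat \<Rightarrow> (('a + 'm) list \<Rightarrow> 'a) \<Rightarrow> _) e"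
    using fg_resolution_exists[OF assms(2), where 'i = "('a + 'm) list"] by fastforce
  obtain S' d' where c: "chosen_resolution R M = (S', d')" by (cases "chosen_resolution R M")
  then obtain e' where r: "free_resolution R M S' d' e'"
    using someI_ex[OF ex] unfolding chosen_resolution_def by auto
  have "trivial_group (Ext R (Suc i) M N) \<longleftrightarrow> ext_vanishes R S' d' N i"
    unfolding Ext_def c prod.case
    by (rule trivial_ext_iff[OF assms(3)]) (use free_resolutionD(2,5)[OF r] in auto)
  also have "\<dots> \<longleftrightarrow> ext_vanishes R S d N i"
    using ext_vanishes_independent[OF r assms(1) M assms(3)] ext_vanishes_independent[OF assms(1) r M assms(3)] by blast
  finally show ?thesis .
qed

lemma ext_eventually_zero_iff:
  assumes "free_resolution R M S d e" "fg_module R M" "module R N"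
  shows "ext_eventually_zero R M N \<longleftrightarrow> (\<exists>n. \<forall>i\<ge>n. ext_vanishes R S d N i)"
proof
  assume "ext_eventually_zero R M N"
  then obtain n where "\<forall>i>n. trivial_group (Ext R i M N)" unfolding ext_eventually_zero_def by blast
  then have "\<forall>i\<ge>n. ext_vanishes R S d N i"
    using trivial_Ext_iff[OF assms] by (metis le_imp_less_Suc)
  then show "\<exists>n. \<forall>i\<ge>n. ext_vanishes R S d N i" by blast
next
  assume "\<exists>n. \<forall>i\<ge>n. ext_vanishes R S d N i"
  then obtain n where n: "\<And>i. i \<ge> n \<Longrightarrow> ext_vanishes R S d N i" by blast
  have "trivial_group (Ext R i M N)" if "i > n" for i
    using n[of "i - 1"] trivial_Ext_iff[OF assms, of "i - 1"] that by (cases i) auto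
  then show "ext_eventually_zero R M N" unfolding ext_eventually_zero_def by blast
qed

text \<open>The modules are copied into the type over which \<open>ext_index\<close> ranges. Index
  \<open>i\<close> stands for degree \<open>i + 1\<close>, so \<open>i \<ge> b\<close> covers
  exactly the degrees above \<open>b\<close>.\<close>

lemma ext_index_bound:
  fixes M :: "('a, 'm) module" and N :: "('a, 'n) module"
  assumes "ext_index R \<le> enat b" "fg_module R M" "fg_module R N" "ext_eventually_zero R M N"
    and r: "free_resolution R M S d e" and "i \<ge> b"
  shows "ext_vanishes R S d N i"
proof -
  note M = fg_moduleD[OF assms(2)] and N = fg_moduleD[OF assms(3)]
  note D = free_resolutionD[OF r]
  obtain \<phi> :: "'m \<Rightarrow> 'a list set" where "inj_on \<phi> (carrier M)" using fg_inj[OF assms(2)] by blast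
  from copy_module_exists[OF M this] obtain M' :: "('a, 'a list set) module" and \<theta> where
    M': "module R M'" "\<theta> \<in> Hom M M'" "bij_betw \<theta> (carrier M) (carrier M')" by blast
  obtain \<psi> :: "'n \<Rightarrow> 'a list set" where "inj_on \<psi> (carrier N)" using fg_inj[OF assms(3)] by blast
  from copy_module_exists[OF N this] obtain N' :: "('a, 'a list set) module" and \<zeta> \<eta> where
    N': "module R N'" "\<zeta> \<in> Hom N N'" "\<eta> \<in> Hom N' N" "bij_betw \<zeta> (carrier N) (carrier N')"
      "\<forall>x \<in> carrier N. \<eta> (\<zeta> x) = x" "\<forall>x \<in> carrier N'. \<zeta> (\<eta> x) = x"
    by (elim exE conjE) (rule that)
  have fg: "fg_module R M'" "fg_module R N'"
    using fg_iso[OF assms(2) M'(1,2)] fg_iso[OF assms(3) N'(1,2)] M'(3) N'(4) by (auto simp: bij_betw_def)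
  note r' = free_resolution_iso[OF r M M']
  have NN': "ext_vanishes R S d N j \<longleftrightarrow> ext_vanishes R S d N' j" for j
  proof
    show "ext_vanishes R S d N' j" if "ext_vanishes R S d N j"
      by (rule ext_vanishes_retract[OF N'(1) N N'(3,2) _ _ that]) (use N'(6) D(2) in auto)
    show "ext_vanishes R S d N j" if "ext_vanishes R S d N' j"
      by (rule ext_vanishes_retract[OF N N'(1-3) _ _ that]) (use N'(5) D(2) in auto)
  qed
  obtain n where n: "\<And>j. j \<ge> n \<Longrightarrow> ext_vanishes R S d N j"
    using assms(4) ext_eventually_zero_iff[OF r assms(2) N] by blast
  have ev: "ext_eventually_zero R M' N'"
    using n NN' ext_eventually_zero_iff[OF r' fg(1) N'(1)] by blast
  show ?thesis
  proof (rule ccontr)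
    assume "\<not> ?thesis"
    then have ne: "{j. j \<ge> b \<and> \<not> ext_vanishes R S d N j} \<noteq> {}" using assms(6) by blast
    have fin: "finite {j. j \<ge> b \<and> \<not> ext_vanishes R S d N j}"
      by (rule finite_subset[of _ "{..<n}"]) (use n in \<open>auto simp: not_less[symmetric]\<close>)
    \<comment> \<open>The Ext-index only sees the last nonvanishing degree of a pair, so a bad index
      must be taken maximal; the set is finite because vanishing holds eventually.\<close>
    define j where "j = Max {j. j \<ge> b \<and> \<not> ext_vanishes R S d N j}"
    have j: "j \<ge> b" "\<not> ext_vanishes R S d N j" using Max_in[OF fin ne] by (auto simp: j_def)
    have "ext_vanishes R S d N k" if "k > j" for k
      using Max_ge[OF fin, of k] that j(1) by (fastforce simp: j_def[symmetric])
    then have "\<forall>k>Suc j. trivial_group (Ext R k M' N')"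
      using trivial_Ext_iff[OF r' fg(1) N'(1)] NN' by (metis Suc_lessE)
    moreover have "\<not> trivial_group (Ext R (Suc j) M' N')"
      using trivial_Ext_iff[OF r' fg(1) N'(1)] NN' j(2) by blast
    ultimately have "enat (Suc j) \<le> ext_index R"
      unfolding ext_index_def using fg ev by (intro Sup_upper) blast
    then have "enat (Suc j) \<le> enat b" using assms(1) by (rule order_trans)
    then show False using j(1) by simp
  qed
qed

end

section \<open>Vanishing of Ext into the ring\<close>

text \<open>The finite injective resolution of \<open>R\<close> is fixed as data so that Ext into
  \<open>R\<close> can be defined from it. The carrier type is the one that
  \<open>injective_dimension\<close> prescribes for the regular module.\<close>

locale gorenstein_base_ring = noetherian_base_ring +
  fixes n :: nat and I :: "nat \<Rightarrow> ('a, ('a + 'a) list set) module" and \<delta> and \<iota>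
  assumes resolution: "injective_resolution R (regular_module R) n I \<delta> \<iota>"
begin

text \<open>\<open>Ext\<^sup>j\<^sup>+\<^sup>1(X, R) = 0\<close>, computed from the injective resolution.\<close>

definition ext_ring_vanishes :: "('a, 'm) module \<Rightarrow> nat \<Rightarrow> bool" where
  "ext_ring_vanishes X j \<longleftrightarrow>
     (\<forall>f \<in> Hom X (I (Suc j)). (\<forall>x \<in> carrier X. \<delta> (Suc j) (f x) = \<zero>\<^bsub>I (Suc (Suc j))\<^esub>) \<longrightarrow>
        (\<exists>g \<in> Hom X (I j). \<forall>x \<in> carrier X. f x = \<delta> j (g x)))"

abbreviation ker_mod :: "('a, 'p) module \<Rightarrow> ('a, 'q) module \<Rightarrow> ('p \<Rightarrow> 'q) \<Rightarrow> ('a, 'p) module" where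
  "ker_mod M N f \<equiv> M\<lparr>carrier := {x \<in> carrier M. f x = \<zero>\<^bsub>N\<^esub>}\<rparr>"

abbreviation im_mod :: "('a, 'p) module \<Rightarrow> ('a, 'q) module \<Rightarrow> ('p \<Rightarrow> 'q) \<Rightarrow> ('a, 'q) module" where
  "im_mod M N f \<equiv> N\<lparr>carrier := f ` carrier M\<rparr>"

lemma
  shows I_module: "module R (I j)"
    and I_lin: "\<delta> j \<in> Hom (I j) (I (Suc j))"
    and \<iota>_lin: "\<iota> \<in> Hom RR (I 0)"
    and \<iota>_inj: "inj_on \<iota> (carrier RR)"
    and I_zero: "j > n \<Longrightarrow> carrier (I j) = {\<zero>\<^bsub>I j\<^esub>}"
    and \<iota>_ker: "x \<in> carrier (I 0) \<Longrightarrow> \<delta> 0 x = \<zero>\<^bsub>I (Suc 0)\<^esub> \<Longrightarrow> x \<in> \<iota> ` carrier RR"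
    and \<iota>_im: "r \<in> carrier RR \<Longrightarrow> \<delta> 0 (\<iota> r) = \<zero>\<^bsub>I (Suc 0)\<^esub>"
    and I_ker: "x \<in> carrier (I (Suc j)) \<Longrightarrow> \<delta> (Suc j) x = \<zero>\<^bsub>I (Suc (Suc j))\<^esub> \<Longrightarrow> x \<in> \<delta> j ` carrier (I j)"
    and I_im: "x \<in> carrier (I j) \<Longrightarrow> \<delta> (Suc j) (\<delta> j x) = \<zero>\<^bsub>I (Suc (Suc j))\<^esub>"
    and I_injective: "injective_module R (I j)"
proof -
  have A: "injective_module R (I j)" "\<delta> j \<in> Hom (I j) (I (Suc j))" "\<iota> \<in> Hom RR (I 0)" "inj_on \<iota> (carrier RR)"
     "j > n \<Longrightarrow> carrier (I j) = {\<zero>\<^bsub>I j\<^esub>}"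
     "\<iota> ` carrier RR = {x \<in> carrier (I 0). \<delta> 0 x = \<zero>\<^bsub>I (Suc 0)\<^esub>}"
     "\<delta> j ` carrier (I j) = {x \<in> carrier (I (Suc j)). \<delta> (Suc j) x = \<zero>\<^bsub>I (Suc (Suc j))\<^esub>}" for j
    using resolution unfolding injective_resolution_def a_kernel_def' by simp_all
  show "module R (I j)" using A(1) unfolding injective_module_def by blast
  show "\<delta> j \<in> Hom (I j) (I (Suc j))" "\<iota> \<in> Hom RR (I 0)" "inj_on \<iota> (carrier RR)"
    "j > n \<Longrightarrow> carrier (I j) = {\<zero>\<^bsub>I j\<^esub>}" "injective_module R (I j)" by (fact A)+
  show "x \<in> \<iota> ` carrier RR" if "x \<in> carrier (I 0)" "\<delta> 0 x = \<zero>\<^bsub>I (Suc 0)\<^esub>" using A(6) that by simp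
  show "\<delta> 0 (\<iota> r) = \<zero>\<^bsub>I (Suc 0)\<^esub>" if "r \<in> carrier RR" using A(6) imageI[OF that, of \<iota>] by simp
  show "x \<in> \<delta> j ` carrier (I j)" if "x \<in> carrier (I (Suc j))" "\<delta> (Suc j) x = \<zero>\<^bsub>I (Suc (Suc j))\<^esub>"
    using A(7)[of j] that by simp
  show "\<delta> (Suc j) (\<delta> j x) = \<zero>\<^bsub>I (Suc (Suc j))\<^esub>" if "x \<in> carrier (I j)"
    using A(7)[of j] imageI[OF that, of "\<delta> j"] by simp
qed

text \<open>Injectivity is only known for test modules with carrier in
  \<open>('a + 'a) list set\<close>. A finitely generated \<open>C\<close> has a copy there:
  \<open>fg_inj\<close> gives sets of lists over \<open>'a\<close>, and \<open>Inl\<close> moves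
  them into the sum type.\<close>

lemma injective_extend:
  fixes C :: "('a, 'c) module"
  assumes "fg_module R C" "submodule B R C" "f \<in> Hom (C\<lparr>carrier := B\<rparr>) (I j)"
  shows "\<exists>h \<in> Hom C (I j). \<forall>x \<in> B. h x = f x"
proof -
  note C = fg_moduleD[OF assms(1)]
  note BC = submodule_carrier[OF assms(2)]
  obtain \<phi> :: "'c \<Rightarrow> 'a list set" where \<phi>: "inj_on \<phi> (carrier C)" using fg_inj[OF assms(1)] by blast
  have "inj (\<lambda>A :: 'a list set. map Inl ` A :: ('a + 'a) list set)"
    by (intro inj_image_eq_iff[THEN iffD1, THEN injI]) (auto simp: inj_on_def)
  then have "inj_on (\<lambda>x. map Inl ` \<phi> x :: ('a + 'a) list set) (carrier C)"
    using \<phi> by (auto simp: inj_on_def)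
  from copy_module_exists[OF C this] obtain C' :: "('a, ('a + 'a) list set) module" and \<theta> \<eta> where
    C': "module R C'" "\<theta> \<in> Hom C C'" "\<eta> \<in> Hom C' C" "\<forall>x \<in> carrier C. \<eta> (\<theta> x) = x"
    by (elim exE conjE) (rule that)
  let ?B = "\<theta> ` B"
  let ?A = "C'\<lparr>carrier := ?B\<rparr>"
  have sB: "submodule ?B R C'" by (rule image_submodule[OF C C'(1,2) assms(2)])
  have A: "module R ?A" by (rule submodule_module[OF C'(1) sB])
  have incl: "(\<lambda>x\<in>?B. x) \<in> Hom ?A C'" by (rule lin_inclusion[OF C'(1) sB])
  have "restrict \<eta> ?B \<in> Hom ?A (C\<lparr>carrier := B\<rparr>)"
    by (rule lin_codomain[OF lin_restrict[OF C'(1) sB C'(3)]]) (use C'(4) BC in auto)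
  then have g: "(\<lambda>x\<in>carrier ?A. f (restrict \<eta> ?B x)) \<in> Hom ?A (I j)"
    by (rule lin_comp[OF A _ assms(3)])
  have inj: "inj_on (\<lambda>x\<in>?B. x) (carrier ?A)" by (auto simp: inj_on_def)
  obtain h where h: "h \<in> Hom C' (I j)"
     "\<forall>x \<in> carrier ?A. h ((\<lambda>x\<in>?B. x) x) = (\<lambda>x\<in>carrier ?A. f (restrict \<eta> ?B x)) x"
    using I_injective[of j, unfolded injective_module_def, THEN conjunct2, rule_format,
        of ?A C' "\<lambda>x\<in>?B. x" "\<lambda>x\<in>carrier ?A. f (restrict \<eta> ?B x)"] A C'(1) incl inj g
    by blast
  show ?thesis
  proof (rule bexI[OF _ lin_comp[OF C C'(2) h(1)]], rule ballI)
    fix x assume x: "x \<in> B"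
    then show "(\<lambda>x\<in>carrier C. h (\<theta> x)) x = f x" using h(2) BC C'(4) by auto
  qed
qed

text \<open>Let K be the kernel of \<open>p\<close>. Extend \<open>f\<close> to a map
  \<open>\<psi>\<close> on \<open>C\<close> by injectivity. Its differential kills K, hence comes
  from a cocycle on the image of \<open>p\<close>, which is a coboundary by hypothesis; subtracting
  the bounding map turns \<open>\<psi>\<close> into a cocycle without changing it on K. In other
  words, the obstruction is a connecting homomorphism into a group that vanishes.\<close>

lemma cocycle_extend:
  fixes C :: "('a, 'c) module" and D :: "('a, 'd) module"
  assumes "fg_module R C" "module R D" "p \<in> Hom C D" "ext_ring_vanishes (im_mod C D p) k"
    and f: "f \<in> Hom (ker_mod C D p) (I k)"
    and fz: "\<And>x. x \<in> carrier C \<Longrightarrow> p x = \<zero>\<^bsub>D\<^esub> \<Longrightarrow> \<delta> k (f x) = \<zero>\<^bsub>I (Suc k)\<^esub>"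
  shows "\<exists>h \<in> Hom C (I k). (\<forall>x \<in> carrier C. \<delta> k (h x) = \<zero>\<^bsub>I (Suc k)\<^esub>) \<and>
            (\<forall>x \<in> carrier C. p x = \<zero>\<^bsub>D\<^esub> \<longrightarrow> h x = f x)"
proof -
  note C = fg_moduleD[OF assms(1)]
  let ?D = "im_mod C D p"
  have D: "module R ?D" by (rule submodule_module[OF assms(2) range_submodule[OF C assms(2,3)]])
  interpret I: module R "I k" by (rule I_module)
  interpret I1: module R "I (Suc k)" by (rule I_module)
  obtain \<psi> where \<psi>: "\<psi> \<in> Hom C (I k)" "\<And>x. x \<in> carrier C \<Longrightarrow> p x = \<zero>\<^bsub>D\<^esub> \<Longrightarrow> \<psi> x = f x"
    using injective_extend[OF assms(1) kernel_submodule[OF C assms(2,3)] f] by auto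
  have \<chi>: "(\<lambda>x\<in>carrier C. \<delta> k (\<psi> x)) \<in> Hom C (I (Suc k))" by (rule lin_comp[OF C \<psi>(1) I_lin])
  have "\<exists>g \<in> Hom ?D (I (Suc k)). \<forall>x \<in> carrier C. g (p x) = (\<lambda>x\<in>carrier C. \<delta> k (\<psi> x)) x"
    by (rule lin_factor[OF C assms(2) I_module assms(3) \<chi>]) (use \<psi>(2) fz in auto)
  then obtain g where g: "g \<in> Hom ?D (I (Suc k))" "\<And>x. x \<in> carrier C \<Longrightarrow> g (p x) = \<delta> k (\<psi> x)"
    by auto
  have "\<forall>x \<in> carrier ?D. \<delta> (Suc k) (g x) = \<zero>\<^bsub>I (Suc (Suc k))\<^esub>"
    using g(2) I_im[OF lin_closed[OF \<psi>(1)]] by auto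
  then obtain l where l: "l \<in> Hom ?D (I k)" "\<forall>x \<in> carrier ?D. g x = \<delta> k (l x)"
    using assms(4) g(1) unfolding ext_ring_vanishes_def by blast
  have p: "p \<in> Hom C ?D" by (rule lin_codomain[OF assms(3)]) auto
  have lp: "(\<lambda>x\<in>carrier C. l (p x)) \<in> Hom C (I k)" by (rule lin_comp[OF C p l(1)])
  show ?thesis
  proof (rule bexI[OF _ lin_diff[OF C I_module \<psi>(1) lp]], intro conjI ballI impI)
    fix x assume x: "x \<in> carrier C"
    have c: "\<psi> x \<in> carrier (I k)" "l (p x) \<in> carrier (I k)"
      using lin_closed[OF \<psi>(1) x] lin_closed[OF l(1) lin_closed[OF p x]] by auto
    have "\<delta> k (\<psi> x \<ominus>\<^bsub>I k\<^esub> l (p x)) = \<delta> k (\<psi> x) \<ominus>\<^bsub>I (Suc k)\<^esub> \<delta> k (l (p x))"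
      by (rule lin_minus[OF I_module I_module I_lin c])
    also have "\<delta> k (l (p x)) = \<delta> k (\<psi> x)"
      using g(2)[OF x] l(2)[rule_format, OF lin_closed[OF p x]] by metis
    also have "\<delta> k (\<psi> x) \<ominus>\<^bsub>I (Suc k)\<^esub> \<delta> k (\<psi> x) = \<zero>\<^bsub>I (Suc k)\<^esub>"
      using lin_closed[OF I_lin c(1)] by (simp add: a_minus_def I1.M.r_neg)
    finally show "\<delta> k ((\<lambda>x\<in>carrier C. \<psi> x \<ominus>\<^bsub>I k\<^esub> (\<lambda>x\<in>carrier C. l (p x)) x) x) = \<zero>\<^bsub>I (Suc k)\<^esub>"
      using x by simp
    assume px: "p x = \<zero>\<^bsub>D\<^esub>"
    then have "l (p x) = \<zero>\<^bsub>I k\<^esub>" using lin_zero[OF D I_module l(1)] by simp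
    then show "(\<lambda>x\<in>carrier C. \<psi> x \<ominus>\<^bsub>I k\<^esub> (\<lambda>x\<in>carrier C. l (p x)) x) x = f x"
      using x c \<psi>(2)[OF x px] by (simp add: a_minus_def)
  qed
qed

text \<open>In the long exact sequence of the kernel, \<open>C\<close> and the image, the Ext group
  of the kernel sits between that of \<open>C\<close> in the same degree and that of the image one
  degree higher.\<close>

lemma ext_ring_vanishes_ker:
  fixes C :: "('a, 'c) module" and D :: "('a, 'd) module"
  assumes "fg_module R C" "module R D" "p \<in> Hom C D"
    and "ext_ring_vanishes C j" "ext_ring_vanishes (im_mod C D p) (Suc j)"
  shows "ext_ring_vanishes (ker_mod C D p) j"
  unfolding ext_ring_vanishes_def
proof (intro ballI impI)
  note C = fg_moduleD[OF assms(1)]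
  fix f assume f: "f \<in> Hom (ker_mod C D p) (I (Suc j))"
    and fz: "\<forall>x \<in> carrier (ker_mod C D p). \<delta> (Suc j) (f x) = \<zero>\<^bsub>I (Suc (Suc j))\<^esub>"
  have "\<exists>h \<in> Hom C (I (Suc j)). (\<forall>x \<in> carrier C. \<delta> (Suc j) (h x) = \<zero>\<^bsub>I (Suc (Suc j))\<^esub>) \<and>
            (\<forall>x \<in> carrier C. p x = \<zero>\<^bsub>D\<^esub> \<longrightarrow> h x = f x)"
    by (rule cocycle_extend[OF assms(1,2,3,5) f]) (use fz in auto)
  then obtain h where h: "h \<in> Hom C (I (Suc j))" "\<forall>x \<in> carrier C. \<delta> (Suc j) (h x) = \<zero>\<^bsub>I (Suc (Suc j))\<^esub>"
      "\<forall>x \<in> carrier C. p x = \<zero>\<^bsub>D\<^esub> \<longrightarrow> h x = f x" by blast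
  obtain g where g: "g \<in> Hom C (I j)" "\<forall>x \<in> carrier C. h x = \<delta> j (g x)"
    using assms(4) h(1,2) unfolding ext_ring_vanishes_def by blast
  have "restrict g {x \<in> carrier C. p x = \<zero>\<^bsub>D\<^esub>} \<in> Hom (ker_mod C D p) (I j)"
    by (rule lin_restrict[OF C kernel_submodule[OF C assms(2,3)] g(1)])
  then show "\<exists>g \<in> Hom (ker_mod C D p) (I j). \<forall>x \<in> carrier (ker_mod C D p). f x = \<delta> j (g x)"
    by (rule bexI[rotated]) (use g(2) h(3) in auto)
qed

text \<open>The bottom case of \<open>cocycle_extend\<close>: a cocycle with values in
  \<open>I 0\<close> is a functional, because the kernel of \<open>\<delta> 0\<close> is the
  embedded copy of \<open>R\<close>.\<close>

lemma functional_extend: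
  fixes C :: "('a, 'c) module" and D :: "('a, 'd) module"
  assumes "fg_module R C" "module R D" "p \<in> Hom C D" "ext_ring_vanishes (im_mod C D p) 0"
    and f: "f \<in> Hom (ker_mod C D p) RR"
  shows "\<exists>h \<in> Hom C RR. \<forall>x \<in> carrier C. p x = \<zero>\<^bsub>D\<^esub> \<longrightarrow> h x = f x"
proof -
  note C = fg_moduleD[OF assms(1)]
  have K: "module R (ker_mod C D p)" by (rule submodule_module[OF C kernel_submodule[OF C assms(2,3)]])
  have \<iota>f: "(\<lambda>x\<in>carrier (ker_mod C D p). \<iota> (f x)) \<in> Hom (ker_mod C D p) (I 0)"
    by (rule lin_comp[OF K f \<iota>_lin])
  have fc: "f x \<in> carrier RR" if "x \<in> carrier C" "p x = \<zero>\<^bsub>D\<^esub>" for x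
    using lin_closed[OF f] that by simp
  have "\<exists>h \<in> Hom C (I 0). (\<forall>x \<in> carrier C. \<delta> 0 (h x) = \<zero>\<^bsub>I (Suc 0)\<^esub>) \<and>
      (\<forall>x \<in> carrier C. p x = \<zero>\<^bsub>D\<^esub> \<longrightarrow> h x = (\<lambda>x\<in>carrier (ker_mod C D p). \<iota> (f x)) x)"
    by (rule cocycle_extend[OF assms(1-4) \<iota>f]) (use \<iota>_im fc in auto)
  then obtain h where h: "h \<in> Hom C (I 0)" "\<And>x. x \<in> carrier C \<Longrightarrow> \<delta> 0 (h x) = \<zero>\<^bsub>I (Suc 0)\<^esub>"
     "\<And>x. x \<in> carrier C \<Longrightarrow> p x = \<zero>\<^bsub>D\<^esub> \<Longrightarrow> h x = \<iota> (f x)" by auto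
  \<comment> \<open>Factoring the identity through \<open>\<iota>\<close> yields the linear inverse
    of \<open>\<iota>\<close> on its image.\<close>
  have idR: "(\<lambda>x\<in>carrier RR. x) \<in> Hom RR RR" by (rule lin_mapI[OF _ _ _ regular_module]) auto
  have "x = \<zero>\<^bsub>RR\<^esub>" if "x \<in> carrier RR" "\<iota> x = \<zero>\<^bsub>I 0\<^esub>" for x
    using inj_onD[OF \<iota>_inj, of x "\<zero>\<^bsub>RR\<^esub>"] that lin_zero[OF regular_module I_module \<iota>_lin]
    by (simp add: regular_simps)
  then have "\<exists>g \<in> Hom (im_mod RR (I 0) \<iota>) RR. \<forall>x \<in> carrier RR. g (\<iota> x) = (\<lambda>x\<in>carrier RR. x) x"
    by (intro lin_factor[OF regular_module I_module regular_module \<iota>_lin idR]) auto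
  then obtain g where g: "g \<in> Hom (im_mod RR (I 0) \<iota>) RR" "\<And>x. x \<in> carrier RR \<Longrightarrow> g (\<iota> x) = x" by auto
  have "h \<in> Hom C (im_mod RR (I 0) \<iota>)"
    by (rule lin_codomain[OF h(1)]) (use \<iota>_ker lin_closed[OF h(1)] h(2) in blast)
  then have gh: "(\<lambda>x\<in>carrier C. g (h x)) \<in> Hom C RR" by (rule lin_comp[OF C _ g(1)])
  show ?thesis by (rule bexI[OF _ gh]) (use h(3) g(2) fc in auto)
qed

text \<open>The cocycles in question take values in \<open>I (Suc j)\<close>, which is zero once
  \<open>j\<close> reaches \<open>n\<close>.\<close>

lemma ext_ring_vanishes_trivial:
  assumes "module R X" "j \<ge> n" shows "ext_ring_vanishes X j"
  unfolding ext_ring_vanishes_def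
proof (intro ballI impI)
  fix f assume f: "f \<in> Hom X (I (Suc j))"
  show "\<exists>g \<in> Hom X (I j). \<forall>x \<in> carrier X. f x = \<delta> j (g x)"
    by (rule bexI[OF _ lin_zero_map[OF assms(1) I_module]])
      (use lin_closed[OF f] I_zero[of "Suc j"] assms(2) lin_zero[OF I_module I_module I_lin] in auto)
qed

lemma ext_ring_vanishes_free: "ext_ring_vanishes (Fr S) j"
  unfolding ext_ring_vanishes_def
proof (intro ballI impI)
  fix f assume f: "f \<in> Hom (Fr S) (I (Suc j))"
    and fz: "\<forall>x \<in> carrier (Fr S). \<delta> (Suc j) (f x) = \<zero>\<^bsub>I (Suc (Suc j))\<^esub>"
  have "\<exists>g \<in> Hom (Fr S) (I j). \<forall>y \<in> carrier (Fr S). \<delta> j (g y) = f y"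
    by (rule free_lift[OF I_module I_module f I_lin]) (use I_ker lin_closed[OF f] fz in blast)
  then show "\<exists>g \<in> Hom (Fr S) (I j). \<forall>x \<in> carrier (Fr S). f x = \<delta> j (g x)" by metis
qed

text \<open>The regular module is a different record from a free module on one basis element, but
  the same idea applies: lift the value at \<open>\<one>\<close>. It is the case
  \<open>N = R\<close> that makes \<open>functional_factor\<close> applicable in
  \<open>torsionless\<close>.\<close>

lemma ext_ring_vanishes_regular: "ext_ring_vanishes RR j"
  unfolding ext_ring_vanishes_def
proof (intro ballI impI)
  fix f assume f: "f \<in> Hom RR (I (Suc j))"
    and fz: "\<forall>x \<in> carrier RR. \<delta> (Suc j) (f x) = \<zero>\<^bsub>I (Suc (Suc j))\<^esub>"
  interpret I: module R "I j" by (rule I_module)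
  have 1: "\<one> \<in> carrier RR" by (simp add: regular_simps)
  obtain b where b: "b \<in> carrier (I j)" "\<delta> j b = f \<one>"
    using I_ker[OF lin_closed[OF f 1]] fz 1 by (metis imageE)
  have "(\<lambda>r\<in>carrier RR. r \<odot>\<^bsub>I j\<^esub> b) \<in> Hom RR (I j)"
    by (rule lin_mapI[OF _ _ _ regular_module])
      (use b(1) in \<open>auto simp: regular_simps I.smult_l_distr I.smult_assoc1\<close>)
  then show "\<exists>g \<in> Hom RR (I j). \<forall>x \<in> carrier RR. f x = \<delta> j (g x)"
  proof (rule bexI[rotated], intro ballI)
    fix r assume r: "r \<in> carrier RR"
    have "f (r \<odot>\<^bsub>RR\<^esub> \<one>) = r \<odot>\<^bsub>I (Suc j)\<^esub> f \<one>"
      using r by (intro lin_smult[OF f _ 1]) (simp add: regular_simps)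
    then show "f r = \<delta> j ((\<lambda>r\<in>carrier RR. r \<odot>\<^bsub>I j\<^esub> b) r)"
      using lin_smult[OF I_lin _ b(1)] b(2) r by (simp add: regular_simps)
  qed
qed

text \<open>The module is a finite sum of copies of \<open>N\<close>; bound each component
  separately and assemble the bounding maps.\<close>

lemma ext_ring_vanishes_hom_free:
  assumes "finite S" "module R N" "ext_ring_vanishes N j"
  shows "ext_ring_vanishes (hom_module R (Fr S) N) j"
  unfolding ext_ring_vanishes_def
proof (intro ballI impI)
  let ?C = "hom_module R (Fr S) N"
  have C: "module R ?C" by (rule hom_module[OF free_module assms(2)])
  fix f assume f: "f \<in> Hom ?C (I (Suc j))"
    and fz: "\<forall>x \<in> carrier ?C. \<delta> (Suc j) (f x) = \<zero>\<^bsub>I (Suc (Suc j))\<^esub>"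
  have "\<exists>g \<in> Hom N (I j). \<forall>x \<in> carrier N. f (scal (Fr S) N (coord S s) x) = \<delta> j (g x)" if s: "s \<in> S" for s
  proof -
    have l: "(\<lambda>x\<in>carrier N. f ((\<lambda>x\<in>carrier N. scal (Fr S) N (coord S s) x) x)) \<in> Hom N (I (Suc j))"
      by (rule lin_comp[OF assms(2) scal_lin[OF free_module assms(2) coord_lin[OF s]] f])
    have "\<forall>x \<in> carrier N. \<delta> (Suc j) ((\<lambda>x\<in>carrier N. f ((\<lambda>x\<in>carrier N. scal (Fr S) N (coord S s) x) x)) x) = \<zero>\<^bsub>I (Suc (Suc j))\<^esub>"
      using fz scal_closed[OF free_module assms(2) coord_lin[OF s]] by (simp add: hom_simps)
    with assms(3) l show ?thesis unfolding ext_ring_vanishes_def by fastforce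
  qed
  then obtain g where g: "\<And>s. s \<in> S \<Longrightarrow> g s \<in> Hom N (I j)"
     "\<And>s x. s \<in> S \<Longrightarrow> x \<in> carrier N \<Longrightarrow> f (scal (Fr S) N (coord S s) x) = \<delta> j (g s x)"
    by metis
  obtain G where G: "G \<in> Hom ?C (I j)"
     "\<And>s x. s \<in> S \<Longrightarrow> x \<in> carrier N \<Longrightarrow> G (scal (Fr S) N (coord S s) x) = g s x"
    using hom_free_extend[where h = g, OF assms(1,2) I_module[of j] g(1)] by metis
  have "f u = (\<lambda>u\<in>carrier ?C. \<delta> j (G u)) u" if "u \<in> carrier ?C" for u
  proof (rule hom_free_ext[OF assms(1,2) I_module f lin_comp[OF C G(1) I_lin]])
    fix s x assume s: "s \<in> S" "x \<in> carrier N"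
    then show "f (scal (Fr S) N (coord S s) x) = (\<lambda>u\<in>carrier ?C. \<delta> j (G u)) (scal (Fr S) N (coord S s) x)"
      using scal_closed[OF free_module assms(2) coord_lin[OF s(1)] s(2)] by (simp add: g(2) G(2) hom_simps)
  qed (use that in \<open>simp add: hom_simps\<close>)
  then show "\<exists>g \<in> Hom ?C (I j). \<forall>x \<in> carrier ?C. f x = \<delta> j (g x)"
    using G(1) by (intro bexI[of _ G]) auto
qed

text \<open>Passing from one image to the next trades one syzygy step for one degree of Ext, so
  \<open>i + j\<close> is what counts. The induction starts at the image of \<open>d 0\<close>,
  about which nothing but finite injective dimension of \<open>R\<close> is used.\<close>

lemma ext_ring_vanishes_syzygy:
  fixes S :: "nat \<Rightarrow> 'i set"
  assumes "\<And>i. finite (S i)" and d: "\<And>i. d i \<in> Hom (Fr (S (Suc i))) (Fr (S i))"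
    and ex: "\<And>i. d (Suc i) ` carrier (Fr (S (Suc (Suc i)))) = {x \<in> carrier (Fr (S (Suc i))). d i x = \<zero>\<^bsub>Fr (S i)\<^esub>}"
    and "n \<le> i + j"
  shows "ext_ring_vanishes (im_mod (Fr (S (Suc i))) (Fr (S i)) (d i)) j"
  using assms(4)
proof (induction i arbitrary: j)
  case 0
  then show ?case
    by (intro ext_ring_vanishes_trivial submodule_module[OF free_module range_submodule[OF free_module free_module d]]) simp
next
  case (Suc i)
  have "ext_ring_vanishes (ker_mod (Fr (S (Suc i))) (Fr (S i)) (d i)) j"
    by (rule ext_ring_vanishes_ker[OF fg_free[OF assms(1)] free_module d ext_ring_vanishes_free Suc.IH])
      (use Suc.prems in simp)
  then show ?case unfolding ex .
qed

text \<open>Here Ext computed injectively becomes Ext computed from a free complex. With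
  \<open>i = Suc k\<close>, a cocycle descends to the image of \<open>d i\<close>, which is the
  kernel of \<open>d k\<close>. Extending it to the free module around that kernel is obstructed by
  Ext^1 of the image of \<open>d k\<close> into \<open>R\<close>, zero since
  \<open>n \<le> k\<close>.\<close>

lemma dual_exact:
  fixes S :: "nat \<Rightarrow> 'i set"
  assumes "\<And>i. finite (S i)" and d: "\<And>i. d i \<in> Hom (Fr (S (Suc i))) (Fr (S i))"
    and ex: "\<And>i. d (Suc i) ` carrier (Fr (S (Suc (Suc i)))) = {x \<in> carrier (Fr (S (Suc i))). d i x = \<zero>\<^bsub>Fr (S i)\<^esub>}"
    and "n < i"
  shows "ext_vanishes R S d RR i"
proof (rule ext_vanishesI)
  obtain k where k: "i = Suc k" "n \<le> k" using assms(4) by (cases i) auto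
  fix f assume f: "f \<in> Hom (Fr (S (Suc i))) RR"
    and fz: "\<And>y. y \<in> carrier (Fr (S (Suc (Suc i)))) \<Longrightarrow> f (d (Suc i) y) = \<zero>\<^bsub>RR\<^esub>"
  have "f x = \<zero>\<^bsub>RR\<^esub>" if "x \<in> carrier (Fr (S (Suc i)))" "d i x = \<zero>\<^bsub>Fr (S i)\<^esub>" for x
  proof -
    have "x \<in> d (Suc i) ` carrier (Fr (S (Suc (Suc i))))" using ex[of i] that by simp
    then show ?thesis using fz by auto
  qed
  then obtain g where g: "g \<in> Hom (im_mod (Fr (S (Suc i))) (Fr (S i)) (d i)) RR"
     "\<And>x. x \<in> carrier (Fr (S (Suc i))) \<Longrightarrow> g (d i x) = f x"
    using lin_factor[OF free_module free_module regular_module d[of i] f] by blast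
  have g': "g \<in> Hom (ker_mod (Fr (S (Suc k))) (Fr (S k)) (d k)) RR"
    using g(1) unfolding k(1) ex .
  have "ext_ring_vanishes (im_mod (Fr (S (Suc k))) (Fr (S k)) (d k)) 0"
    by (rule ext_ring_vanishes_syzygy[where d = d and S = S and i = k and j = 0, OF assms(1) d ex]) (use k in simp)
  from functional_extend[OF fg_free[OF assms(1)] free_module d this g'] obtain h where
    h: "h \<in> Hom (Fr (S i)) RR" "\<And>x. x \<in> carrier (Fr (S i)) \<Longrightarrow> d k x = \<zero>\<^bsub>Fr (S k)\<^esub> \<Longrightarrow> h x = g x"
    unfolding k(1) by blast
  have "f y = h (d i y)" if y: "y \<in> carrier (Fr (S (Suc i)))" for y
  proof -
    have "d i y \<in> carrier (Fr (S i))" by (rule lin_closed[OF d y])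
    moreover have "d k (d i y) = \<zero>\<^bsub>Fr (S k)\<^esub>"
      using ex[of k] imageI[of y "carrier (Fr (S (Suc i)))" "d i"] y unfolding k(1) by blast
    ultimately show ?thesis using h(2) g(2)[OF y] by simp
  qed
  then show "\<exists>g \<in> Hom (Fr (S i)) RR. \<forall>y \<in> carrier (Fr (S (Suc i))). f y = g (d i y)"
    using h(1) by blast
qed

text \<open>Since \<open>Hom(d, N)\<close> is exact indefinitely to the right, shifting dimensions \<open>n\<close> times shows that its
  cocycles have vanishing Ext into \<open>R\<close>; so the functional that \<open>\<phi>\<close> induces on the coboundaries
  extends.\<close>

lemma functional_factor:
  fixes S :: "nat \<Rightarrow> 'i set" and N :: "('a, 'n) module"
  assumes "fg_module R N" "\<And>j. ext_ring_vanishes N j"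
    and "\<And>i. finite (S i)" and d: "\<And>i. d i \<in> Hom (Fr (S (Suc i))) (Fr (S i))"
    and dd: "\<And>n y. y \<in> carrier (Fr (S (Suc (Suc n)))) \<Longrightarrow> d n (d (Suc n) y) = \<zero>\<^bsub>Fr (S n)\<^esub>"
    and ev: "\<And>i. i \<ge> i0 \<Longrightarrow> ext_vanishes R S d N i"
    and \<phi>: "\<phi> \<in> Hom (hom_module R (Fr (S i0)) N) RR"
    and \<phi>z: "\<And>u. u \<in> Hom (Fr (S i0)) N \<Longrightarrow> (\<And>y. y \<in> carrier (Fr (S (Suc i0))) \<Longrightarrow> u (d i0 y) = \<zero>\<^bsub>N\<^esub>) \<Longrightarrow> \<phi> u = \<zero>"
  shows "\<exists>\<chi> \<in> Hom (hom_module R (Fr (S (Suc i0))) N) RR.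
     \<forall>u \<in> Hom (Fr (S i0)) N. \<phi> u = \<chi> (\<lambda>y\<in>carrier (Fr (S (Suc i0))). u (d i0 y))"
proof -
  note N = fg_moduleD[OF assms(1)]
  define C where "C k = hom_module R (Fr (S k)) N" for k
  define \<gamma> where "\<gamma> k = coboundary S d N k" for k
  have C: "module R (C k)" for k unfolding C_def by (rule hom_module[OF free_module N])
  have cC: "carrier (C k) = Hom (Fr (S k)) N" for k by (simp add: C_def hom_simps)
  have fgC: "fg_module R (C k)" for k unfolding C_def by (rule fg_hom_free[OF assms(3,1)])
  have VC: "ext_ring_vanishes (C k) j" for k j
    unfolding C_def by (rule ext_ring_vanishes_hom_free[OF assms(3) N assms(2)])
  have \<gamma>: "\<gamma> k \<in> Hom (C k) (C (Suc k))" for k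
    unfolding \<gamma>_def C_def by (rule coboundary_lin[where d = d, OF N d])
  have ex: "\<gamma> k ` carrier (C k) = {f \<in> carrier (C (Suc k)). \<gamma> (Suc k) f = \<zero>\<^bsub>C (Suc (Suc k))\<^esub>}"
    if "k \<ge> i0" for k
    unfolding C_def \<gamma>_def hom_simps(1)
  proof (rule equalityI)
    note e = ext_vanishes_iff_exact[where d = d and S = S and i = k, OF N d dd]
    show "coboundary S d N k ` Hom (Fr (S k)) N \<subseteq> {f \<in> Hom (Fr (S (Suc k))) N.
        coboundary S d N (Suc k) f = \<zero>\<^bsub>hom_module R (Fr (S (Suc (Suc k)))) N\<^esub>}"
      by (rule e(1))
    show "{f \<in> Hom (Fr (S (Suc k))) N.
        coboundary S d N (Suc k) f = \<zero>\<^bsub>hom_module R (Fr (S (Suc (Suc k)))) N\<^esub>}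
        \<subseteq> coboundary S d N k ` Hom (Fr (S k)) N"
      using e(2) ev[OF that] by (rule iffD1)
  qed
  \<comment> \<open>The image of a coboundary map is the cocycle module one place further right.
    Each move to the right raises the required degree by one; \<open>m\<close> counts the moves
    still available until that degree reaches \<open>n\<close>.\<close>
  have V: "ext_ring_vanishes (ker_mod (C (Suc k)) (C (Suc (Suc k))) (\<gamma> (Suc k))) j"
    if "i0 \<le> k" "n \<le> j + m" for k j m
    using that
  proof (induction m arbitrary: j k)
    case 0
    then show ?case
      by (intro ext_ring_vanishes_trivial submodule_module[OF C kernel_submodule[OF C C \<gamma>]]) simp
  next
    case (Suc m)
    have "ext_ring_vanishes (im_mod (C (Suc k)) (C (Suc (Suc k))) (\<gamma> (Suc k))) (Suc j)"
      using Suc.IH[of "Suc k" "Suc j"] Suc.prems ex[of "Suc k"] by simp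
    then show ?case by (rule ext_ring_vanishes_ker[OF fgC C \<gamma> VC])
  qed
  have "\<phi> u = \<zero>\<^bsub>RR\<^esub>" if "u \<in> carrier (C i0)" "\<gamma> i0 u = \<zero>\<^bsub>C (Suc i0)\<^esub>" for u
    using \<phi>z[of u] that coboundary_eq_zero_iff[where d = d and S = S and n = i0, of u N]
    unfolding C_def \<gamma>_def hom_simps(1) regular_simps by blast
  then obtain g where g: "g \<in> Hom (im_mod (C i0) (C (Suc i0)) (\<gamma> i0)) RR"
     "\<And>u. u \<in> carrier (C i0) \<Longrightarrow> g (\<gamma> i0 u) = \<phi> u"
    using lin_factor[OF C C regular_module \<gamma> \<phi>[folded C_def]] by blast
  have g': "g \<in> Hom (ker_mod (C (Suc i0)) (C (Suc (Suc i0))) (\<gamma> (Suc i0))) RR"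
    using g(1) ex[of i0] by simp
  have "ext_ring_vanishes (im_mod (C (Suc i0)) (C (Suc (Suc i0))) (\<gamma> (Suc i0))) 0"
    using V[of "Suc i0" 0 n] ex[of "Suc i0"] by simp
  from functional_extend[OF fgC C \<gamma> this g'] obtain \<chi> where
    \<chi>: "\<chi> \<in> Hom (C (Suc i0)) RR"
      "\<And>x. x \<in> carrier (C (Suc i0)) \<Longrightarrow> \<gamma> (Suc i0) x = \<zero>\<^bsub>C (Suc (Suc i0))\<^esub> \<Longrightarrow> \<chi> x = g x" by blast
  have "\<phi> u = \<chi> (\<lambda>y\<in>carrier (Fr (S (Suc i0))). u (d i0 y))" if u: "u \<in> Hom (Fr (S i0)) N" for u
  proof -
    have "\<gamma> i0 u \<in> \<gamma> i0 ` carrier (C i0)" using u cC by blast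
    then have "\<chi> (\<gamma> i0 u) = g (\<gamma> i0 u)" using \<chi>(2) ex[of i0] by blast
    then show ?thesis using g(2)[of u] u cC by (simp add: \<gamma>_def coboundary_def)
  qed
  then show ?thesis using \<chi>(1) unfolding C_def by blast
qed

section \<open>Functionals on Hom modules\<close>

text \<open>Both sides are linear in \<open>\<theta>\<close>, and the functionals on a finite free
  module are generated by the coordinates, for which the claim is \<open>eq\<close>.\<close>

lemma functional_scal:
  assumes "finite S" "module R N" and \<phi>: "\<phi> \<in> Hom (hom_module R (Fr S) N) RR"
    and x: "x \<in> carrier N" and y: "y \<in> carrier (Fr S)"
    and eq: "\<And>s. s \<in> S \<Longrightarrow> \<phi> (scal (Fr S) N (coord S s) x) = y s"
    and \<theta>: "\<theta> \<in> Hom (Fr S) RR"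
  shows "\<phi> (scal (Fr S) N \<theta> x) = \<theta> y"
proof -
  interpret N: module R N by fact
  let ?D = "hom_module R (Fr S) RR"
  have D: "module R ?D" by (rule hom_module[OF free_module regular_module])
  have c: "\<theta> v \<in> carrier R" if "\<theta> \<in> Hom (Fr S) RR" "v \<in> carrier (Fr S)" for \<theta> v
    using lin_closed[OF that] by (simp add: regular_simps)
  have s: "(\<lambda>\<theta>\<in>carrier ?D. scal (Fr S) N \<theta> x) \<in> Hom ?D (hom_module R (Fr S) N)"
    by (rule lin_mapI[OF _ _ _ D])
      (use x scal_closed[OF free_module assms(2)] in
        \<open>auto simp: hom_simps scal_def regular_simps N.smult_l_distr N.smult_assoc1 c intro!: ext\<close>)
  have l: "(\<lambda>\<theta>\<in>carrier ?D. \<phi> ((\<lambda>\<theta>\<in>carrier ?D. scal (Fr S) N \<theta> x) \<theta>)) \<in> Hom ?D RR"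
    by (rule lin_comp[OF D s \<phi>])
  have r: "(\<lambda>\<theta>\<in>carrier ?D. \<theta> y) \<in> Hom ?D RR"
    by (rule lin_mapI[OF _ _ _ D]) (use y in \<open>auto simp: hom_simps lin_closed\<close>)
  have "(\<lambda>\<theta>\<in>carrier ?D. \<phi> ((\<lambda>\<theta>\<in>carrier ?D. scal (Fr S) N \<theta> x) \<theta>)) \<theta> = (\<lambda>\<theta>\<in>carrier ?D. \<theta> y) \<theta>"
  proof (rule hom_free_ext[OF assms(1) regular_module regular_module l r _ \<theta>])
    fix s a assume s: "s \<in> S" and a: "a \<in> carrier RR"
    \<comment> \<open>The generators that \<open>hom_free_ext\<close> offers for the dual of
      \<open>Fr S\<close> are the multiples of coordinate functionals.\<close>
    let ?\<theta> = "scal (Fr S) RR (coord S s) a"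
    have \<theta>c: "?\<theta> \<in> carrier ?D"
      using scal_closed[OF free_module regular_module coord_lin[OF s] a] by (simp add: hom_simps)
    have xc: "scal (Fr S) N (coord S s) x \<in> carrier (hom_module R (Fr S) N)"
      using scal_closed[OF free_module assms(2) coord_lin[OF s] x] by (simp add: hom_simps)
    have a': "a \<in> carrier R" using a by (simp add: regular_simps)
    have "scal (Fr S) N ?\<theta> x = a \<odot>\<^bsub>hom_module R (Fr S) N\<^esub> scal (Fr S) N (coord S s) x"
      using s x a' by (auto simp: scal_def coord_def hom_simps regular_simps free_carrierD(1) m_comm
          simp flip: N.smult_assoc1 intro!: ext)
    then have "\<phi> (scal (Fr S) N ?\<theta> x) = a \<otimes> y s"
      using lin_smult[OF \<phi> a' xc] eq[OF s] by (simp add: regular_simps)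
    moreover have "?\<theta> y = a \<otimes> y s"
      using s y a' by (simp add: scal_def coord_def regular_simps free_carrierD(1) m_comm)
    ultimately show "(\<lambda>\<theta>\<in>carrier ?D. \<phi> ((\<lambda>\<theta>\<in>carrier ?D. scal (Fr S) N \<theta> x) \<theta>)) ?\<theta> = (\<lambda>\<theta>\<in>carrier ?D. \<theta> y) ?\<theta>"
      using \<theta>c by simp
  qed
  then show ?thesis using \<theta> by (simp add: hom_simps)
qed

text \<open>The \<open>s\<close>-th coordinate of \<open>g x\<close> is \<open>\<chi>\<close> at
  \<open>x\<close> placed in summand \<open>s\<close>. With \<open>functional_from_lin\<close> this
  identifies functionals on Hom(Fr S, N) with maps from N to Fr S. Quantifying over all
  \<open>\<theta>\<close> builds in naturality: later \<open>\<theta>\<close> is a coordinate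
  composed with a differential.\<close>

lemma lin_from_functional:
  assumes "finite S" "module R N" and \<chi>: "\<chi> \<in> Hom (hom_module R (Fr S) N) RR"
  shows "\<exists>g \<in> Hom N (Fr S). \<forall>x \<in> carrier N. \<forall>\<theta> \<in> Hom (Fr S) RR. \<theta> (g x) = \<chi> (scal (Fr S) N \<theta> x)"
proof -
  let ?C = "hom_module R (Fr S) N"
  let ?h = "\<lambda>s. \<lambda>x\<in>carrier N. \<chi> ((\<lambda>x\<in>carrier N. scal (Fr S) N (coord S s) x) x)"
  have h: "?h s \<in> Hom N RR" if "s \<in> S" for s
    by (rule lin_comp[OF assms(2) scal_lin[OF free_module assms(2) coord_lin[OF that]] \<chi>])
  let ?g = "\<lambda>x\<in>carrier N. \<lambda>s\<in>S. ?h s x"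
  have g: "?g \<in> Hom N (Fr S)" by (rule lin_tuple[OF assms(2,1) h])
  have "\<theta> (?g x) = \<chi> (scal (Fr S) N \<theta> x)" if "x \<in> carrier N" "\<theta> \<in> Hom (Fr S) RR" for x \<theta>
    by (rule functional_scal[OF assms(1,2) \<chi> that(1) lin_closed[OF g that(1)] _ that(2), symmetric])
      (use that(1) in simp)
  then show ?thesis using g by blast
qed

lemma functional_from_lin:
  assumes "finite S" "module R N" and f: "f \<in> Hom N (Fr S)"
  shows "\<exists>\<phi> \<in> Hom (hom_module R (Fr S) N) RR.
           \<forall>x \<in> carrier N. \<forall>\<theta> \<in> Hom (Fr S) RR. \<phi> (scal (Fr S) N \<theta> x) = \<theta> (f x)"
proof -
  have "(\<lambda>x\<in>carrier N. coord S s (f x)) \<in> Hom N RR" if "s \<in> S" for s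
    by (rule lin_comp[OF assms(2) f coord_lin[OF that]])
  then obtain \<phi> where \<phi>: "\<phi> \<in> Hom (hom_module R (Fr S) N) RR"
    "\<forall>s \<in> S. \<forall>x \<in> carrier N. \<phi> (scal (Fr S) N (coord S s) x) = (\<lambda>x\<in>carrier N. coord S s (f x)) x"
    using hom_free_extend[OF assms(1,2) regular_module, of "\<lambda>s. \<lambda>x\<in>carrier N. coord S s (f x)"] by metis
  have "\<phi> (scal (Fr S) N \<theta> x) = \<theta> (f x)" if "x \<in> carrier N" "\<theta> \<in> Hom (Fr S) RR" for x \<theta>
    by (rule functional_scal[OF assms(1,2) \<phi>(1) that(1) lin_closed[OF f that(1)] _ that(2)])
      (use \<phi>(2) that(1) lin_closed[OF f that(1)] in \<open>simp add: coord_def\<close>)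
  then show ?thesis using \<phi>(1) by blast
qed

lemma free_eq_coordI:
  assumes "x \<in> carrier (Fr S)" "y \<in> carrier (Fr S)" "\<And>s. s \<in> S \<Longrightarrow> coord S s x = coord S s y"
  shows "x = y"
  by (rule free_eqI[OF assms(1,2)]) (use assms in \<open>simp add: coord_def\<close>)

section \<open>Dimension shifting in the second argument\<close>

lemma ext_vanishes_free:
  fixes T :: "'j set"
  assumes "finite T" "\<And>n. d n \<in> Hom (Fr (S (Suc n))) (Fr (S n))" "ext_vanishes R S d RR i"
  shows "ext_vanishes R S d (Fr T) i"
proof (rule ext_vanishesI)
  fix f assume f: "f \<in> Hom (Fr (S (Suc i))) (Fr T)"
    and fz: "\<And>y. y \<in> carrier (Fr (S (Suc (Suc i)))) \<Longrightarrow> f (d (Suc i) y) = \<zero>\<^bsub>Fr T\<^esub>"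
  have "\<exists>g \<in> Hom (Fr (S i)) RR. \<forall>y \<in> carrier (Fr (S (Suc i))). coord T t (f y) = g (d i y)"
    if t: "t \<in> T" for t
  proof -
    have l: "(\<lambda>y\<in>carrier (Fr (S (Suc i))). coord T t (f y)) \<in> Hom (Fr (S (Suc i))) RR"
      by (rule lin_comp[OF free_module f coord_lin[OF t]])
    have "(\<lambda>y\<in>carrier (Fr (S (Suc i))). coord T t (f y)) (d (Suc i) y) = \<zero>\<^bsub>RR\<^esub>"
      if "y \<in> carrier (Fr (S (Suc (Suc i))))" for y
      using lin_closed[OF assms(2) that] fz[OF that] lin_zero[OF free_module regular_module coord_lin[OF t]]
      by simp
    then obtain g where "g \<in> Hom (Fr (S i)) RR"
      "\<And>y. y \<in> carrier (Fr (S (Suc i))) \<Longrightarrow> (\<lambda>y\<in>carrier (Fr (S (Suc i))). coord T t (f y)) y = g (d i y)"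
    using ext_vanishesD[OF assms(3) l] by blast
    then show ?thesis by (intro bexI[of _ g]) auto
  qed
  then obtain g where g: "\<And>t. t \<in> T \<Longrightarrow> g t \<in> Hom (Fr (S i)) RR"
     "\<And>t y. t \<in> T \<Longrightarrow> y \<in> carrier (Fr (S (Suc i))) \<Longrightarrow> coord T t (f y) = g t (d i y)"
    by metis
  show "\<exists>g \<in> Hom (Fr (S i)) (Fr T). \<forall>y \<in> carrier (Fr (S (Suc i))). f y = g (d i y)"
  proof (rule bexI[OF _ lin_tuple[OF free_module assms(1) g(1)]], rule ballI)
    fix y assume y: "y \<in> carrier (Fr (S (Suc i)))"
    note dy = lin_closed[OF assms(2) y]
    show "f y = (\<lambda>x\<in>carrier (Fr (S i)). \<lambda>s\<in>T. g s x) (d i y)"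
    proof (rule free_eqI[OF lin_closed[OF f y] lin_closed[OF lin_tuple[OF free_module assms(1) g(1)] dy]])
      fix t assume t: "t \<in> T"
      show "f y t = (\<lambda>x\<in>carrier (Fr (S i)). \<lambda>s\<in>T. g s x) (d i y) t"
        using g(2)[OF t y] t dy lin_closed[OF f y] by (simp add: coord_def)
    qed
  qed
qed

text \<open>The long exact sequence in the second argument: Ext of the kernel sits between Ext of
  the image one degree lower and Ext of \<open>B\<close> in the same degree.\<close>

lemma ext_vanishes_ker:
  fixes B :: "('a, 'b) module" and D :: "('a, 'c) module"
  assumes "module R B" "module R D" "p \<in> Hom B D"
    and d: "\<And>n. d n \<in> Hom (Fr (S (Suc n))) (Fr (S n))"
    and dd: "\<And>n y. y \<in> carrier (Fr (S (Suc (Suc n)))) \<Longrightarrow> d n (d (Suc n) y) = \<zero>\<^bsub>Fr (S n)\<^esub>"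
    and "ext_vanishes R S d (D\<lparr>carrier := p ` carrier B\<rparr>) i" "ext_vanishes R S d B (Suc i)"
  shows "ext_vanishes R S d (B\<lparr>carrier := {x \<in> carrier B. p x = \<zero>\<^bsub>D\<^esub>}\<rparr>) (Suc i)"
proof (rule ext_vanishesI)
  let ?K = "B\<lparr>carrier := {x \<in> carrier B. p x = \<zero>\<^bsub>D\<^esub>}\<rparr>"
  let ?X = "D\<lparr>carrier := p ` carrier B\<rparr>"
  let ?F = "\<lambda>j. Fr (S j)"
  have X: "module R ?X" by (rule submodule_module[OF assms(2) range_submodule[OF assms(1-3)]])
  interpret B: module R B by fact
  interpret D: module R D by fact
  have pX: "p \<in> Hom B ?X" by (rule lin_codomain[OF assms(3)]) auto
  fix f assume f: "f \<in> Hom (?F (Suc (Suc i))) ?K"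
    and fz: "\<And>y. y \<in> carrier (?F (Suc (Suc (Suc i)))) \<Longrightarrow> f (d (Suc (Suc i)) y) = \<zero>\<^bsub>?K\<^esub>"
  have fB: "f \<in> Hom (?F (Suc (Suc i))) B" by (rule lin_codomainD[OF f]) auto
  obtain g where g: "g \<in> Hom (?F (Suc i)) B" "\<And>y. y \<in> carrier (?F (Suc (Suc i))) \<Longrightarrow> f y = g (d (Suc i) y)"
    using ext_vanishesD[OF assms(7) fB] fz by auto
  let ?pg = "\<lambda>y\<in>carrier (?F (Suc i)). p (g y)"
  have pg: "?pg \<in> Hom (?F (Suc i)) ?X" by (rule lin_comp[OF free_module g(1) pX])
  have "?pg (d (Suc i) y) = \<zero>\<^bsub>?X\<^esub>" if "y \<in> carrier (?F (Suc (Suc i)))" for y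
    using lin_closed[OF d that] g(2)[OF that] lin_closed[OF f that] by simp
  then obtain h where h: "h \<in> Hom (?F i) ?X"
    "\<And>y. y \<in> carrier (?F (Suc i)) \<Longrightarrow> ?pg y = h (d i y)"
    using ext_vanishesD[OF assms(6) pg] by blast
  obtain h' where h': "h' \<in> Hom (?F i) B" "\<And>y. y \<in> carrier (?F i) \<Longrightarrow> p (h' y) = h y"
    using free_lift[OF X assms(1) h(1) pX] lin_closed[OF h(1)] by auto
  let ?hd = "\<lambda>y\<in>carrier (?F (Suc i)). h' (d i y)"
  have hd: "?hd \<in> Hom (?F (Suc i)) B" by (rule lin_comp[OF free_module d h'(1)])
  \<comment> \<open>The map \<open>g\<close> bounds \<open>f\<close> in \<open>B\<close> but may
    leave the kernel. Its image under \<open>p\<close> is a coboundary; lifting the bounding map to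
    \<open>B\<close> and subtracting its coboundary brings \<open>g\<close> into the kernel and
    leaves its values on boundaries unchanged.\<close>
  let ?u = "\<lambda>y\<in>carrier (?F (Suc i)). g y \<ominus>\<^bsub>B\<^esub> ?hd y"
  have uB: "?u \<in> Hom (?F (Suc i)) B" by (rule lin_diff[OF free_module assms(1) g(1) hd])
  have "?u \<in> Hom (?F (Suc i)) ?K"
  proof (rule lin_codomain[OF uB])
    fix y assume y: "y \<in> carrier (?F (Suc i))"
    have c: "g y \<in> carrier B" "h' (d i y) \<in> carrier B" "p (g y) \<in> carrier D"
      using lin_closed[OF g(1) y] lin_closed[OF h'(1) lin_closed[OF d y]] lin_closed[OF assms(3)] by auto
    have "p (g y \<ominus>\<^bsub>B\<^esub> h' (d i y)) = p (g y) \<ominus>\<^bsub>D\<^esub> p (h' (d i y))"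
      by (rule lin_minus[OF assms(1-3) c(1,2)])
    also have "p (h' (d i y)) = p (g y)" using h'(2)[OF lin_closed[OF d y]] h(2)[OF y] y by simp
    also have "p (g y) \<ominus>\<^bsub>D\<^esub> p (g y) = \<zero>\<^bsub>D\<^esub>" using c(3) by (simp add: a_minus_def D.M.r_neg)
    finally show "?u y \<in> {x \<in> carrier B. p x = \<zero>\<^bsub>D\<^esub>}" using y c by simp
  qed
  moreover have "f y = ?u (d (Suc i) y)" if y: "y \<in> carrier (?F (Suc (Suc i)))" for y
    using lin_closed[OF d y] dd[OF y] lin_zero[OF free_module assms(1) h'(1)] g(2)[OF y] lin_closed[OF fB y]
    by (simp add: a_minus_def)
  ultimately show "\<exists>g \<in> Hom (?F (Suc i)) ?K. \<forall>y \<in> carrier (?F (Suc (Suc i))). f y = g (d (Suc i) y)"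
    by blast
qed

text \<open>The neighbouring piece of the same long exact sequence: Ext of the image sits between
  Ext of \<open>B\<close> in the same degree and Ext of the kernel one degree higher.\<close>

lemma ext_vanishes_im:
  fixes B :: "('a, 'b) module" and D :: "('a, 'c) module"
  assumes "module R B" "module R D" "p \<in> Hom B D"
    and d: "\<And>n. d n \<in> Hom (Fr (S (Suc n))) (Fr (S n))"
    and dd: "\<And>n y. y \<in> carrier (Fr (S (Suc (Suc n)))) \<Longrightarrow> d n (d (Suc n) y) = \<zero>\<^bsub>Fr (S n)\<^esub>"
    and "ext_vanishes R S d (B\<lparr>carrier := {x \<in> carrier B. p x = \<zero>\<^bsub>D\<^esub>}\<rparr>) (Suc i)"
    and "ext_vanishes R S d B i"
  shows "ext_vanishes R S d (D\<lparr>carrier := p ` carrier B\<rparr>) i"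
proof (rule ext_vanishesI)
  let ?K = "B\<lparr>carrier := {x \<in> carrier B. p x = \<zero>\<^bsub>D\<^esub>}\<rparr>"
  let ?X = "D\<lparr>carrier := p ` carrier B\<rparr>"
  let ?F = "\<lambda>j. Fr (S j)"
  have X: "module R ?X" by (rule submodule_module[OF assms(2) range_submodule[OF assms(1-3)]])
  interpret B: module R B by fact
  interpret D: module R D by fact
  have pX: "p \<in> Hom B ?X" by (rule lin_codomain[OF assms(3)]) auto
  fix f assume f: "f \<in> Hom (?F (Suc i)) ?X"
    and fz: "\<And>y. y \<in> carrier (?F (Suc (Suc i))) \<Longrightarrow> f (d (Suc i) y) = \<zero>\<^bsub>?X\<^esub>"
  obtain f' where f': "f' \<in> Hom (?F (Suc i)) B" "\<And>y. y \<in> carrier (?F (Suc i)) \<Longrightarrow> p (f' y) = f y"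
    using free_lift[OF X assms(1) f pX] lin_closed[OF f] by auto
  let ?fd = "\<lambda>y\<in>carrier (?F (Suc (Suc i))). f' (d (Suc i) y)"
  have fdB: "?fd \<in> Hom (?F (Suc (Suc i))) B" by (rule lin_comp[OF free_module d f'(1)])
  have fd: "?fd \<in> Hom (?F (Suc (Suc i))) ?K"
  proof (rule lin_codomain[OF fdB])
    fix y assume y: "y \<in> carrier (?F (Suc (Suc i)))"
    show "?fd y \<in> {x \<in> carrier B. p x = \<zero>\<^bsub>D\<^esub>}"
      using f'(2)[OF lin_closed[OF d y]] fz[OF y] lin_closed[OF f'(1) lin_closed[OF d y]] y by simp
  qed
  have "?fd (d (Suc (Suc i)) y) = \<zero>\<^bsub>?K\<^esub>" if y: "y \<in> carrier (?F (Suc (Suc (Suc i))))" for y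
    using lin_closed[OF d y] dd[OF y] lin_zero[OF free_module assms(1) f'(1)] by simp
  then obtain g where g: "g \<in> Hom (?F (Suc i)) ?K"
    "\<And>y. y \<in> carrier (?F (Suc (Suc i))) \<Longrightarrow> ?fd y = g (d (Suc i) y)"
    using ext_vanishesD[OF assms(6) fd] by blast
  have gB: "g \<in> Hom (?F (Suc i)) B" by (rule lin_codomainD[OF g(1)]) auto
  let ?u = "\<lambda>y\<in>carrier (?F (Suc i)). f' y \<ominus>\<^bsub>B\<^esub> g y"
  have u: "?u \<in> Hom (?F (Suc i)) B" by (rule lin_diff[OF free_module assms(1) f'(1) gB])
  have "?u (d (Suc i) y) = \<zero>\<^bsub>B\<^esub>" if y: "y \<in> carrier (?F (Suc (Suc i)))" for y
    using lin_closed[OF d y] g(2)[OF y] y lin_closed[OF gB lin_closed[OF d y]]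
    by (simp add: a_minus_def B.M.r_neg)
  then obtain h where h: "h \<in> Hom (?F i) B"
    "\<And>y. y \<in> carrier (?F (Suc i)) \<Longrightarrow> ?u y = h (d i y)"
    using ext_vanishesD[OF assms(7) u] by blast
  have "f y = (\<lambda>y\<in>carrier (?F i). p (h y)) (d i y)" if y: "y \<in> carrier (?F (Suc i))" for y
  proof -
    have c: "f' y \<in> carrier B" "g y \<in> carrier B" "p (g y) = \<zero>\<^bsub>D\<^esub>" "f y \<in> carrier D"
      using lin_closed[OF f'(1) y] lin_closed[OF g(1) y] lin_closed[OF f y] lin_closed[OF assms(3)] by auto
    have "p (h (d i y)) = p (f' y \<ominus>\<^bsub>B\<^esub> g y)" using h(2)[OF y] y by simp
    also have "\<dots> = p (f' y) \<ominus>\<^bsub>D\<^esub> p (g y)" by (rule lin_minus[OF assms(1-3) c(1,2)])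
    also have "\<dots> = f y" using c f'(2)[OF y] by (simp add: a_minus_def)
    finally show ?thesis using lin_closed[OF d y] by simp
  qed
  then show "\<exists>g \<in> Hom (?F i) ?X. \<forall>y \<in> carrier (?F (Suc i)). f y = g (d i y)"
    using lin_comp[OF free_module h(1) pX] by blast
qed

section \<open>Extending a complex to the left\<close>

text \<open>A complex of finite free modules, exact together with its dual at every position
  \<open>Suc i\<close>. Position 0 is left open: a further term attached there has to supply both
  exactness conditions at the old end.\<close>

definition biexact :: "(nat \<Rightarrow> 'i set) \<Rightarrow> (nat \<Rightarrow> ('i \<Rightarrow> 'a) \<Rightarrow> 'i \<Rightarrow> 'a) \<Rightarrow> bool" where
  "biexact S d \<longleftrightarrow> (\<forall>i. finite (S i)) \<and> (\<forall>i. d i \<in> Hom (Fr (S (Suc i))) (Fr (S i))) \<and>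
     (\<forall>i. d (Suc i) ` carrier (Fr (S (Suc (Suc i)))) =
        {x \<in> carrier (Fr (S (Suc i))). d i x = \<zero>\<^bsub>Fr (S i)\<^esub>}) \<and>
     (\<forall>i. ext_vanishes R S d RR i)"

lemma biexactD:
  assumes "biexact S d"
  shows "finite (S i)" "d i \<in> Hom (Fr (S (Suc i))) (Fr (S i))"
    and "d (Suc i) ` carrier (Fr (S (Suc (Suc i)))) = {x \<in> carrier (Fr (S (Suc i))). d i x = \<zero>\<^bsub>Fr (S i)\<^esub>}"
    and "ext_vanishes R S d RR i"
    and "y \<in> carrier (Fr (S (Suc (Suc i)))) \<Longrightarrow> d i (d (Suc i) y) = \<zero>\<^bsub>Fr (S i)\<^esub>"
proof -
  show "finite (S i)" "d i \<in> Hom (Fr (S (Suc i))) (Fr (S i))"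
    "d (Suc i) ` carrier (Fr (S (Suc (Suc i)))) = {x \<in> carrier (Fr (S (Suc i))). d i x = \<zero>\<^bsub>Fr (S i)\<^esub>}"
    "ext_vanishes R S d RR i" using assms unfolding biexact_def by blast+
  then show "d i (d (Suc i) y) = \<zero>\<^bsub>Fr (S i)\<^esub>" if "y \<in> carrier (Fr (S (Suc (Suc i))))"
    using imageI[OF that, of "d (Suc i)"] by simp
qed

lemma syzygy_resolution:
  assumes "\<And>i. d i \<in> Hom (Fr (S (Suc i))) (Fr (S i))"
    and "\<And>i. d (Suc i) ` carrier (Fr (S (Suc (Suc i)))) =
       {x \<in> carrier (Fr (S (Suc i))). d i x = \<zero>\<^bsub>Fr (S i)\<^esub>}"
  shows "free_resolution R (Fr (S m)\<lparr>carrier := d m ` carrier (Fr (S (Suc m)))\<rparr>)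
     (\<lambda>i. S (i + Suc m)) (\<lambda>i. d (i + Suc m)) (d m)"
  unfolding free_resolution_def a_kernel_def' using assms lin_codomain[OF assms(1)] by simp

end

context gorenstein_base_ring
begin

text \<open>Evaluation at \<open>p\<close> is a functional on the dual of \<open>Fr (S 0)\<close>
  that kills the cocycles. By \<open>functional_factor\<close> for \<open>N = R\<close> it factors
  through the dual of \<open>Fr (S 1)\<close>, and by reflexivity of finite free modules the factor
  is evaluation at some vector, which \<open>d 0\<close> maps to \<open>p\<close>.\<close>

lemma torsionless:
  assumes "biexact S d" "p \<in> carrier (Fr (S 0))"
    and "\<And>u. u \<in> Hom (Fr (S 0)) RR \<Longrightarrow> (\<And>y. y \<in> carrier (Fr (S (Suc 0))) \<Longrightarrow> u (d 0 y) = \<zero>) \<Longrightarrow> u p = \<zero>"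
  shows "p \<in> d 0 ` carrier (Fr (S (Suc 0)))"
proof -
  note B = biexactD[OF assms(1)]
  let ?D = "hom_module R (Fr (S 0)) RR"
  have D: "module R ?D" by (rule hom_module[OF free_module regular_module])
  have \<phi>: "(\<lambda>u\<in>carrier ?D. u p) \<in> Hom ?D RR"
    by (rule lin_mapI[OF _ _ _ D]) (use assms(2) in \<open>auto simp: hom_simps lin_closed\<close>)
  have "\<exists>\<chi> \<in> Hom (hom_module R (Fr (S (Suc 0))) RR) RR. \<forall>u \<in> Hom (Fr (S 0)) RR.
      (\<lambda>u\<in>carrier ?D. u p) u = \<chi> (\<lambda>y\<in>carrier (Fr (S (Suc 0))). u (d 0 y))"
    by (rule functional_factor[where d = d and S = S, OF fg_regular ext_ring_vanishes_regular B(1,2) _ B(4) \<phi>])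
      (use B(5) assms(3) in \<open>auto simp: hom_simps regular_simps\<close>)
  then obtain \<chi> where \<chi>: "\<chi> \<in> Hom (hom_module R (Fr (S (Suc 0))) RR) RR"
    "\<And>u. u \<in> Hom (Fr (S 0)) RR \<Longrightarrow> u p = \<chi> (\<lambda>y\<in>carrier (Fr (S (Suc 0))). u (d 0 y))"
    by (auto simp: hom_simps)
  obtain g where g: "g \<in> Hom RR (Fr (S (Suc 0)))"
    "\<And>x \<theta>. x \<in> carrier RR \<Longrightarrow> \<theta> \<in> Hom (Fr (S (Suc 0))) RR \<Longrightarrow> \<theta> (g x) = \<chi> (scal (Fr (S (Suc 0))) RR \<theta> x)"
    using lin_from_functional[OF B(1) regular_module \<chi>(1)] by blast
  have 1: "\<one> \<in> carrier RR" by (simp add: regular_simps)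
  note g1 = lin_closed[OF g(1) 1]
  have "p = d 0 (g \<one>)"
  proof (rule free_eq_coordI[OF assms(2) lin_closed[OF B(2) g1]])
    fix s assume s: "s \<in> S 0"
    let ?\<theta> = "\<lambda>y\<in>carrier (Fr (S (Suc 0))). coord (S 0) s (d 0 y)"
    have \<theta>: "?\<theta> \<in> Hom (Fr (S (Suc 0))) RR" by (rule lin_comp[OF free_module B(2) coord_lin[OF s]])
    have "?\<theta> y \<in> carrier R" if "y \<in> carrier (Fr (S (Suc 0)))" for y
      using lin_closed[OF \<theta> that] by (simp add: regular_simps)
    then have "scal (Fr (S (Suc 0))) RR ?\<theta> \<one> = ?\<theta>"
      by (auto simp: scal_def regular_simps intro!: ext)
    then have "coord (S 0) s (d 0 (g \<one>)) = \<chi> ?\<theta>" using g(2)[OF 1 \<theta>] g1 by simp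
    then show "coord (S 0) s p = coord (S 0) s (d 0 (g \<one>))" using \<chi>(2)[OF coord_lin[OF s]] by simp
  qed
  then show ?thesis using g1 by blast
qed

text \<open>The new differential has as components finitely many generators of the functionals that kill the
  image of \<open>d 0\<close>.\<close>

lemma biexact_extend:
  fixes S :: "nat \<Rightarrow> 'i set"
  assumes "biexact S d" "infinite (UNIV :: 'i set)"
  shows "\<exists>S' d'. biexact S' d' \<and> (\<forall>i. S' (Suc i) = S i) \<and> (\<forall>i. d' (Suc i) = d i)"
proof -
  note B = biexactD[OF assms(1)]
  let ?D = "hom_module R (Fr (S 0)) RR"
  have D: "module R ?D" by (rule hom_module[OF free_module regular_module])
  define K where "K = {u \<in> carrier ?D. coboundary S d RR 0 u = \<zero>\<^bsub>hom_module R (Fr (S (Suc 0))) RR\<^esub>}"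
  have K: "submodule K R ?D" unfolding K_def
    by (rule kernel_submodule[OF D hom_module[OF free_module regular_module] coboundary_lin[where d = d, OF regular_module B(2)]])
  have Ki: "u \<in> K \<longleftrightarrow> u \<in> Hom (Fr (S 0)) RR \<and> (\<forall>y \<in> carrier (Fr (S (Suc 0))). u (d 0 y) = \<zero>\<^bsub>RR\<^esub>)" for u
    unfolding K_def using coboundary_eq_zero_iff[where d = d and S = S and n = 0 and f = u and N = RR]
    unfolding hom_simps(1) by blast
  obtain A where A: "finite A" "A \<subseteq> K" "\<forall>H. submodule H R ?D \<and> A \<subseteq> H \<longrightarrow> K \<subseteq> H"
    using fg_submoduleD[OF D K fg_submodule[OF fg_hom_free[OF B(1) fg_regular] K]]
    by (elim exE conjE) (rule that)
  obtain T :: "'i set" where T: "finite T" "card T = card A"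
    using infinite_arbitrarily_large[OF assms(2)] by blast
  obtain b where b: "bij_betw b T A" using A(1) T finite_same_card_bij by blast
  have bl: "b t \<in> Hom (Fr (S 0)) RR" if "t \<in> T" for t
    using b that A(2) Ki by (auto simp: bij_betw_def)
  define e where "e = (\<lambda>x\<in>carrier (Fr (S 0)). \<lambda>t\<in>T. b t x)"
  have e: "e \<in> Hom (Fr (S 0)) (Fr T)" unfolding e_def by (rule lin_tuple[OF free_module T(1) bl])
  have ez: "e x = \<zero>\<^bsub>Fr T\<^esub> \<longleftrightarrow> (\<forall>a \<in> A. a x = \<zero>\<^bsub>RR\<^esub>)" if "x \<in> carrier (Fr (S 0))" for x
    using that b by (auto simp: e_def free_simps regular_simps fun_eq_iff restrict_def bij_betw_def)
  \<comment> \<open>Exactness at the old end. A vector killed by the generators \<open>A\<close> is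
    killed by all of \<open>K\<close>, and \<open>torsionless\<close> puts it into the image of
    \<open>d 0\<close>.\<close>
  have exact: "d 0 ` carrier (Fr (S (Suc 0))) = {x \<in> carrier (Fr (S 0)). e x = \<zero>\<^bsub>Fr T\<^esub>}"
  proof
    show "d 0 ` carrier (Fr (S (Suc 0))) \<subseteq> {x \<in> carrier (Fr (S 0)). e x = \<zero>\<^bsub>Fr T\<^esub>}"
      using lin_closed[OF B(2)] ez A(2) Ki by fastforce
    show "{x \<in> carrier (Fr (S 0)). e x = \<zero>\<^bsub>Fr T\<^esub>} \<subseteq> d 0 ` carrier (Fr (S (Suc 0)))"
    proof
      fix p assume p: "p \<in> {x \<in> carrier (Fr (S 0)). e x = \<zero>\<^bsub>Fr T\<^esub>}"
      then have pc: "p \<in> carrier (Fr (S 0))" by simp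
      have "(\<lambda>u\<in>carrier ?D. u p) \<in> Hom ?D RR"
        by (rule lin_mapI[OF _ _ _ D]) (use pc in \<open>auto simp: hom_simps lin_closed\<close>)
      from kernel_submodule[OF D regular_module this]
      have sub: "submodule {u \<in> carrier ?D. (\<lambda>u\<in>carrier ?D. u p) u = \<zero>\<^bsub>RR\<^esub>} R ?D" .
      have "A \<subseteq> {u \<in> carrier ?D. (\<lambda>u\<in>carrier ?D. u p) u = \<zero>\<^bsub>RR\<^esub>}"
        using p ez A(2) Ki by (auto simp: hom_simps)
      with sub A(3) have KH: "K \<subseteq> {u \<in> carrier ?D. (\<lambda>u\<in>carrier ?D. u p) u = \<zero>\<^bsub>RR\<^esub>}" by blast
      show "p \<in> d 0 ` carrier (Fr (S (Suc 0)))"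
      proof (rule torsionless[OF assms(1) pc])
        fix u assume "u \<in> Hom (Fr (S 0)) RR" "\<And>y. y \<in> carrier (Fr (S (Suc 0))) \<Longrightarrow> u (d 0 y) = \<zero>"
        then have "u \<in> K" using Ki by (simp add: regular_simps)
        then show "u p = \<zero>" using KH by (auto simp: regular_simps)
      qed
    qed
  qed
  define S' where "S' = case_nat T S"
  define d' where "d' = case_nat e d"
  have S': "S' 0 = T" "S' (Suc i) = S i" for i by (simp_all add: S'_def)
  have d': "d' 0 = e" "d' (Suc i) = d i" for i by (simp_all add: d'_def)
  have lin: "d' i \<in> Hom (Fr (S' (Suc i))) (Fr (S' i))" for i
    by (cases i) (use e B(2) in \<open>auto simp: S' d'\<close>)
  \<comment> \<open>Dual exactness at the old end. A functional that kills the image of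
    \<open>d 0\<close> lies in \<open>K\<close>, and each generator \<open>b t\<close> of
    \<open>K\<close> is the coordinate \<open>t\<close> composed with the new differential.\<close>
  have ev: "ext_vanishes R S' d' RR 0"
  proof (rule ext_vanishesI)
    fix f assume "f \<in> Hom (Fr (S' (Suc 0))) RR"
      and "\<And>y. y \<in> carrier (Fr (S' (Suc (Suc 0)))) \<Longrightarrow> f (d' (Suc 0) y) = \<zero>\<^bsub>RR\<^esub>"
    then have fK: "f \<in> K" using Ki by (simp add: S' d')
    let ?H = "coboundary S' d' RR 0 ` carrier (hom_module R (Fr T) RR)"
    have cl: "coboundary S' d' RR 0 \<in> Hom (hom_module R (Fr T) RR) ?D"
      using coboundary_lin[where d = d' and S = S' and n = 0, OF regular_module lin] by (simp add: S')
    have H: "submodule ?H R ?D"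
      by (rule range_submodule[OF hom_module[OF free_module regular_module] D cl])
    have "a \<in> ?H" if "a \<in> A" for a
    proof -
      obtain t where t: "t \<in> T" "a = b t" using b \<open>a \<in> A\<close> by (auto simp: bij_betw_def)
      have "b t = coboundary S' d' RR 0 (coord T t)"
      proof (rule lin_eqI[OF bl[OF t(1)]])
        have c: "coord T t \<in> carrier (hom_module R (Fr T) RR)" using coord_lin[OF t(1)] by (simp add: hom_simps)
        show "coboundary S' d' RR 0 (coord T t) \<in> Hom (Fr (S 0)) RR"
          using lin_closed[OF cl c] by (simp add: hom_simps)
        show "b t x = coboundary S' d' RR 0 (coord T t) x" if "x \<in> carrier (Fr (S 0))" for x
          using that t(1) coord_lin[OF t(1)] lin_closed[OF e that]
          by (simp add: coboundary_def S' d' coord_def e_def)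
      qed
      then show ?thesis using t coord_lin[OF t(1)] by (auto simp: hom_simps)
    qed
    then have "K \<subseteq> ?H" using A(3) H by blast
    then obtain g where "g \<in> Hom (Fr T) RR" "f = coboundary S' d' RR 0 g"
      using fK by (auto simp: hom_simps)
    then show "\<exists>g \<in> Hom (Fr (S' 0)) RR. \<forall>y \<in> carrier (Fr (S' (Suc 0))). f y = g (d' 0 y)"
      by (intro bexI[of _ g]) (auto simp: coboundary_def S')
  qed
  have "biexact S' d'"
    unfolding biexact_def
  proof (intro conjI allI)
    fix i
    show "finite (S' i)" by (cases i) (auto simp: S' T(1) B(1))
    show "d' i \<in> Hom (Fr (S' (Suc i))) (Fr (S' i))" by (rule lin)
    show "d' (Suc i) ` carrier (Fr (S' (Suc (Suc i)))) = {x \<in> carrier (Fr (S' (Suc i))). d' i x = \<zero>\<^bsub>Fr (S' i)\<^esub>}"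
      by (cases i) (use exact B(3) in \<open>auto simp: S' d'\<close>)
    show "ext_vanishes R S' d' RR i"
    proof (cases i)
      case 0
      then show ?thesis using ev by simp
    next
      case (Suc k)
      then show ?thesis using B(4)[of k] by (simp add: ext_vanishes_def S' d')
    qed
  qed
  then show ?thesis using S'(2) d'(2) by blast
qed

lemma biexact_extend_iterated:
  fixes S :: "nat \<Rightarrow> 'i set"
  assumes "biexact S d" "infinite (UNIV :: 'i set)"
  shows "\<exists>S' d'. biexact S' d' \<and> (\<forall>i. S' (i + m) = S i) \<and> (\<forall>i. d' (i + m) = d i)"
proof (induction m)
  case 0
  then show ?case using assms(1) by auto
next
  case (Suc m)
  then obtain S' d' where 1: "biexact S' d'" "\<forall>i. S' (i + m) = S i" "\<forall>i. d' (i + m) = d i" by blast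
  from biexact_extend[OF 1(1) assms(2)] obtain S'' d'' where
    "biexact S'' d''" "\<forall>i. S'' (Suc i) = S' i" "\<forall>i. d'' (Suc i) = d' i" by blast
  with 1 show ?case by (intro exI[of _ S''] exI[of _ d'']) simp
qed

section \<open>Exactness of Hom(N, -) on a biexact complex\<close>

text \<open>A map \<open>f : N \<rightarrow> Fr S\<close> is the same as a functional on \<open>Hom(Fr S, N)\<close>, so this is the dual of the
  exactness of \<open>Hom(d, N)\<close>.\<close>

lemma hom_exact:
  fixes N :: "('a, 'n) module" and S :: "nat \<Rightarrow> 'i set"
  assumes "fg_module R N" "\<And>j. ext_ring_vanishes N j" "biexact S d"
    and ev: "\<And>k. k \<ge> i \<Longrightarrow> ext_vanishes R S d N k"
    and f: "f \<in> Hom N (Fr (S (Suc i)))"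
    and fz: "\<And>x. x \<in> carrier N \<Longrightarrow> d i (f x) = \<zero>\<^bsub>Fr (S i)\<^esub>"
  shows "\<exists>g \<in> Hom N (Fr (S (Suc (Suc i)))). \<forall>x \<in> carrier N. f x = d (Suc i) (g x)"
proof -
  note N = fg_moduleD[OF assms(1)] and B = biexactD[OF assms(3)]
  let ?F = "\<lambda>j. Fr (S j)"
  have C: "module R (hom_module R (?F k) N)" for k by (rule hom_module[OF free_module N])
  obtain \<phi> where \<phi>: "\<phi> \<in> Hom (hom_module R (?F (Suc i)) N) RR"
    "\<And>x \<theta>. x \<in> carrier N \<Longrightarrow> \<theta> \<in> Hom (?F (Suc i)) RR \<Longrightarrow> \<phi> (scal (?F (Suc i)) N \<theta> x) = \<theta> (f x)"
    using functional_from_lin[OF B(1) N f] by blast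
  \<comment> \<open>Naturality of \<open>scal\<close>: pulling back along a differential acts on the
    functional alone.\<close>
  have pull: "(\<lambda>y\<in>carrier (?F (Suc k)). scal (?F k) N \<theta> x (d k y)) =
      scal (?F (Suc k)) N (\<lambda>y\<in>carrier (?F (Suc k)). \<theta> (d k y)) x" for k x \<theta>
    using lin_closed[OF B(2)] by (auto simp: scal_def intro!: ext)
  \<comment> \<open>The condition that \<open>d i\<close> after \<open>f\<close> is zero, read on
    the functional that corresponds to \<open>f\<close>; by linearity it is checked on the
    generators of Hom(Fr (S i), N).\<close>
  have \<phi>d: "\<phi> (coboundary S d N i u) = \<zero>\<^bsub>RR\<^esub>" if u: "u \<in> Hom (?F i) N" for u
  proof -
    have l: "(\<lambda>u\<in>carrier (hom_module R (?F i) N). \<phi> (coboundary S d N i u)) \<in> Hom (hom_module R (?F i) N) RR"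
      by (rule lin_comp[OF C coboundary_lin[where d = d, OF N B(2)] \<phi>(1)])
    have "(\<lambda>u\<in>carrier (hom_module R (?F i) N). \<phi> (coboundary S d N i u)) u =
        (\<lambda>u\<in>carrier (hom_module R (?F i) N). \<zero>\<^bsub>RR\<^esub>) u"
    proof (rule hom_free_ext[OF B(1) N regular_module l lin_zero_map[OF C regular_module] _ u])
      fix s x assume s: "s \<in> S i" and x: "x \<in> carrier N"
      note sc = scal_closed[OF free_module N coord_lin[OF s] x]
      have "\<phi> (coboundary S d N i (scal (?F i) N (coord (S i) s) x)) =
         \<phi> (scal (?F (Suc i)) N (\<lambda>y\<in>carrier (?F (Suc i)). coord (S i) s (d i y)) x)"
        using sc pull[of i "coord (S i) s" x] by (simp add: coboundary_def)
      also have "\<dots> = (\<lambda>y\<in>carrier (?F (Suc i)). coord (S i) s (d i y)) (f x)"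
        by (rule \<phi>(2)[OF x lin_comp[OF free_module B(2) coord_lin[OF s]]])
      also have "\<dots> = \<zero>\<^bsub>RR\<^esub>"
        using lin_closed[OF f x] fz[OF x] lin_zero[OF free_module regular_module coord_lin[OF s]] by simp
      finally show "(\<lambda>u\<in>carrier (hom_module R (?F i) N). \<phi> (coboundary S d N i u)) (scal (?F i) N (coord (S i) s) x) =
        (\<lambda>u\<in>carrier (hom_module R (?F i) N). \<zero>\<^bsub>RR\<^esub>) (scal (?F i) N (coord (S i) s) x)"
        using sc by (simp add: hom_simps)
    qed
    then show ?thesis using u by (simp add: hom_simps)
  qed
  \<comment> \<open>Cocycles at position \<open>Suc i\<close> are coboundaries by \<open>ev\<close>
    at \<open>i\<close> itself. So \<open>\<phi>\<close> kills all cocycles, and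
    \<open>functional_factor\<close> applies one position further, at \<open>Suc i\<close>.\<close>
  have \<phi>z: "\<phi> u = \<zero>" if u: "u \<in> Hom (?F (Suc i)) N"
    and uz: "\<And>y. y \<in> carrier (?F (Suc (Suc i))) \<Longrightarrow> u (d (Suc i) y) = \<zero>\<^bsub>N\<^esub>" for u
  proof -
    obtain v where v: "v \<in> Hom (?F i) N" "\<And>y. y \<in> carrier (?F (Suc i)) \<Longrightarrow> u y = v (d i y)"
      using ext_vanishesD[OF ev[OF order_refl] u uz] by blast
    then have "u = coboundary S d N i v"
      using coboundary_eq_iff[where d = d and S = S and n = i, OF u v(1) B(2)] by blast
    then show ?thesis using \<phi>d[OF v(1)] by (simp add: regular_simps)
  qed
  have ev': "ext_vanishes R S d N k" if "Suc i \<le> k" for k using ev that by simp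
  have "\<exists>\<chi> \<in> Hom (hom_module R (?F (Suc (Suc i))) N) RR.
     \<forall>u \<in> Hom (?F (Suc i)) N. \<phi> u = \<chi> (\<lambda>y\<in>carrier (?F (Suc (Suc i))). u (d (Suc i) y))"
    by (rule functional_factor[where d = d and S = S, OF assms(1,2) B(1,2,5) ev' \<phi>(1) \<phi>z])
  then obtain \<chi> where \<chi>: "\<chi> \<in> Hom (hom_module R (?F (Suc (Suc i))) N) RR"
     "\<And>u. u \<in> Hom (?F (Suc i)) N \<Longrightarrow> \<phi> u = \<chi> (\<lambda>y\<in>carrier (?F (Suc (Suc i))). u (d (Suc i) y))" by blast
  obtain g where g: "g \<in> Hom N (?F (Suc (Suc i)))"
    "\<And>x \<theta>. x \<in> carrier N \<Longrightarrow> \<theta> \<in> Hom (?F (Suc (Suc i))) RR \<Longrightarrow>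
        \<theta> (g x) = \<chi> (scal (?F (Suc (Suc i))) N \<theta> x)"
    using lin_from_functional[OF B(1) N \<chi>(1)] by blast
  have "f x = d (Suc i) (g x)" if x: "x \<in> carrier N" for x
  proof (rule free_eq_coordI[OF lin_closed[OF f x] lin_closed[OF B(2) lin_closed[OF g(1) x]]])
    fix s assume s: "s \<in> S (Suc i)"
    let ?\<theta> = "\<lambda>y\<in>carrier (?F (Suc (Suc i))). coord (S (Suc i)) s (d (Suc i) y)"
    have "coord (S (Suc i)) s (d (Suc i) (g x)) = ?\<theta> (g x)" using lin_closed[OF g(1) x] by simp
    also have "\<dots> = \<chi> (scal (?F (Suc (Suc i))) N ?\<theta> x)"
      by (rule g(2)[OF x lin_comp[OF free_module B(2) coord_lin[OF s]]])
    also have "\<dots> = \<phi> (scal (?F (Suc i)) N (coord (S (Suc i)) s) x)"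
      using \<chi>(2)[OF scal_closed[OF free_module N coord_lin[OF s] x]] pull[of "Suc i"] by simp
    also have "\<dots> = coord (S (Suc i)) s (f x)" by (rule \<phi>(2)[OF x coord_lin[OF s]])
    finally show "coord (S (Suc i)) s (f x) = coord (S (Suc i)) s (d (Suc i) (g x))" by simp
  qed
  then show ?thesis using g(1) by blast
qed

text \<open>Each passage to a kernel raises the degree by one, and reaching the image of
  \<open>q k\<close> takes \<open>Suc k\<close> passages, the first of them through the
  augmentation. Vanishing into \<open>R\<close> takes care of the free middle terms.\<close>

lemma ext_vanishes_syzygyI:
  fixes N :: "('a, 'n) module" and S :: "nat \<Rightarrow> 'i set" and T :: "nat \<Rightarrow> 'j set"
  assumes T: "free_resolution R N T q e" "module R N" "\<And>k. finite (T k)"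
    and d: "\<And>n. d n \<in> Hom (Fr (S (Suc n))) (Fr (S n))"
    and dd: "\<And>n y. y \<in> carrier (Fr (S (Suc (Suc n)))) \<Longrightarrow> d n (d (Suc n) y) = \<zero>\<^bsub>Fr (S n)\<^esub>"
    and dual: "\<And>i. i \<ge> a \<Longrightarrow> ext_vanishes R S d RR i"
    and N: "\<And>i. i \<ge> a \<Longrightarrow> ext_vanishes R S d N i"
    and "i \<ge> a + Suc k"
  shows "ext_vanishes R S d (im_mod (Fr (T (Suc k))) (Fr (T k)) (q k)) i"
  using assms(8)
proof (induction k arbitrary: i)
  note D = free_resolutionD[OF T(1)] and E = free_resolution_exact[OF T(1)]
  case 0
  then obtain i' where i: "i = Suc i'" "a \<le> i'" by (cases i) auto
  have "ext_vanishes R S d (im_mod (Fr (T 0)) N e) i'" using N[OF i(2)] D(3) by simp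
  moreover have "ext_vanishes R S d (Fr (T 0)) (Suc i')"
    by (rule ext_vanishes_free[where d = d and S = S, OF T(3) d]) (use dual i in simp)
  ultimately have "ext_vanishes R S d (ker_mod (Fr (T 0)) N e) (Suc i')"
    using ext_vanishes_ker[where d = d and S = S, OF free_module T(2) D(1) d dd] by blast
  then show ?case unfolding i(1) E(1) .
next
  note D = free_resolutionD[OF T(1)] and E = free_resolution_exact[OF T(1)]
  case (Suc k)
  then obtain i' where i: "i = Suc i'" "a + Suc k \<le> i'" by (cases i) auto
  have "ext_vanishes R S d (Fr (T (Suc k))) (Suc i')"
    by (rule ext_vanishes_free[where d = d and S = S, OF T(3) d]) (use dual i in simp)
  with Suc.IH[OF i(2)] have "ext_vanishes R S d (ker_mod (Fr (T (Suc k))) (Fr (T k)) (q k)) (Suc i')"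
    using ext_vanishes_ker[where d = d and S = S, OF free_module free_module D(2) d dd] by blast
  then show ?case unfolding i(1) E(2) .
qed

text \<open>In the return direction each step consumes the syzygy in degree \<open>Suc i\<close> to
  reach degree \<open>i\<close>. As vanishing is assumed from \<open>a\<close> on, the threshold
  \<open>a\<close> survives every step.\<close>

lemma ext_vanishes_syzygyD:
  fixes N :: "('a, 'n) module" and S :: "nat \<Rightarrow> 'i set" and T :: "nat \<Rightarrow> 'j set"
  assumes T: "free_resolution R N T q e" "module R N" "\<And>k. finite (T k)"
    and d: "\<And>n. d n \<in> Hom (Fr (S (Suc n))) (Fr (S n))"
    and dd: "\<And>n y. y \<in> carrier (Fr (S (Suc (Suc n)))) \<Longrightarrow> d n (d (Suc n) y) = \<zero>\<^bsub>Fr (S n)\<^esub>"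
    and dual: "\<And>i. i \<ge> a \<Longrightarrow> ext_vanishes R S d RR i"
    and "\<And>i. i \<ge> a \<Longrightarrow> ext_vanishes R S d (im_mod (Fr (T (Suc k))) (Fr (T k)) (q k)) i"
    and "i \<ge> a"
  shows "ext_vanishes R S d N i"
proof -
  note D = free_resolutionD[OF T(1)] and E = free_resolution_exact[OF T(1)]
  have F: "ext_vanishes R S d (Fr (T k)) i" if "i \<ge> a" for k i
    by (rule ext_vanishes_free[where d = d and S = S, OF T(3) d dual[OF that]])
  have K0: "\<forall>i\<ge>a. ext_vanishes R S d (im_mod (Fr (T (Suc 0))) (Fr (T 0)) (q 0)) i"
    using assms(7)
  proof (induction k)
    case 0
    then show ?case by blast
  next
    case (Suc k)
    show ?case
    proof (rule Suc.IH)
      fix i assume i: "i \<ge> a"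
      have "ext_vanishes R S d (ker_mod (Fr (T (Suc k))) (Fr (T k)) (q k)) (Suc i)"
        using Suc.prems[of "Suc i"] i unfolding E(2) by simp
      then show "ext_vanishes R S d (im_mod (Fr (T (Suc k))) (Fr (T k)) (q k)) i"
        using ext_vanishes_im[where S = S and d = d, OF free_module free_module D(2) d dd _ F[OF i]] by blast
    qed
  qed
  have "ext_vanishes R S d (ker_mod (Fr (T 0)) N e) (Suc i)"
    using K0 assms(8) unfolding E(1) by simp
  then have "ext_vanishes R S d (im_mod (Fr (T 0)) N e) i"
    using ext_vanishes_im[where S = S and d = d, OF free_module T(2) D(1) d dd _ F[OF assms(8)]] by blast
  then show ?thesis using D(3) by simp
qed

text \<open>Let X be the image, that is, the kernel of \<open>d (Suc i)\<close>. A cocycle with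
  values in X is bounded in the free module around X, because Ext^1(N, R) = 0. Composing the
  bounding map with \<open>d (Suc i)\<close> gives a map that descends to \<open>N\<close> and is
  killed by \<open>d i\<close>; \<open>hom_exact\<close> lifts it, and subtracting the lift moves
  the bounding map into X.\<close>

lemma ext_vanishes_cosyzygy:
  fixes N :: "('a, 'n) module" and S :: "nat \<Rightarrow> 'i set" and T :: "nat \<Rightarrow> 'j set"
  assumes "fg_module R N" "\<And>j. ext_ring_vanishes N j" "free_resolution R N T q e"
    and dual: "ext_vanishes R T q RR 0"
    and "biexact S d" and ev: "\<And>k. k \<ge> i \<Longrightarrow> ext_vanishes R S d N k"
  shows "ext_vanishes R T q (im_mod (Fr (S (Suc (Suc (Suc i))))) (Fr (S (Suc (Suc i)))) (d (Suc (Suc i)))) 0"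
proof (rule ext_vanishesI)
  note N = fg_moduleD[OF assms(1)] and B = biexactD[OF assms(5)]
  note D = free_resolutionD[OF assms(3)]
  let ?F = "\<lambda>j. Fr (S j)"
  let ?i = "Suc (Suc i)"
  let ?X = "im_mod (?F (Suc ?i)) (?F ?i) (d ?i)"
  interpret F: module R "?F ?i" by (rule free_module)
  interpret F1: module R "?F (Suc i)" by (rule free_module)
  have Xsub: "carrier ?X \<subseteq> carrier (?F ?i)" using lin_closed[OF B(2)] by auto
  fix f assume f: "f \<in> Hom (Fr (T (Suc 0))) ?X"
    and fz: "\<And>y. y \<in> carrier (Fr (T (Suc (Suc 0)))) \<Longrightarrow> f (q (Suc 0) y) = \<zero>\<^bsub>?X\<^esub>"
  have fF: "f \<in> Hom (Fr (T (Suc 0))) (?F ?i)"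
    by (rule lin_codomainD[OF f]) (use Xsub in simp)
  have dualF: "ext_vanishes R T q (?F ?i) 0" by (rule ext_vanishes_free[where d = q and S = T, OF B(1) D(2) dual])
  obtain g where g: "g \<in> Hom (Fr (T 0)) (?F ?i)"
      "\<And>y. y \<in> carrier (Fr (T (Suc 0))) \<Longrightarrow> f y = g (q 0 y)"
    using ext_vanishesD[OF dualF fF] fz by auto
  let ?dg = "\<lambda>y\<in>carrier (Fr (T 0)). d (Suc i) (g y)"
  have dg: "?dg \<in> Hom (Fr (T 0)) (?F (Suc i))" by (rule lin_comp[OF free_module g(1) B(2)])
  have df: "d (Suc i) (f y) = \<zero>\<^bsub>?F (Suc i)\<^esub>" if "y \<in> carrier (Fr (T (Suc 0)))" for y
    using lin_closed[OF f that] B(5) by auto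
  have "?dg x = \<zero>\<^bsub>?F (Suc i)\<^esub>" if "x \<in> carrier (Fr (T 0))" "e x = \<zero>\<^bsub>N\<^esub>" for x
    using D(6)[OF that] that(1) df g(2) by auto
  then have "\<exists>h \<in> Hom (im_mod (Fr (T 0)) N e) (?F (Suc i)). \<forall>x \<in> carrier (Fr (T 0)). h (e x) = ?dg x"
    by (rule lin_factor[OF free_module N free_module D(1) dg])
  then obtain h where h: "h \<in> Hom N (?F (Suc i))"
     "\<And>x. x \<in> carrier (Fr (T 0)) \<Longrightarrow> h (e x) = d (Suc i) (g x)"
    using D(3) by auto
  have "d i (h x) = \<zero>\<^bsub>?F i\<^esub>" if "x \<in> carrier N" for x
  proof -
    obtain y where y: "y \<in> carrier (Fr (T 0))" "x = e y" using \<open>x \<in> carrier N\<close> D(3) by (metis imageE)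
    then show ?thesis using h(2)[OF y(1)] B(5)[OF lin_closed[OF g(1) y(1)]] by simp
  qed
  then have "\<exists>g \<in> Hom N (?F ?i). \<forall>x \<in> carrier N. h x = d (Suc i) (g x)"
    by (intro hom_exact[OF assms(1,2,5) ev h(1)])
  then obtain h' where h': "h' \<in> Hom N (?F ?i)" "\<And>x. x \<in> carrier N \<Longrightarrow> h x = d (Suc i) (h' x)" by blast
  let ?he = "\<lambda>y\<in>carrier (Fr (T 0)). h' (e y)"
  have he: "?he \<in> Hom (Fr (T 0)) (?F ?i)" by (rule lin_comp[OF free_module D(1) h'(1)])
  let ?u = "\<lambda>y\<in>carrier (Fr (T 0)). g y \<ominus>\<^bsub>?F ?i\<^esub> ?he y"
  have u: "?u \<in> Hom (Fr (T 0)) (?F ?i)" by (rule lin_diff[OF free_module free_module g(1) he])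
  have "?u \<in> Hom (Fr (T 0)) ?X"
  proof (rule lin_codomain[OF u])
    fix y assume y: "y \<in> carrier (Fr (T 0))"
    have c: "g y \<in> carrier (?F ?i)" "h' (e y) \<in> carrier (?F ?i)"
      using lin_closed[OF g(1) y] lin_closed[OF h'(1) lin_closed[OF D(1) y]] .
    have "d (Suc i) (g y \<ominus>\<^bsub>?F ?i\<^esub> h' (e y)) = d (Suc i) (g y) \<ominus>\<^bsub>?F (Suc i)\<^esub> d (Suc i) (h' (e y))"
      by (rule lin_minus[OF free_module free_module B(2) c])
    also have "d (Suc i) (h' (e y)) = d (Suc i) (g y)"
      using h(2)[OF y] h'(2)[OF lin_closed[OF D(1) y]] by simp
    also have "d (Suc i) (g y) \<ominus>\<^bsub>?F (Suc i)\<^esub> d (Suc i) (g y) = \<zero>\<^bsub>?F (Suc i)\<^esub>"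
      using lin_closed[OF B(2) c(1)] by (simp add: a_minus_def F1.M.r_neg)
    finally show "?u y \<in> d ?i ` carrier (?F (Suc ?i))" using B(3)[of "Suc i"] y c by simp
  qed
  moreover have "f y = ?u (q 0 y)" if y: "y \<in> carrier (Fr (T (Suc 0)))" for y
    using lin_closed[OF D(2) y] D(4)[OF y] lin_zero[OF N free_module h'(1)] g(2)[OF y] lin_closed[OF fF y]
    by (simp add: a_minus_def)
  ultimately show "\<exists>g \<in> Hom (Fr (T 0)) ?X. \<forall>y \<in> carrier (Fr (T (Suc 0))). f y = g (q 0 y)"
    by blast
qed

section \<open>Symmetry of eventual Ext vanishing\<close>

lemma ext_eventually_zero_swap:
  fixes M :: "('a, 'm) module" and N :: "('a, 'n) module"
  assumes b: "ext_index R \<le> enat b" and M: "fg_module R M" and N: "fg_module R N"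
    and zero: "ext_eventually_zero R M N"
  shows "ext_eventually_zero R N M"
proof -
  note mM = fg_moduleD[OF M] and mN = fg_moduleD[OF N]
  obtain S :: "nat \<Rightarrow> nat set" and d e where S: "free_resolution R M S d e" "\<And>k. finite (S k)"
    using fg_resolution_exists[OF M, where 'i = nat] by auto
  obtain T :: "nat \<Rightarrow> nat set" and q \<epsilon> where T: "free_resolution R N T q \<epsilon>" "\<And>k. finite (T k)"
    using fg_resolution_exists[OF N, where 'i = nat] by auto
  note DS = free_resolutionD[OF S(1)] and ES = free_resolution_exact[OF S(1)]
  note DT = free_resolutionD[OF T(1)] and ET = free_resolution_exact[OF T(1)]
  have dualS: "ext_vanishes R S d RR i" if "n < i" for i
    by (rule dual_exact[where d = d and S = S, OF S(2) DS(2) ES(2) that])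
  have dualT: "ext_vanishes R T q RR i" if "n < i" for i
    by (rule dual_exact[where d = q and S = T, OF T(2) DT(2) ET(2) that])

  \<comment> \<open>The syzygy of order \<open>n + 1\<close>, far enough for all Ext into
    \<open>R\<close> to vanish in positive degrees, in both the injective and the free
    computation.\<close>
  define N1 where "N1 = im_mod (Fr (T (Suc n))) (Fr (T n)) (q n)"
  have N1: "fg_module R N1" unfolding N1_def by (rule fg_image[OF fg_free[OF T(2)] free_module DT(2)])
  have VN1: "ext_ring_vanishes N1 j" for j
    unfolding N1_def by (rule ext_ring_vanishes_syzygy[where d = q and S = T, OF T(2) DT(2) ET(2)]) simp
  define T1 where "T1 i = T (i + Suc n)" for i
  define q1 where "q1 i = q (i + Suc n)" for i
  have T1: "free_resolution R N1 T1 q1 (q n)"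
    unfolding N1_def T1_def q1_def using syzygy_resolution[where d = q and S = T, OF DT(2) ET(2)] .
  note D1 = free_resolutionD[OF T1]
  have T1_shift: "ext_vanishes R T1 q1 X i \<longleftrightarrow> ext_vanishes R T q X (i + Suc n)"
    for X :: "('a, nat \<Rightarrow> 'a) module" and i
    by (simp add: ext_vanishes_def T1_def q1_def)
  have dual1: "ext_vanishes R T1 q1 RR i" for i
    using dualT[of "i + Suc n"] by (simp add: ext_vanishes_def T1_def q1_def)

  obtain i1 where i1: "\<And>i. i \<ge> i1 \<Longrightarrow> ext_vanishes R S d N i"
    using zero ext_eventually_zero_iff[OF S(1) M mN] by blast
  \<comment> \<open>The first \<open>i1 + Suc n\<close> lies beyond the thresholds for
    \<open>N\<close> and for \<open>R\<close>; the second \<open>Suc n\<close> pays for the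
    \<open>n + 1\<close> kernel steps from \<open>N\<close> to \<open>N1\<close>.\<close>
  have SN1: "ext_vanishes R S d N1 i" if "i \<ge> i1 + Suc n + Suc n" for i
    unfolding N1_def
    by (rule ext_vanishes_syzygyI[where S = S and d = d and a = "i1 + Suc n", OF T(1) mN T(2) DS(2,5)])
      (use dualS i1 that in auto)

  \<comment> \<open>Dual exactness of the resolution of \<open>M\<close> is known from index
    \<open>n + 1\<close> on, so the truncation there is biexact and can be extended.\<close>
  define S0 where "S0 i = S (i + Suc n)" for i
  define d0 where "d0 i = d (i + Suc n)" for i
  have "biexact S0 d0"
    unfolding biexact_def S0_def d0_def
  proof (intro conjI allI)
    show "ext_vanishes R (\<lambda>i. S (i + Suc n)) (\<lambda>i. d (i + Suc n)) RR i" for i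
      using dualS[of "i + Suc n"] by (simp add: ext_vanishes_def)
  qed (use S(2) DS(2) ES(2) in auto)
  note ext0 = biexact_extend_iterated[OF this infinite_UNIV_nat]

  have MT: "ext_vanishes R T1 q1 (im_mod (Fr (S (Suc (Suc n)))) (Fr (S (Suc n))) (d (Suc n))) j" for j
  proof -
    \<comment> \<open>The syzygy at position \<open>b + 3\<close> is the first for which Ext^1(N1,
      -) = 0 will be known, and \<open>j\<close> more positions allow \<open>j\<close> dimension
      shifts. After \<open>m\<close> new terms the old complex begins at index \<open>m\<close>, so
      the image of \<open>d' m\<close> is the syzygy of \<open>M\<close> in the claim.\<close>
    define m where "m = j + Suc (Suc (Suc b))"
    obtain S' d' where S': "biexact S' d'" "\<And>i. S' (i + m) = S0 i" "\<And>i. d' (i + m) = d0 i"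
      using ext0[of m] by blast
    note B = biexactD[OF S'(1)]
    define M1 where "M1 = im_mod (Fr (S' (Suc 0))) (Fr (S' 0)) (d' 0)"
    have M1: "fg_module R M1" unfolding M1_def by (rule fg_image[OF fg_free[OF B(1)] free_module B(2)])
    have rM1: "free_resolution R M1 (\<lambda>i. S' (Suc i)) (\<lambda>i. d' (Suc i)) (d' 0)"
      unfolding M1_def using syzygy_resolution[where d = d' and S = S' and m = 0, OF B(2,3)] by simp
    have sh: "ext_vanishes R (\<lambda>i. S' (Suc i)) (\<lambda>i. d' (Suc i)) N1 i \<longleftrightarrow> ext_vanishes R S' d' N1 (Suc i)" for i
      by (simp add: ext_vanishes_def)
    \<comment> \<open>From index \<open>m\<close> on the extended complex is the old one, so
      eventual vanishing carries over although its threshold now grows with \<open>m\<close>. The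
      Ext-index replaces that threshold by \<open>b\<close>.\<close>
    have shm: "ext_vanishes R S' d' N1 (i + m) \<longleftrightarrow> ext_vanishes R S d N1 (i + Suc n)" for i
      using S'(2)[of i] S'(2)[of "Suc i"] S'(2)[of "Suc (Suc i)"] S'(3)[of i] S'(3)[of "Suc i"]
      by (simp add: ext_vanishes_def S0_def d0_def)
    have "ext_vanishes R S' d' N1 (Suc i)" if "i \<ge> i1 + Suc n + Suc n + m" for i
      using shm[of "Suc i - m"] SN1[of "Suc i - m + Suc n"] that by simp
    then have "ext_eventually_zero R M1 N1"
      using ext_eventually_zero_iff[OF rM1 M1 fg_moduleD[OF N1]] sh by blast
    then have "ext_vanishes R S' d' N1 (Suc i)" if "i \<ge> b" for i
      using ext_index_bound[OF b M1 N1 _ rM1 that] sh by simp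
    \<comment> \<open>The resolution of \<open>M1\<close> starts at position 1 of the extended
      complex, so the bound \<open>b\<close> becomes \<open>Suc b\<close>.\<close>
    then have ev: "ext_vanishes R S' d' N1 k" if "k \<ge> Suc b" for k
      using that by (cases k) auto
    \<comment> \<open>The bound \<open>j\<close> here is a new variable, while the extended complex
      belongs to the outer \<open>j\<close> through \<open>m\<close>. Induction shifts position and
      degree together, and the outer \<open>j\<close> is inserted at the end, where the position is
      \<open>m\<close>. The start is \<open>ext_vanishes_cosyzygy\<close> at \<open>Suc b\<close>,
      whose syzygy sits two places further.\<close>
    have "ext_vanishes R T1 q1 (im_mod (Fr (S' (Suc (j + Suc (Suc (Suc b)))))) (Fr (S' (j + Suc (Suc (Suc b))))) (d' (j + Suc (Suc (Suc b))))) j" for j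
    proof (induction j)
      case 0
      show ?case
        using ext_vanishes_cosyzygy[where i = "Suc b", OF N1 VN1 T1 dual1 S'(1) ev] by simp
    next
      case (Suc j)
      have "ext_vanishes R T1 q1 (Fr (S' (Suc (j + Suc (Suc (Suc b)))))) (Suc j)"
        by (rule ext_vanishes_free[where d = q1 and S = T1, OF B(1) D1(2) dual1])
      with Suc.IH have "ext_vanishes R T1 q1
          (ker_mod (Fr (S' (Suc (j + Suc (Suc (Suc b)))))) (Fr (S' (j + Suc (Suc (Suc b))))) (d' (j + Suc (Suc (Suc b))))) (Suc j)"
        using ext_vanishes_ker[where d = q1 and S = T1, OF free_module free_module B(2) D1(2,5)] by blast
      then show ?case using B(3)[of "j + Suc (Suc (Suc b))"] by simp
    qed
    from this[of j] show ?thesis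
      using S'(2)[of 0] S'(2)[of "Suc 0"] S'(3)[of 0] by (simp add: m_def S0_def d0_def)
  qed
  \<comment> \<open>Resolving \<open>N1\<close> amounts to dropping the first \<open>n + 1\<close>
    terms of the resolution of \<open>N\<close>, so vanishing in all positive degrees over
    \<open>N1\<close> becomes vanishing from index \<open>Suc n\<close> on over
    \<open>N\<close>.\<close>
  have "ext_vanishes R T q (im_mod (Fr (S (Suc (Suc n)))) (Fr (S (Suc n))) (d (Suc n))) i" if "i \<ge> Suc n" for i
    using MT[of "i - Suc n"] T1_shift that by simp
  then have "ext_vanishes R T q M i" if "i \<ge> Suc n" for i
    using that by (intro ext_vanishes_syzygyD[where S = T and d = q and a = "Suc n" and k = "Suc n",
        OF S(1) mM S(2) DT(2,5)]) (auto simp: dualT)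
  then show ?thesis using ext_eventually_zero_iff[OF T(1) N mM] by blast
qed

end

theorem theorem4p1:
  fixes R :: "'a ring" and M :: "('a, 'm) module" and N :: "('a, 'n) module"
  assumes "AB_ring R" and "fg_module R M" and "fg_module R N"
  shows "ext_eventually_zero R M N \<longleftrightarrow> ext_eventually_zero R N M"
proof -
  have R: "cring R" "noetherian_ring R" "injective_dimension R (regular_module R) < \<infinity>" "ext_index R < \<infinity>"
    using assms(1) unfolding AB_ring_def gorenstein_local_ring_def local_ring_def by auto
  obtain b where b: "ext_index R = enat b" using R(4) by (cases "ext_index R") auto
  obtain n and I :: "nat \<Rightarrow> ('a, ('a + 'a) list set) module" and \<delta> \<iota> where
    res: "injective_resolution R (regular_module R) n I \<delta> \<iota>"
  proof -
    \<comment> \<open>Were the set of lengths empty, its infimum would be infinite; hence a finite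
      injective dimension provides an actual resolution.\<close>
    have "{enat n | n. \<exists>(I :: nat \<Rightarrow> ('a, ('a + 'a) list set) module) d e.
        injective_resolution R (regular_module R) n I d e} \<noteq> {}"
      using R(3) unfolding injective_dimension_def by (metis Inf_enat_def less_irrefl)
    then show ?thesis using that by blast
  qed
  interpret gorenstein_base_ring R n I \<delta> \<iota>
    by (intro gorenstein_base_ring.intro noetherian_base_ring.intro base_ring.intro R(1,2)
        gorenstein_base_ring_axioms.intro res)
  show ?thesis
    using ext_eventually_zero_swap[OF _ assms(2,3), of b] ext_eventually_zero_swap[OF _ assms(3,2), of b] b
    by auto
qed

end
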